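(* Let $p$ be a prime and suppose that $(QIA_p)$ holds. Let $\psi:\mathbb{N}\to\mathbb{R}$ be a non-negative function supported on a set $S\subseteq\mathbb{N}$ for which there exists $N\in\mathbb{N}$ such that $p^{N+1}\nmid n$ for every $n\in S$. Then $\lambda(W_\infty(\psi))=1$ if $\sum_{n\in\mathbb{N}}\lambda(A_n(\psi))=\infty$, and $\lambda(W_\infty(\psi))=0$ otherwise.
   Context: $\lambda$ denotes Lebesgue (Haar probability) measure on $\mathbb{R}/\mathbb{Z}$. For a non-negative $\psi:\mathbb{N}\to\mathbb{R}$ and $n\in\mathbb{N}$, $A_n(\psi)=\bigcup_{1\le a\le n,\ (a,n)=1}[a/n-\psi(n),a/n+\psi(n)]\subseteq\mathbb{R}/\mathbb{Z}$, and $W_\infty(\psi)$ is the set of $x\in\mathbb{R}/\mathbb{Z}$ lying in $A_n(\psi)$ for infinitely many $n$. For a prime $p$, $|\cdot|_p$ is the $p$-adic absolute value, $\mathbb{Z}_p=\{x\in\mathbb{Q}_p:|x|_p\le1\}$, $\mu_p$ is the Haar probability measure on $\mathbb{Z}_p$, and for non-negative $\psi$ and $n\in\mathbb{N}$, $\mathcal{E}_n(\psi)=\bigcup_{-n\le a\le n,\ (a,n)=1}\{x\in\mathbb{Z}_p:|x-a/n|_p\le\psi(n)\}$. We say $(QIA_p,\psi)$ holds if $\limsup_{N\to\infty}\left(\sum_{n\le N}\mu_p(\mathcal{E}_n(\psi))\right)^2\left(\sum_{m,n\le N}\mu_p(\mathcal{E}_m(\psi)\cap\mathcal{E}_n(\psi))\right)^{-1}>0$,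 and we say $(QIA_p)$ holds if $(QIA_p,\psi)$ holds for every non-negative $\psi$ with $\sum_{n\in\mathbb{N}}\mu_p(\mathcal{E}_n(\psi))=\infty$. *)

theory Defs
  imports "HOL-Probability.Probability"
begin

text \<open>
  The circle \<open>\<real>/\<int>\<close> is identified with its fundamental domain \<open>[0,1)\<close>; under this
  identification \<^const>\<open>frac\<close> is the projection from the reals and Lebesgue measure on \<open>[0,1)\<close>
  is the Haar probability measure.
\<close>

definition circle_measure :: "real measure" where
  "circle_measure = lebesgue_on {0..<1}"

definition circle_approx :: "(nat \<Rightarrow> real) \<Rightarrow> nat \<Rightarrow> real set" where
  "circle_approx \<psi> n =
     (\<Union>a\<in>{a. 1 \<le> a \<and> a \<le> n \<and> coprime a n}.
        frac ` {real a / real n - \<psi> n .. real a / real n + \<psi> n})"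

definition circle_limsup :: "(nat \<Rightarrow> real) \<Rightarrow> real set" where
  "circle_limsup \<psi> = {x \<in> {0..<1}. infinite {n. 1 \<le> n \<and> x \<in> circle_approx \<psi> n}}"

definition padic_rat_abs :: "nat \<Rightarrow> rat \<Rightarrow> real" where
  "padic_rat_abs p r = (if r = 0 then 0 else
     real p powi (int (multiplicity (int p) (snd (quotient_of r)))
                  - int (multiplicity (int p) (fst (quotient_of r)))))"

text \<open>
  The field of \<open>p\<close>-adic numbers is the completion of the rationals: Cauchy sequences for
  the \<open>p\<close>-adic absolute value modulo null sequences. As \<open>p\<close> is a variable, it is a carrier
  set rather than a type. Only its additive structure is needed.
\<close>

definition padic_Cauchy :: "nat \<Rightarrow> (nat \<Rightarrow> rat) \<Rightarrow> bool" where
  "padic_Cauchy p X \<longleftrightarrow>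
     (\<forall>e>0. \<exists>N. \<forall>m\<ge>N. \<forall>n\<ge>N. padic_rat_abs p (X m - X n) < e)"

definition padic_rel :: "nat \<Rightarrow> ((nat \<Rightarrow> rat) \<times> (nat \<Rightarrow> rat)) set" where
  "padic_rel p = {(X, Y). padic_Cauchy p X \<and> padic_Cauchy p Y \<and>
     (\<lambda>n. padic_rat_abs p (X n - Y n)) \<longlonglongrightarrow> 0}"

definition Qp :: "nat \<Rightarrow> (nat \<Rightarrow> rat) set set" where
  "Qp p = {X. padic_Cauchy p X} // padic_rel p"

definition padic_of_rat :: "nat \<Rightarrow> rat \<Rightarrow> (nat \<Rightarrow> rat) set" where
  "padic_of_rat p r = padic_rel p `` {\<lambda>_. r}"

definition padic_add :: "nat \<Rightarrow> (nat \<Rightarrow> rat) set \<Rightarrow> (nat \<Rightarrow> rat) set \<Rightarrow> (nat \<Rightarrow> rat) set" where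
  "padic_add p x y = (\<Union>X\<in>x. \<Union>Y\<in>y. padic_rel p `` {\<lambda>n. X n + Y n})"

definition padic_diff :: "nat \<Rightarrow> (nat \<Rightarrow> rat) set \<Rightarrow> (nat \<Rightarrow> rat) set \<Rightarrow> (nat \<Rightarrow> rat) set" where
  "padic_diff p x y = (\<Union>X\<in>x. \<Union>Y\<in>y. padic_rel p `` {\<lambda>n. X n - Y n})"

definition padic_abs :: "nat \<Rightarrow> (nat \<Rightarrow> rat) set \<Rightarrow> real" where
  "padic_abs p x = (THE l. \<forall>X\<in>x. (\<lambda>n. padic_rat_abs p (X n)) \<longlonglongrightarrow> l)"

definition Zp :: "nat \<Rightarrow> (nat \<Rightarrow> rat) set set" where
  "Zp p = {x \<in> Qp p. padic_abs p x \<le> 1}"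

definition Zp_open :: "nat \<Rightarrow> (nat \<Rightarrow> rat) set set \<Rightarrow> bool" where
  "Zp_open p U \<longleftrightarrow> U \<subseteq> Zp p \<and>
     (\<forall>x\<in>U. \<exists>e>0. \<forall>y\<in>Zp p. padic_abs p (padic_diff p y x) < e \<longrightarrow> y \<in> U)"

definition Zp_borel :: "nat \<Rightarrow> (nat \<Rightarrow> rat) set measure" where
  "Zp_borel p = sigma (Zp p) {U. Zp_open p U}"

definition is_Zp_haar :: "nat \<Rightarrow> (nat \<Rightarrow> rat) set measure \<Rightarrow> bool" where
  "is_Zp_haar p M \<longleftrightarrow>
     space M = Zp p \<and> sets M = sets (Zp_borel p) \<and> emeasure M (Zp p) = 1 \<and>
     (\<forall>y\<in>Zp p. \<forall>A\<in>sets M. emeasure M ((\<lambda>x. padic_add p x y) ` A) = emeasure M A)"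

text \<open>Existence and uniqueness are shown in \<open>ex1_Zp_haar\<close>.\<close>

definition Zp_haar :: "nat \<Rightarrow> (nat \<Rightarrow> rat) set measure" where
  "Zp_haar p = (THE M. is_Zp_haar p M)"

definition padic_approx :: "nat \<Rightarrow> (nat \<Rightarrow> real) \<Rightarrow> nat \<Rightarrow> (nat \<Rightarrow> rat) set set" where
  "padic_approx p \<psi> n =
     (\<Union>a\<in>{a::int. - int n \<le> a \<and> a \<le> int n \<and> coprime a (int n)}.
        {x \<in> Zp p. padic_abs p (padic_diff p x (padic_of_rat p (of_int a / of_nat n))) \<le> \<psi> n})"

text \<open>
  The quotient is read with \<open>0 / 0 = 0\<close>; this concerns only those \<open>N\<close> for which all the
  measures in question vanish.
\<close>

definition QIA_for :: "nat \<Rightarrow> (nat \<Rightarrow> real) \<Rightarrow> bool" where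
  "QIA_for p \<psi> \<longleftrightarrow>
     limsup (\<lambda>N. ereal
       ((\<Sum>n=1..N. measure (Zp_haar p) (padic_approx p \<psi> n))\<^sup>2
        / (\<Sum>m=1..N. \<Sum>n=1..N.
             measure (Zp_haar p) (padic_approx p \<psi> m \<inter> padic_approx p \<psi> n)))) > 0"

definition QIA :: "nat \<Rightarrow> bool" where
  "QIA p \<longleftrightarrow>
     (\<forall>\<psi>. (\<forall>n\<ge>1. 0 \<le> \<psi> n) \<longrightarrow>
        (\<Sum>n. emeasure (Zp_haar p) (padic_approx p \<psi> (Suc n))) = \<infinity> \<longrightarrow> QIA_for p \<psi>)"

context
  fixes p :: nat
  assumes prime_p: "prime p"
begin

lemma p_gt_1: "1 < p"
  using prime_p prime_gt_1_nat by blast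

lemma prime_int_p: "prime (int p)"
  using prime_p by simp

lemma powi_p_le_iff: "real p powi i \<le> real p powi j \<longleftrightarrow> i \<le> j"
proof
  assume "i \<le> j"
  thus "real p powi i \<le> real p powi j" using p_gt_1 by (intro power_int_increasing) auto
next
  assume *: "real p powi i \<le> real p powi j"
  show "i \<le> j"
  proof (rule ccontr)
    assume "\<not> i \<le> j"
    hence "real p powi j < real p powi i" using p_gt_1 by (intro power_int_strict_increasing) auto
    with * show False by simp
  qed
qed

lemma padic_rat_abs_0 [simp]: "padic_rat_abs p 0 = 0"
  by (simp add: padic_rat_abs_def)

lemma padic_rat_abs_divide:
  assumes "a \<noteq> 0" "b \<noteq> 0"
  shows "padic_rat_abs p (of_int a / of_int b) =
    real p powi (int (multiplicity (int p) b) - int (multiplicity (int p) a))"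
proof -
  obtain c d where cd: "quotient_of (of_int a / of_int b) = (c, d)" by fastforce
  have d: "d > 0" using cd by (rule quotient_of_denom_pos)
  have eq: "of_int a / of_int b = (of_int c / of_int d :: rat)" using cd by (rule quotient_of_div)
  hence "of_int (a * d) = (of_int (c * b) :: rat)"
    using assms d by (simp add: field_simps)
  hence adcb: "a * d = c * b" using of_int_eq_iff by blast
  hence c: "c \<noteq> 0" using assms d by auto
  have "multiplicity (int p) (a * d) = multiplicity (int p) a + multiplicity (int p) d"
    using assms d prime_int_p by (intro prime_elem_multiplicity_mult_distrib) auto
  moreover have "multiplicity (int p) (c * b) = multiplicity (int p) c + multiplicity (int p) b"
    using assms c prime_int_p by (intro prime_elem_multiplicity_mult_distrib) auto
  ultimately have "int (multiplicity (int p) b) - int (multiplicity (int p) a)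
      = int (multiplicity (int p) d) - int (multiplicity (int p) c)"
    unfolding adcb by linarith
  thus ?thesis using assms cd by (simp add: padic_rat_abs_def)
qed

lemma rat_cases_divide:
  fixes r :: rat
  obtains a b where "r = of_int a / of_int b" "b > 0" "coprime a b"
proof -
  obtain a b where "quotient_of r = (a, b)" by fastforce
  thus ?thesis
    using that quotient_of_denom_pos quotient_of_div quotient_of_coprime by blast
qed

lemma padic_rat_abs_nonneg [simp]: "0 \<le> padic_rat_abs p r"
  by (simp add: padic_rat_abs_def)

lemma padic_rat_abs_pos: "r \<noteq> 0 \<Longrightarrow> 0 < padic_rat_abs p r"
  using p_gt_1 by (simp add: padic_rat_abs_def)

lemma padic_rat_abs_minus: "padic_rat_abs p (- r) = padic_rat_abs p r"
proof (cases "r = 0")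
  case False
  obtain a b where ab: "r = of_int a / of_int b" "b > 0" by (rule rat_cases_divide)
  have "a \<noteq> 0" using False ab by auto
  have "- r = of_int (- a) / of_int b" using ab by simp
  thus ?thesis using padic_rat_abs_divide[of a b] padic_rat_abs_divide[of "- a" b] ab \<open>a \<noteq> 0\<close>
      multiplicity_normalize_right[of "int p" a] multiplicity_normalize_right[of "int p" "- a"]
    by simp
qed simp

lemma padic_rat_abs_diff_commute: "padic_rat_abs p (r - s) = padic_rat_abs p (s - r)"
  using padic_rat_abs_minus[of "r - s"] by simp

lemma padic_rat_abs_add: "padic_rat_abs p (r + s) \<le> max (padic_rat_abs p r) (padic_rat_abs p s)"
proof (cases "r = 0 \<or> s = 0 \<or> r + s = 0")
  case True
  thus ?thesis by (auto simp: max_def)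
next
  case False
  obtain a b where r: "r = of_int a / of_int b" "b > 0" by (rule rat_cases_divide)
  obtain c d where s: "s = of_int c / of_int d" "d > 0" by (rule rat_cases_divide)
  have nz: "a \<noteq> 0" "c \<noteq> 0" "b \<noteq> 0" "d \<noteq> 0" using False r s by auto
  have rs: "r + s = of_int (a * d + c * b) / of_int (b * d)"
    using r s by (simp add: field_simps)
  hence nz': "a * d + c * b \<noteq> 0" using False by (metis div_0 of_int_0)
  define v where "v = multiplicity (int p)"
  have m: "v (x * y) = v x + v y" if "x \<noteq> 0" "y \<noteq> 0" for x y
    unfolding v_def using that prime_int_p by (intro prime_elem_multiplicity_mult_distrib) auto
  have "min (v (a * d)) (v (c * b)) \<le> v (a * d + c * b)"
  proof -
    have "int p ^ min (v (a * d)) (v (c * b)) dvd a * d + c * b"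
      by (intro dvd_add) (auto simp: v_def intro!: multiplicity_dvd')
    thus ?thesis
      unfolding v_def using nz' prime_int_p by (intro multiplicity_geI) auto
  qed
  hence *: "v a + v d \<le> v (a * d + c * b) \<or> v c + v b \<le> v (a * d + c * b)"
    using m nz by (auto simp: min_def split: if_splits)
  have "padic_rat_abs p (r + s) = real p powi (int (v b + v d) - int (v (a * d + c * b)))"
    unfolding rs using padic_rat_abs_divide[OF nz', of "b * d"] nz m[of b d] by (simp add: v_def)
  moreover have "padic_rat_abs p r = real p powi (int (v b) - int (v a))"
    unfolding r using padic_rat_abs_divide nz by (simp add: v_def)
  moreover have "padic_rat_abs p s = real p powi (int (v d) - int (v c))"
    unfolding s using padic_rat_abs_divide nz by (simp add: v_def)
  ultimately show ?thesis
    unfolding le_max_iff_disj using * by (auto simp: powi_p_le_iff)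
qed

lemma padic_rat_abs_diff: "padic_rat_abs p (r - s) \<le> max (padic_rat_abs p r) (padic_rat_abs p s)"
  using padic_rat_abs_add[of r "- s"] by (simp add: padic_rat_abs_minus)

lemma padic_rat_abs_add_le: "padic_rat_abs p (r + s) \<le> padic_rat_abs p r + padic_rat_abs p s"
  using padic_rat_abs_add[of r s] padic_rat_abs_nonneg[of r] padic_rat_abs_nonneg[of s] by linarith

lemma padic_rat_abs_diff_le: "padic_rat_abs p (r - s) \<le> padic_rat_abs p r + padic_rat_abs p s"
  using padic_rat_abs_add_le[of r "- s"] by (simp add: padic_rat_abs_minus)

lemma padic_rat_abs_abs_diff:
  "\<bar>padic_rat_abs p r - padic_rat_abs p s\<bar> \<le> padic_rat_abs p (r - s)"
  using padic_rat_abs_add_le[of "r - s" s] padic_rat_abs_add_le[of "s - r" r]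
    padic_rat_abs_diff_commute[of r s] by simp

lemma padic_rat_abs_of_int_le_iff:
  "padic_rat_abs p (of_int a) \<le> 1 / real p ^ k \<longleftrightarrow> int p ^ k dvd a"
proof (cases "a = 0")
  case False
  have "padic_rat_abs p (of_int a) = real p powi (- int (multiplicity (int p) a))"
    using padic_rat_abs_divide[OF False, of 1] by simp
  moreover have "1 / real p ^ k = real p powi (- int k)"
    by (simp add: power_int_minus_divide)
  ultimately have "padic_rat_abs p (of_int a) \<le> 1 / real p ^ k \<longleftrightarrow> k \<le> multiplicity (int p) a"
    by (simp add: powi_p_le_iff)
  also have "\<dots> \<longleftrightarrow> int p ^ k dvd a"
    using False prime_int_p by (subst power_dvd_iff_le_multiplicity) auto
  finally show ?thesis .
qed simp

lemma padic_rat_residue: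
  assumes "padic_rat_abs p r \<le> 1"
  shows "\<exists>c<p ^ k. padic_rat_abs p (r - of_nat c) \<le> 1 / real p ^ k"
proof -
  obtain a b where r: "r = of_int a / of_int b" "b > 0" "coprime a b" by (rule rat_cases_divide)
  have pb: "\<not> int p dvd b"
  proof (cases "a = 0")
    case True
    hence "b = 1" using r by simp
    thus ?thesis using p_gt_1 by simp
  next
    case False
    show ?thesis
    proof
      assume "int p dvd b"
      have "real p powi (int (multiplicity (int p) b) - int (multiplicity (int p) a)) \<le> real p powi 0"
        using assms r padic_rat_abs_divide[OF False, of b] by simp
      hence le: "multiplicity (int p) b \<le> multiplicity (int p) a"
        unfolding powi_p_le_iff by simp
      have "multiplicity (int p) b \<ge> 1"
        using \<open>int p dvd b\<close> r prime_int_p by (intro multiplicity_geI) auto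
      hence "int p ^ 1 dvd a" using le by (intro multiplicity_dvd') auto
      hence "int p dvd a" by simp
      with \<open>int p dvd b\<close> r(3) have "is_unit (int p)" by (meson coprime_common_divisor)
      thus False using p_gt_1 by simp
    qed
  qed
  hence "coprime b (int p ^ k)"
    using prime_int_p by (metis coprime_commute coprime_power_left_iff prime_imp_coprime)
  moreover obtain u v where "u * b + v * int p ^ k = gcd b (int p ^ k)"
    using bezout_int by blast
  ultimately have "b * u - 1 = int p ^ k * (- v)" by (simp add: algebra_simps)
  then obtain t where t: "int p ^ k dvd b * t - 1" by (metis dvd_triv_left)
  define c where "c = nat ((a * t) mod int p ^ k)"
  have pk: "0 < int p ^ k" using p_gt_1 by simp
  have c: "int c = (a * t) mod int p ^ k" using pk by (simp add: c_def)
  have "int c < int p ^ k" using pk c by simp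
  hence "c < p ^ k" by (simp flip: of_nat_power)
  moreover have "padic_rat_abs p (r - of_nat c) \<le> 1 / real p ^ k"
  proof (cases "a - b * int c = 0")
    case True
    hence "a = b * int c" by simp
    hence "(of_int a :: rat) = of_int b * of_nat c" by simp
    hence "r - of_nat c = 0" using r by (simp add: field_simps)
    thus ?thesis by simp
  next
    case False
    have "int p ^ k dvd a * t - int c" unfolding c by (simp add: dvd_minus_mod)
    hence "int p ^ k dvd b * (a * t - int c) - a * (b * t - 1)"
      using t by (metis dvd_diff dvd_mult)
    hence dvd: "int p ^ k dvd a - b * int c" by (simp add: algebra_simps)
    have "r - of_nat c = of_int (a - b * int c) / of_int b"
      using r by (simp add: field_simps)
    hence "padic_rat_abs p (r - of_nat c) =
      real p powi (int (multiplicity (int p) b) - int (multiplicity (int p) (a - b * int c)))"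
      using padic_rat_abs_divide[OF False, of b] r by simp
    also have "multiplicity (int p) b = 0" using pb by (rule not_dvd_imp_multiplicity_0)
    also have "real p powi (int 0 - int (multiplicity (int p) (a - b * int c))) \<le> real p powi (- int k)"
      unfolding powi_p_le_iff using multiplicity_geI[OF False _ dvd] p_gt_1 by auto
    finally show ?thesis by (simp add: power_int_minus_divide)
  qed
  ultimately show ?thesis by blast
qed

lemma padic_Cauchy_const [simp]: "padic_Cauchy p (\<lambda>_. r)"
  by (simp add: padic_Cauchy_def)

lemma padic_Cauchy_add:
  assumes "padic_Cauchy p X" "padic_Cauchy p Y"
  shows "padic_Cauchy p (\<lambda>n. X n + Y n)"
  unfolding padic_Cauchy_def
proof (intro allI impI)
  fix e :: real assume "e > 0"
  obtain M where M: "\<And>m n. m \<ge> M \<Longrightarrow> n \<ge> M \<Longrightarrow> padic_rat_abs p (X m - X n) < e"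
    using assms(1) \<open>e > 0\<close> unfolding padic_Cauchy_def by blast
  obtain N where N: "\<And>m n. m \<ge> N \<Longrightarrow> n \<ge> N \<Longrightarrow> padic_rat_abs p (Y m - Y n) < e"
    using assms(2) \<open>e > 0\<close> unfolding padic_Cauchy_def by blast
  show "\<exists>N. \<forall>m\<ge>N. \<forall>n\<ge>N. padic_rat_abs p (X m + Y m - (X n + Y n)) < e"
  proof (intro exI[of _ "max M N"] allI impI)
    fix m n assume "max M N \<le> m" "max M N \<le> n"
    hence "padic_rat_abs p (X m - X n) < e" "padic_rat_abs p (Y m - Y n) < e"
      using M N by auto
    thus "padic_rat_abs p (X m + Y m - (X n + Y n)) < e"
      using padic_rat_abs_add[of "X m - X n" "Y m - Y n"]
      by (simp add: algebra_simps max_def split: if_splits)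
  qed
qed

lemma padic_Cauchy_minus:
  assumes "padic_Cauchy p X"
  shows "padic_Cauchy p (\<lambda>n. - X n)"
proof -
  have "padic_rat_abs p (- X m - - X n) = padic_rat_abs p (X m - X n)" for m n
    using padic_rat_abs_minus[of "X m - X n"] by simp
  thus ?thesis using assms unfolding padic_Cauchy_def by simp
qed

lemma padic_Cauchy_diff:
  assumes "padic_Cauchy p X" "padic_Cauchy p Y"
  shows "padic_Cauchy p (\<lambda>n. X n - Y n)"
  using padic_Cauchy_add[OF assms(1) padic_Cauchy_minus[OF assms(2)]] by simp

lemma padic_null_add:
  assumes "(\<lambda>n. padic_rat_abs p (X n)) \<longlonglongrightarrow> 0" "(\<lambda>n. padic_rat_abs p (Y n)) \<longlonglongrightarrow> 0"
  shows "(\<lambda>n. padic_rat_abs p (X n + Y n)) \<longlonglongrightarrow> 0"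
proof (rule tendsto_sandwich[OF _ _ tendsto_const])
  show "(\<lambda>n. padic_rat_abs p (X n) + padic_rat_abs p (Y n)) \<longlonglongrightarrow> 0"
    using tendsto_add[OF assms] by simp
qed (auto intro!: always_eventually padic_rat_abs_add_le)

lemma padic_null_diff:
  assumes "(\<lambda>n. padic_rat_abs p (X n)) \<longlonglongrightarrow> 0" "(\<lambda>n. padic_rat_abs p (Y n)) \<longlonglongrightarrow> 0"
  shows "(\<lambda>n. padic_rat_abs p (X n - Y n)) \<longlonglongrightarrow> 0"
  using padic_null_add[of X "\<lambda>n. - Y n"] assms by (simp add: padic_rat_abs_minus)

lemma padic_rel_iff:
  "(X, Y) \<in> padic_rel p \<longleftrightarrow> padic_Cauchy p X \<and> padic_Cauchy p Y \<and>
     (\<lambda>n. padic_rat_abs p (X n - Y n)) \<longlonglongrightarrow> 0"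
  by (simp add: padic_rel_def)

lemma equiv_padic_rel: "equiv {X. padic_Cauchy p X} (padic_rel p)"
proof (rule equivI)
  show "refl_on {X. padic_Cauchy p X} (padic_rel p)"
    by (auto simp: refl_on_def padic_rel_iff)
  show "sym (padic_rel p)"
    by (auto simp: sym_def padic_rel_iff padic_rat_abs_diff_commute)
  show "trans (padic_rel p)"
  proof (rule transI)
    fix X Y Z assume "(X, Y) \<in> padic_rel p" "(Y, Z) \<in> padic_rel p"
    thus "(X, Z) \<in> padic_rel p"
      using padic_null_add[of "\<lambda>n. X n - Y n" "\<lambda>n. Y n - Z n"] by (auto simp: padic_rel_iff)
  qed
  show "padic_rel p \<subseteq> {X. padic_Cauchy p X} \<times> {X. padic_Cauchy p X}"
    by (auto simp: padic_rel_iff)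
qed

definition padic_class :: "(nat \<Rightarrow> rat) \<Rightarrow> (nat \<Rightarrow> rat) set" where
  "padic_class X = padic_rel p `` {X}"

lemma padic_class_in_Qp: "padic_Cauchy p X \<Longrightarrow> padic_class X \<in> Qp p"
  by (auto simp: padic_class_def Qp_def intro: quotientI)

lemma Qp_cases:
  assumes "x \<in> Qp p"
  obtains X where "padic_Cauchy p X" "x = padic_class X"
  using assms by (auto simp: padic_class_def Qp_def elim: quotientE)

lemma padic_class_eq_iff:
  assumes "padic_Cauchy p X" "padic_Cauchy p Y"
  shows "padic_class X = padic_class Y \<longleftrightarrow> (\<lambda>n. padic_rat_abs p (X n - Y n)) \<longlonglongrightarrow> 0"
  unfolding padic_class_def using eq_equiv_class_iff[OF equiv_padic_rel, of X Y] assms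
  by (simp add: padic_rel_iff)

lemma padic_of_rat_class: "padic_of_rat p r = padic_class (\<lambda>_. r)"
  by (simp add: padic_of_rat_def padic_class_def)

lemma padic_class_binop:
  assumes "padic_Cauchy p X" "padic_Cauchy p Y"
    and C: "\<And>X Y. padic_Cauchy p X \<Longrightarrow> padic_Cauchy p Y \<Longrightarrow> padic_Cauchy p (\<lambda>n. f (X n) (Y n))"
    and f: "\<And>X Y X' Y'. (\<lambda>n. padic_rat_abs p (X n - X' n)) \<longlonglongrightarrow> 0 \<Longrightarrow>
              (\<lambda>n. padic_rat_abs p (Y n - Y' n)) \<longlonglongrightarrow> 0 \<Longrightarrow>
              (\<lambda>n. padic_rat_abs p (f (X n) (Y n) - f (X' n) (Y' n))) \<longlonglongrightarrow> 0"
  shows "(\<Union>X\<in>padic_class X. \<Union>Y\<in>padic_class Y. padic_rel p `` {\<lambda>n. f (X n) (Y n)})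
    = padic_class (\<lambda>n. f (X n) (Y n))"
proof -
  have eq: "padic_rel p `` {\<lambda>n. f (X' n) (Y' n)} = padic_class (\<lambda>n. f (X n) (Y n))"
    if "X' \<in> padic_class X" "Y' \<in> padic_class Y" for X' Y'
  proof -
    have X': "padic_Cauchy p X'" "(\<lambda>n. padic_rat_abs p (X' n - X n)) \<longlonglongrightarrow> 0"
      and Y': "padic_Cauchy p Y'" "(\<lambda>n. padic_rat_abs p (Y' n - Y n)) \<longlonglongrightarrow> 0"
      using that by (auto simp: padic_class_def padic_rel_iff padic_rat_abs_diff_commute)
    show ?thesis
      using padic_class_eq_iff[OF C[OF X'(1) Y'(1)] C[OF assms(1,2)]] f[OF X'(2) Y'(2)]
      by (simp add: padic_class_def)
  qed
  have "X \<in> padic_class X" "Y \<in> padic_class Y"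
    using assms(1,2) by (auto simp: padic_class_def padic_rel_iff)
  thus ?thesis using eq by blast
qed

lemma padic_add_class:
  assumes "padic_Cauchy p X" "padic_Cauchy p Y"
  shows "padic_add p (padic_class X) (padic_class Y) = padic_class (\<lambda>n. X n + Y n)"
  unfolding padic_add_def
proof (rule padic_class_binop[OF assms padic_Cauchy_add], assumption, assumption)
  fix X Y X' Y' :: "nat \<Rightarrow> rat"
  assume "(\<lambda>n. padic_rat_abs p (X n - X' n)) \<longlonglongrightarrow> 0"
    "(\<lambda>n. padic_rat_abs p (Y n - Y' n)) \<longlonglongrightarrow> 0"
  from padic_null_add[OF this]
  show "(\<lambda>n. padic_rat_abs p (X n + Y n - (X' n + Y' n))) \<longlonglongrightarrow> 0"
    by (simp add: algebra_simps)
qed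

lemma padic_diff_class:
  assumes "padic_Cauchy p X" "padic_Cauchy p Y"
  shows "padic_diff p (padic_class X) (padic_class Y) = padic_class (\<lambda>n. X n - Y n)"
  unfolding padic_diff_def
proof (rule padic_class_binop[OF assms padic_Cauchy_diff], assumption, assumption)
  fix X Y X' Y' :: "nat \<Rightarrow> rat"
  assume "(\<lambda>n. padic_rat_abs p (X n - X' n)) \<longlonglongrightarrow> 0"
    "(\<lambda>n. padic_rat_abs p (Y n - Y' n)) \<longlonglongrightarrow> 0"
  from padic_null_diff[OF this]
  show "(\<lambda>n. padic_rat_abs p (X n - Y n - (X' n - Y' n))) \<longlonglongrightarrow> 0"
    by (simp add: algebra_simps)
qed

lemma padic_abs_class:
  assumes "padic_Cauchy p X"
  shows "(\<lambda>n. padic_rat_abs p (X n)) \<longlonglongrightarrow> padic_abs p (padic_class X)"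
proof -
  have "Cauchy (\<lambda>n. padic_rat_abs p (X n))"
  proof (rule metric_CauchyI)
    fix e :: real assume "e > 0"
    then obtain M where M: "\<And>m n. m \<ge> M \<Longrightarrow> n \<ge> M \<Longrightarrow> padic_rat_abs p (X m - X n) < e"
      using assms unfolding padic_Cauchy_def by blast
    show "\<exists>M. \<forall>m\<ge>M. \<forall>n\<ge>M. dist (padic_rat_abs p (X m)) (padic_rat_abs p (X n)) < e"
      unfolding dist_real_def using M padic_rat_abs_abs_diff le_less_trans by blast
  qed
  then obtain l where l: "(\<lambda>n. padic_rat_abs p (X n)) \<longlonglongrightarrow> l"
    using Cauchy_convergent convergent_def by blast
  have l': "(\<lambda>n. padic_rat_abs p (Y n)) \<longlonglongrightarrow> l" if "Y \<in> padic_class X" for Y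
  proof -
    have "(\<lambda>n. padic_rat_abs p (X n - Y n)) \<longlonglongrightarrow> 0"
      using that by (auto simp: padic_class_def padic_rel_iff)
    hence "(\<lambda>n. padic_rat_abs p (X n) - padic_rat_abs p (Y n)) \<longlonglongrightarrow> 0"
      by (rule Lim_null_comparison[OF always_eventually, rotated])
        (simp add: padic_rat_abs_abs_diff)
    from tendsto_diff[OF l this] show ?thesis by simp
  qed
  have X: "X \<in> padic_class X"
    using assms by (auto simp: padic_class_def padic_rel_iff)
  have "padic_abs p (padic_class X) = l"
    unfolding padic_abs_def
  proof (rule the_equality)
    fix l2 assume "\<forall>Y\<in>padic_class X. (\<lambda>n. padic_rat_abs p (Y n)) \<longlonglongrightarrow> l2"
    thus "l2 = l" using X l LIMSEQ_unique by blast
  qed (use l' in blast)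
  thus ?thesis using l by simp
qed

lemma padic_abs_class_le:
  assumes "padic_Cauchy p X" "\<And>n. n \<ge> N \<Longrightarrow> padic_rat_abs p (X n) \<le> c"
  shows "padic_abs p (padic_class X) \<le> c"
  using padic_abs_class[OF assms(1)] assms(2) by (meson Lim_bounded)

lemma padic_abs_of_rat: "padic_abs p (padic_of_rat p r) = padic_rat_abs p r"
  using padic_abs_class[of "\<lambda>_. r"] LIMSEQ_unique tendsto_const
  unfolding padic_of_rat_class by (metis padic_Cauchy_const)

lemma padic_of_rat_in_Qp: "padic_of_rat p r \<in> Qp p"
  unfolding padic_of_rat_class by (simp add: padic_class_in_Qp)

lemma padic_add_in_Qp: "x \<in> Qp p \<Longrightarrow> y \<in> Qp p \<Longrightarrow> padic_add p x y \<in> Qp p"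
  by (metis Qp_cases padic_Cauchy_add padic_add_class padic_class_in_Qp)

lemma padic_diff_in_Qp: "x \<in> Qp p \<Longrightarrow> y \<in> Qp p \<Longrightarrow> padic_diff p x y \<in> Qp p"
  by (metis Qp_cases padic_Cauchy_diff padic_diff_class padic_class_in_Qp)

lemma padic_diff_add_cancel:
  assumes "x \<in> Qp p" "y \<in> Qp p"
  shows "padic_add p (padic_diff p x y) y = x" "padic_diff p (padic_add p x y) y = x"
  using assms by (auto elim!: Qp_cases simp: padic_add_class padic_diff_class padic_Cauchy_diff
      padic_Cauchy_add)

lemma padic_diff_diff:
  assumes "x \<in> Qp p" "y \<in> Qp p" "z \<in> Qp p"
  shows "padic_diff p (padic_diff p x y) z = padic_diff p x (padic_add p z y)"
  using assms by (auto elim!: Qp_cases simp: padic_add_class padic_diff_class padic_Cauchy_diff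
      padic_Cauchy_add algebra_simps)

lemma padic_add_commute:
  assumes "x \<in> Qp p" "y \<in> Qp p"
  shows "padic_add p x y = padic_add p y x"
  using assms by (auto elim!: Qp_cases simp: padic_add_class add.commute)

lemma padic_add_0:
  assumes "x \<in> Qp p"
  shows "padic_add p (padic_of_rat p 0) x = x"
  using assms by (auto elim!: Qp_cases simp: padic_add_class padic_of_rat_class)

lemma padic_diff_of_rat:
  "padic_diff p (padic_of_rat p r) (padic_of_rat p s) = padic_of_rat p (r - s)"
  by (simp add: padic_diff_class padic_of_rat_class)

lemma padic_diff_self:
  assumes "x \<in> Qp p"
  shows "padic_diff p x x = padic_of_rat p 0"
  using assms by (auto elim!: Qp_cases simp: padic_diff_class padic_of_rat_class)

lemma padic_abs_nonneg: "x \<in> Qp p \<Longrightarrow> 0 \<le> padic_abs p x"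
  by (elim Qp_cases) (auto intro!: LIMSEQ_le_const[OF padic_abs_class])

lemma padic_abs_add:
  assumes "x \<in> Qp p" "y \<in> Qp p"
  shows "padic_abs p (padic_add p x y) \<le> max (padic_abs p x) (padic_abs p y)"
proof -
  obtain X Y where X: "padic_Cauchy p X" "x = padic_class X"
    and Y: "padic_Cauchy p Y" "y = padic_class Y" using assms by (metis Qp_cases)
  have "(\<lambda>n. padic_rat_abs p (X n + Y n)) \<longlonglongrightarrow> padic_abs p (padic_add p x y)"
    using X Y padic_abs_class[OF padic_Cauchy_add[OF X(1) Y(1)]] by (simp add: padic_add_class)
  moreover have "(\<lambda>n. max (padic_rat_abs p (X n)) (padic_rat_abs p (Y n)))
      \<longlonglongrightarrow> max (padic_abs p x) (padic_abs p y)"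
    using X Y by (intro tendsto_max) (simp_all add: padic_abs_class)
  ultimately show ?thesis by (rule LIMSEQ_le) (auto intro: padic_rat_abs_add)
qed

lemma padic_abs_diff_commute:
  assumes "x \<in> Qp p" "y \<in> Qp p"
  shows "padic_abs p (padic_diff p x y) = padic_abs p (padic_diff p y x)"
proof -
  obtain X Y where X: "padic_Cauchy p X" "x = padic_class X"
    and Y: "padic_Cauchy p Y" "y = padic_class Y" using assms by (metis Qp_cases)
  have "(\<lambda>n. padic_rat_abs p (X n - Y n)) \<longlonglongrightarrow> padic_abs p (padic_diff p x y)"
    using X Y padic_abs_class[OF padic_Cauchy_diff[OF X(1) Y(1)]] by (simp add: padic_diff_class)
  moreover have "(\<lambda>n. padic_rat_abs p (X n - Y n)) \<longlonglongrightarrow> padic_abs p (padic_diff p y x)"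
    using X Y padic_abs_class[OF padic_Cauchy_diff[OF Y(1) X(1)]]
    by (simp add: padic_diff_class padic_rat_abs_diff_commute)
  ultimately show ?thesis by (rule LIMSEQ_unique)
qed

lemma padic_abs_diff_triangle:
  assumes "x \<in> Qp p" "y \<in> Qp p" "z \<in> Qp p"
  shows "padic_abs p (padic_diff p x z)
    \<le> max (padic_abs p (padic_diff p x y)) (padic_abs p (padic_diff p y z))"
proof -
  have "padic_add p (padic_diff p x y) (padic_diff p y z) = padic_diff p x z"
    using assms by (auto elim!: Qp_cases simp: padic_add_class padic_diff_class padic_Cauchy_diff)
  thus ?thesis
    using padic_abs_add[of "padic_diff p x y" "padic_diff p y z"] assms
    by (simp add: padic_diff_in_Qp)
qed

lemma padic_abs_diff_le:
  assumes "x \<in> Qp p" "y \<in> Qp p"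
  shows "padic_abs p (padic_diff p x y) \<le> max (padic_abs p x) (padic_abs p y)"
proof -
  have z: "padic_of_rat p 0 \<in> Qp p" by (rule padic_of_rat_in_Qp)
  have "padic_diff p w (padic_of_rat p 0) = w" if "w \<in> Qp p" for w
    using that by (auto elim!: Qp_cases simp: padic_diff_class padic_of_rat_class)
  thus ?thesis
    using padic_abs_diff_triangle[OF assms(1) z assms(2)] padic_abs_diff_commute[OF z assms(2)] assms
    by simp
qed

lemma Zp_subset_Qp: "Zp p \<subseteq> Qp p" by (auto simp: Zp_def)

lemma Zp_add: "x \<in> Zp p \<Longrightarrow> y \<in> Zp p \<Longrightarrow> padic_add p x y \<in> Zp p"
  using padic_abs_add[of x y] by (auto simp: Zp_def padic_add_in_Qp)

lemma Zp_diff: "x \<in> Zp p \<Longrightarrow> y \<in> Zp p \<Longrightarrow> padic_diff p x y \<in> Zp p"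
  using padic_abs_diff_le[of x y] by (auto simp: Zp_def padic_diff_in_Qp)

lemma Zp_of_nat: "padic_of_rat p (of_nat c) \<in> Zp p"
  using padic_rat_abs_of_int_le_iff[of "int c" 0]
  by (simp add: Zp_def padic_of_rat_in_Qp padic_abs_of_rat)

lemma Zp_residue:
  assumes "x \<in> Zp p"
  shows "\<exists>c<p ^ k. padic_abs p (padic_diff p x (padic_of_rat p (of_nat c))) \<le> 1 / real p ^ k"
proof -
  obtain X where X: "padic_Cauchy p X" "x = padic_class X"
    using assms Zp_subset_Qp Qp_cases by blast
  have pk: "0 < 1 / real p ^ k" using p_gt_1 by simp
  obtain M where M: "\<And>m n. m \<ge> M \<Longrightarrow> n \<ge> M \<Longrightarrow> padic_rat_abs p (X m - X n) < 1 / real p ^ k"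
    using X(1) pk unfolding padic_Cauchy_def by blast
  have "(\<lambda>n. padic_rat_abs p (X n)) \<longlonglongrightarrow> padic_abs p x" using X padic_abs_class by simp
  moreover have "padic_abs p x < real p" using assms p_gt_1 by (auto simp: Zp_def)
  ultimately have "eventually (\<lambda>n. padic_rat_abs p (X n) < real p) sequentially"
    by (rule order_tendstoD)
  then obtain N0 where N0: "\<And>n. n \<ge> N0 \<Longrightarrow> padic_rat_abs p (X n) < real p"
    unfolding eventually_sequentially by blast
  define N where "N = max M N0"
  have N: "N \<ge> M" "padic_rat_abs p (X N) < real p" using N0 by (auto simp: N_def)
  have "padic_rat_abs p (X N) \<le> 1"
  proof (cases "X N = 0")
    case False
    then obtain i where i: "padic_rat_abs p (X N) = real p powi i" by (simp add: padic_rat_abs_def)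
    hence "\<not> real p powi 1 \<le> real p powi i" using N by simp
    hence "i \<le> 0" unfolding powi_p_le_iff by simp
    hence "real p powi i \<le> real p powi 0" unfolding powi_p_le_iff .
    thus ?thesis using i by simp
  qed simp
  then obtain c where c: "c < p ^ k" "padic_rat_abs p (X N - of_nat c) \<le> 1 / real p ^ k"
    using padic_rat_residue by blast
  have "padic_rat_abs p (X n - of_nat c) \<le> 1 / real p ^ k" if "n \<ge> N" for n
  proof -
    have "padic_rat_abs p (X n - X N) < 1 / real p ^ k" using M that N by simp
    thus ?thesis using c padic_rat_abs_add[of "X n - X N" "X N - of_nat c"] by simp
  qed
  hence "padic_abs p (padic_class (\<lambda>n. X n - of_nat c)) \<le> 1 / real p ^ k"
    using padic_abs_class_le[OF padic_Cauchy_diff[OF X(1) padic_Cauchy_const]] by blast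
  hence "padic_abs p (padic_diff p x (padic_of_rat p (of_nat c))) \<le> 1 / real p ^ k"
    using X by (simp add: padic_diff_class padic_of_rat_class)
  thus ?thesis using c by blast
qed

definition Zp_ball :: "nat \<Rightarrow> (nat \<Rightarrow> rat) set \<Rightarrow> (nat \<Rightarrow> rat) set set" where
  "Zp_ball k z = {x \<in> Zp p. padic_abs p (padic_diff p x z) \<le> 1 / real p ^ k}"

definition Zp_balls :: "(nat \<Rightarrow> rat) set set set" where
  "Zp_balls = insert {} {Zp_ball k z | k z. z \<in> Zp p}"

lemma Zp_ball_self: "z \<in> Zp p \<Longrightarrow> z \<in> Zp_ball k z"
  using Zp_subset_Qp padic_rat_abs_of_int_le_iff[of 0 k] padic_abs_of_rat[of 0]
  by (auto simp: Zp_ball_def padic_diff_self)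

lemma Zp_ball_eq:
  assumes "z \<in> Zp p" "w \<in> Zp_ball k z"
  shows "Zp_ball k w = Zp_ball k z"
proof -
  have Q: "z \<in> Qp p" "w \<in> Qp p" "w \<in> Zp p"
    and d: "padic_abs p (padic_diff p w z) \<le> 1 / real p ^ k"
    using assms Zp_subset_Qp by (auto simp: Zp_ball_def)
  have d': "padic_abs p (padic_diff p z w) \<le> 1 / real p ^ k"
    using d padic_abs_diff_commute[OF Q(1,2)] by simp
  have "padic_abs p (padic_diff p x w) \<le> 1 / real p ^ k
      \<longleftrightarrow> padic_abs p (padic_diff p x z) \<le> 1 / real p ^ k" if "x \<in> Zp p" for x
  proof -
    have "x \<in> Qp p" using that Zp_subset_Qp by blast
    from padic_abs_diff_triangle[OF this Q(1,2)] padic_abs_diff_triangle[OF this Q(2,1)] d d'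
    show ?thesis by linarith
  qed
  thus ?thesis by (auto simp: Zp_ball_def)
qed

lemma Zp_ball_mono: "k \<le> l \<Longrightarrow> Zp_ball l z \<subseteq> Zp_ball k z"
proof -
  assume "k \<le> l"
  hence "1 / real p ^ l \<le> 1 / real p ^ k"
    using p_gt_1 by (simp add: frac_le power_increasing)
  thus ?thesis by (auto simp: Zp_ball_def)
qed

lemma Zp_ball_residue:
  assumes "z \<in> Zp p"
  shows "\<exists>c<p ^ k. Zp_ball k z = Zp_ball k (padic_of_rat p (of_nat c))"
proof -
  obtain c where c: "c < p ^ k" "padic_abs p (padic_diff p z (padic_of_rat p (of_nat c))) \<le> 1 / real p ^ k"
    using Zp_residue[OF assms] by blast
  hence "z \<in> Zp_ball k (padic_of_rat p (of_nat c))" using assms by (simp add: Zp_ball_def)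
  thus ?thesis using Zp_ball_eq[OF Zp_of_nat] c by blast
qed

lemma Zp_eq_Union_ball: "Zp p = (\<Union>c<p ^ k. Zp_ball k (padic_of_rat p (of_nat c)))"
proof
  show "Zp p \<subseteq> (\<Union>c<p ^ k. Zp_ball k (padic_of_rat p (of_nat c)))"
  proof
    fix x assume x: "x \<in> Zp p"
    obtain c where "c < p ^ k" "padic_abs p (padic_diff p x (padic_of_rat p (of_nat c))) \<le> 1 / real p ^ k"
      using Zp_residue[OF x] by blast
    thus "x \<in> (\<Union>c<p ^ k. Zp_ball k (padic_of_rat p (of_nat c)))"
      using x by (auto simp: Zp_ball_def)
  qed
qed (auto simp: Zp_ball_def)

lemma of_nat_in_ball_iff:
  "padic_of_rat p (of_nat b) \<in> Zp_ball k (padic_of_rat p (of_nat c))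
    \<longleftrightarrow> int p ^ k dvd int b - int c"
proof -
  have "(of_nat b - of_nat c :: rat) = of_int (int b - int c)" by simp
  hence "padic_rat_abs p (of_nat b - of_nat c) \<le> 1 / real p ^ k \<longleftrightarrow> int p ^ k dvd int b - int c"
    using padic_rat_abs_of_int_le_iff[of "int b - int c" k] by (simp only:)
  thus ?thesis
    by (simp add: Zp_ball_def Zp_of_nat padic_diff_of_rat padic_abs_of_rat)
qed

lemma disjoint_Zp_ball:
  "disjoint_family_on (\<lambda>c. Zp_ball k (padic_of_rat p (of_nat c))) {..<p ^ k}"
proof (unfold disjoint_family_on_def, intro ballI impI)
  fix b c assume bc: "b \<in> {..<p ^ k}" "c \<in> {..<p ^ k}" "b \<noteq> c"
  show "Zp_ball k (padic_of_rat p (of_nat b)) \<inter> Zp_ball k (padic_of_rat p (of_nat c)) = {}"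
  proof (rule ccontr)
    assume "\<not> ?thesis"
    then obtain x where x: "x \<in> Zp_ball k (padic_of_rat p (of_nat b))"
      "x \<in> Zp_ball k (padic_of_rat p (of_nat c))" by blast
    hence "Zp_ball k (padic_of_rat p (of_nat b)) = Zp_ball k (padic_of_rat p (of_nat c))"
      using Zp_ball_eq Zp_of_nat by metis
    hence "padic_of_rat p (of_nat b) \<in> Zp_ball k (padic_of_rat p (of_nat c))"
      using Zp_ball_self Zp_of_nat by blast
    hence "int p ^ k dvd int b - int c" by (simp only: of_nat_in_ball_iff)
    hence "int b mod int p ^ k = int c mod int p ^ k" by (simp add: mod_eq_dvd_iff)
    moreover have "int b < int p ^ k" "int c < int p ^ k"
      using bc by (simp_all flip: of_nat_power)
    ultimately show False using bc by simp
  qed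
qed

lemma Zp_ball_open:
  assumes z: "z \<in> Zp p"
  shows "Zp_open p (Zp_ball k z)"
  unfolding Zp_open_def
proof (intro conjI ballI)
  fix x assume x: "x \<in> Zp_ball k z"
  have "y \<in> Zp_ball k z" if "y \<in> Zp p" "padic_abs p (padic_diff p y x) < 1 / real p ^ k" for y
  proof -
    have "y \<in> Zp_ball k x" using that unfolding Zp_ball_def by simp
    thus ?thesis using Zp_ball_eq[OF z x] by simp
  qed
  moreover have "0 < 1 / real p ^ k" using p_gt_1 by simp
  ultimately show "\<exists>e>0. \<forall>y\<in>Zp p. padic_abs p (padic_diff p y x) < e \<longrightarrow> y \<in> Zp_ball k z"
    by blast
qed (auto simp: Zp_ball_def)

lemma Zp_balls_subset: "Zp_balls \<subseteq> Pow (Zp p)"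
  by (auto simp: Zp_balls_def Zp_ball_def)

lemma empty_in_Zp_balls: "{} \<in> Zp_balls"
  by (simp add: Zp_balls_def)

lemma Zp_ball_in_Zp_balls: "z \<in> Zp p \<Longrightarrow> Zp_ball k z \<in> Zp_balls"
  unfolding Zp_balls_def by blast

lemma Zp_balls_cases:
  assumes "B \<in> Zp_balls"
  obtains "B = {}" | k z where "B = Zp_ball k z" "z \<in> Zp p"
  using assms unfolding Zp_balls_def by blast

lemma Int_stable_Zp_balls: "Int_stable Zp_balls"
proof (rule Int_stableI)
  have *: "Zp_ball k z \<inter> Zp_ball l w \<in> Zp_balls" if "z \<in> Zp p" "w \<in> Zp p" "k \<le> l" for k l z w
  proof (cases "Zp_ball k z \<inter> Zp_ball l w = {}")
    case True
    show ?thesis unfolding True by (rule empty_in_Zp_balls)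
  next
    case False
    then obtain x where x: "x \<in> Zp_ball k z" "x \<in> Zp_ball l w" by blast
    have "Zp_ball k z = Zp_ball k x" "Zp_ball l w = Zp_ball l x"
      using Zp_ball_eq[OF that(1) x(1)] Zp_ball_eq[OF that(2) x(2)] by simp_all
    hence "Zp_ball k z \<inter> Zp_ball l w = Zp_ball l w" using Zp_ball_mono[OF that(3), of x] by blast
    thus ?thesis using Zp_ball_in_Zp_balls[OF that(2)] by simp
  qed
  fix A B assume A: "A \<in> Zp_balls" and B: "B \<in> Zp_balls"
  show "A \<inter> B \<in> Zp_balls"
  proof (cases rule: Zp_balls_cases[OF A])
    case 1
    thus ?thesis by (simp add: empty_in_Zp_balls)
  next
    case A: (2 k z)
    show ?thesis
    proof (cases rule: Zp_balls_cases[OF B])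
      case 1
      thus ?thesis by (simp add: empty_in_Zp_balls)
    next
      case B: (2 l w)
      show ?thesis
        using *[OF A(2) B(2), of k l] *[OF B(2) A(2), of l k] linear[of k l]
        unfolding A(1) B(1) Int_commute[of "Zp_ball l w"] by blast
    qed
  qed
qed

lemma countable_Zp_balls: "countable Zp_balls"
proof (rule countable_subset)
  show "Zp_balls \<subseteq> insert {} ((\<lambda>(k, c::nat). Zp_ball k (padic_of_rat p (of_nat c))) ` UNIV)"
  proof
    fix B assume "B \<in> Zp_balls"
    thus "B \<in> insert {} ((\<lambda>(k, c::nat). Zp_ball k (padic_of_rat p (of_nat c))) ` UNIV)"
    proof (cases rule: Zp_balls_cases)
      case (2 k z)
      then obtain c where "B = Zp_ball k (padic_of_rat p (of_nat c))"
        using Zp_ball_residue[of z k] by blast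
      hence "B = (\<lambda>(k, c::nat). Zp_ball k (padic_of_rat p (of_nat c))) (k, c)" by simp
      thus ?thesis by blast
    qed simp
  qed
qed simp

lemma sets_Zp_borel: "sets (Zp_borel p) = sigma_sets (Zp p) Zp_balls"
proof -
  have sub: "{U. Zp_open p U} \<subseteq> Pow (Zp p)" by (auto simp: Zp_open_def)
  have "sets (Zp_borel p) = sigma_sets (Zp p) {U. Zp_open p U}"
    unfolding Zp_borel_def using sub by simp
  also have "\<dots> = sigma_sets (Zp p) Zp_balls"
  proof (rule sigma_sets_eqI)
    fix U assume "U \<in> {U. Zp_open p U}"
    hence U: "Zp_open p U" by simp
    have "\<exists>B\<in>Zp_balls. x \<in> B \<and> B \<subseteq> U" if x: "x \<in> U" for x
    proof -
      have xZ: "x \<in> Zp p" using U x by (auto simp: Zp_open_def)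
      obtain e where e: "e > 0" "\<And>y. y \<in> Zp p \<Longrightarrow> padic_abs p (padic_diff p y x) < e \<Longrightarrow> y \<in> U"
        using U x unfolding Zp_open_def by blast
      obtain k where k: "(1 / real p) ^ k < e"
        using real_arch_pow_inv[OF e(1), of "1 / real p"] p_gt_1 by auto
      hence "Zp_ball k x \<subseteq> U" using e(2) by (auto simp: Zp_ball_def power_one_over)
      thus ?thesis using Zp_ball_self[OF xZ] xZ by (auto simp: Zp_balls_def)
    qed
    hence "U = \<Union>{B\<in>Zp_balls. B \<subseteq> U}" by blast
    moreover have "\<Union>{B\<in>Zp_balls. B \<subseteq> U} \<in> sigma_sets (Zp p) Zp_balls"
      by (rule sigma_sets_UNION) (auto intro: countable_subset[OF _ countable_Zp_balls])
    ultimately show "U \<in> sigma_sets (Zp p) Zp_balls" by simp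
  next
    fix B assume "B \<in> Zp_balls"
    hence "Zp_open p B" using Zp_ball_open by (auto simp: Zp_balls_def Zp_open_def)
    thus "B \<in> sigma_sets (Zp p) {U. Zp_open p U}" by auto
  qed
  finally show ?thesis .
qed

lemma space_Zp_borel: "space (Zp_borel p) = Zp p"
  unfolding Zp_borel_def by (simp add: Zp_open_def subset_eq)

lemma Zp_ball_sets: "z \<in> Zp p \<Longrightarrow> Zp_ball k z \<in> sets (Zp_borel p)"
  unfolding sets_Zp_borel by (auto simp: Zp_balls_def)

lemma of_rat_0_in_Zp: "padic_of_rat p 0 \<in> Zp p"
  using Zp_of_nat[of 0] by simp

lemma Zp_eq_ball_0: "Zp p = Zp_ball 0 (padic_of_rat p 0)"
proof -
  have "{..<p ^ 0} = {0}" by auto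
  thus ?thesis using Zp_eq_Union_ball[of 0] by (simp only: of_nat_0 UN_insert UN_empty Un_empty_right)
qed

lemma translate_image:
  assumes "y \<in> Zp p" "A \<subseteq> Zp p"
  shows "(\<lambda>x. padic_add p x y) ` A = {x \<in> Zp p. padic_diff p x y \<in> A}"
proof -
  have Q: "y \<in> Qp p" "\<And>x. x \<in> A \<Longrightarrow> x \<in> Qp p" "\<And>x. x \<in> Zp p \<Longrightarrow> x \<in> Qp p"
    using assms Zp_subset_Qp by blast+
  show ?thesis
  proof (intro equalityI subsetI)
    fix x assume "x \<in> (\<lambda>x. padic_add p x y) ` A"
    then obtain w where w: "w \<in> A" "x = padic_add p w y" by blast
    have "w \<in> Zp p" using w assms by blast
    moreover have "padic_diff p x y = w"
      unfolding w(2) by (rule padic_diff_add_cancel(2)[OF Q(2)[OF w(1)] Q(1)])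
    ultimately show "x \<in> {x \<in> Zp p. padic_diff p x y \<in> A}"
      using w assms(1) Zp_add by simp
  next
    fix x assume x: "x \<in> {x \<in> Zp p. padic_diff p x y \<in> A}"
    hence "x \<in> Qp p" using Q(3) by simp
    hence "x = padic_add p (padic_diff p x y) y"
      using padic_diff_add_cancel(1)[OF _ Q(1)] by simp
    moreover have "padic_diff p x y \<in> A" using x by simp
    ultimately show "x \<in> (\<lambda>x. padic_add p x y) ` A" by (rule image_eqI)
  qed
qed

lemma translate_ball:
  assumes "y \<in> Zp p" "z \<in> Zp p"
  shows "{x \<in> Zp p. padic_diff p x y \<in> Zp_ball k z} = Zp_ball k (padic_add p z y)"
proof -
  have "padic_diff p (padic_diff p x y) z = padic_diff p x (padic_add p z y)" if "x \<in> Zp p" for x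
    using assms that Zp_subset_Qp by (intro padic_diff_diff) (rule subsetD; assumption)+
  moreover have "padic_diff p x y \<in> Zp p" if "x \<in> Zp p" for x
    using that assms(1) by (rule Zp_diff)
  ultimately show ?thesis unfolding Zp_ball_def by (simp cong: conj_cong)
qed

lemma Zp_measure_eqI:
  assumes "sets M = sets (Zp_borel p)" "sets N = sets (Zp_borel p)"
    and "\<And>k z. z \<in> Zp p \<Longrightarrow> emeasure M (Zp_ball k z) = emeasure N (Zp_ball k z)"
    and "emeasure M (Zp p) \<noteq> \<infinity>"
  shows "M = N"
proof (rule measure_eqI_generator_eq[OF Int_stable_Zp_balls Zp_balls_subset])
  show "emeasure M X = emeasure N X" if "X \<in> Zp_balls" for X
    using Zp_balls_cases[OF that] assms(3) by (metis emeasure_empty)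
  show "range (\<lambda>i::nat. Zp p) \<subseteq> Zp_balls"
    using Zp_ball_in_Zp_balls[OF of_rat_0_in_Zp, of 0] unfolding Zp_eq_ball_0[symmetric] by simp
qed (use assms sets_Zp_borel in simp_all)

lemma is_Zp_haar_ball:
  assumes M: "is_Zp_haar p M" and z: "z \<in> Zp p"
  shows "emeasure M (Zp_ball k z) = ennreal (1 / real p ^ k)"
proof -
  let ?B = "\<lambda>c. Zp_ball k (padic_of_rat p (of_nat c))"
  have sets: "sets M = sets (Zp_borel p)" using M by (simp add: is_Zp_haar_def)
  define m where "m = emeasure M (Zp_ball k (padic_of_rat p 0))"
  have eq: "emeasure M (Zp_ball k w) = m" if w: "w \<in> Zp p" for w
  proof -
    have 0: "Zp_ball k (padic_of_rat p 0) \<in> sets M"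
      using Zp_ball_sets of_rat_0_in_Zp sets by blast
    have "(\<lambda>x. padic_add p x w) ` Zp_ball k (padic_of_rat p 0)
        = Zp_ball k (padic_add p (padic_of_rat p 0) w)"
      using translate_image[OF w, of "Zp_ball k (padic_of_rat p 0)"]
        translate_ball[OF w of_rat_0_in_Zp, of k] by (simp add: Zp_ball_def)
    also have "padic_add p (padic_of_rat p 0) w = w"
      using w Zp_subset_Qp by (intro padic_add_0) blast
    finally have "(\<lambda>x. padic_add p x w) ` Zp_ball k (padic_of_rat p 0) = Zp_ball k w" .
    thus ?thesis using M 0 w unfolding is_Zp_haar_def m_def by metis
  qed
  have "1 = emeasure M (\<Union>c<p ^ k. ?B c)"
    using M Zp_eq_Union_ball[of k] by (simp add: is_Zp_haar_def)
  also have "\<dots> = (\<Sum>c<p ^ k. emeasure M (?B c))"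
    using disjoint_Zp_ball sets Zp_ball_sets Zp_of_nat
    by (intro sum_emeasure[symmetric]) auto
  also have "\<dots> = of_nat (p ^ k) * m" using eq Zp_of_nat by simp
  finally have *: "of_nat (p ^ k) * m = 1" by simp
  have pk: "0 < real p ^ k" using p_gt_1 by simp
  have "m \<noteq> \<infinity>" using * p_gt_1 by (auto simp: ennreal_mult_top)
  then obtain r where r: "m = ennreal r" "r \<ge> 0" by (cases m) auto
  have "ennreal (real p ^ k * r) = ennreal 1"
    using * r pk by (simp add: ennreal_mult ennreal_of_nat_eq_real_of_nat flip: of_nat_power)
  hence "real p ^ k * r = 1" using r pk by (subst (asm) ennreal_inj) auto
  hence "r = 1 / real p ^ k" using pk by (simp add: field_simps)
  thus ?thesis using eq[OF z] r by simp
qed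

definition digit_measure :: "(nat \<Rightarrow> nat) measure" where
  "digit_measure = PiM UNIV (\<lambda>_. measure_pmf (pmf_of_set {..<p}))"

definition digit_sum :: "(nat \<Rightarrow> nat) \<Rightarrow> nat \<Rightarrow> nat" where
  "digit_sum d n = (\<Sum>i<n. d i * p ^ i)"

definition digit_class :: "(nat \<Rightarrow> nat) \<Rightarrow> (nat \<Rightarrow> rat) set" where
  "digit_class d = padic_class (\<lambda>n. of_nat (digit_sum d n))"

lemma digit_sum_dvd: "n \<le> m \<Longrightarrow> int p ^ n dvd int (digit_sum d m) - int (digit_sum d n)"
proof (induction m rule: dec_induct)
  case (step m)
  have "int p ^ n dvd int (d m) * int p ^ m"
    using step.hyps by (intro dvd_mult le_imp_power_dvd) simp
  from dvd_add[OF step.IH this] show ?case by (simp add: digit_sum_def algebra_simps)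
qed simp

lemma digit_sum_abs:
  assumes "n \<le> m"
  shows "padic_rat_abs p (of_nat (digit_sum d m) - of_nat (digit_sum d n)) \<le> 1 / real p ^ n"
proof -
  have "(of_nat (digit_sum d m) - of_nat (digit_sum d n) :: rat)
      = of_int (int (digit_sum d m) - int (digit_sum d n))" by simp
  thus ?thesis using digit_sum_dvd[OF assms, of d] by (simp only: padic_rat_abs_of_int_le_iff)
qed

lemma digit_sum_Cauchy: "padic_Cauchy p (\<lambda>n. of_nat (digit_sum d n))"
  unfolding padic_Cauchy_def
proof (intro allI impI)
  fix e :: real assume "e > 0"
  obtain k where "(1 / real p) ^ k < e"
    using real_arch_pow_inv[OF \<open>e > 0\<close>, of "1 / real p"] p_gt_1 by auto
  hence k: "1 / real p ^ k < e" by (simp add: power_one_over)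
  show "\<exists>N. \<forall>m\<ge>N. \<forall>n\<ge>N. padic_rat_abs p (of_nat (digit_sum d m) - of_nat (digit_sum d n)) < e"
  proof (intro exI[of _ k] allI impI)
    fix m n assume "k \<le> m" "k \<le> n"
    from digit_sum_abs[OF this(1), of d] digit_sum_abs[OF this(2), of d] k
      padic_rat_abs_diff[of "of_nat (digit_sum d m) - of_nat (digit_sum d k)"
        "of_nat (digit_sum d n) - of_nat (digit_sum d k)"]
    show "padic_rat_abs p (of_nat (digit_sum d m) - of_nat (digit_sum d n)) < e" by simp
  qed
qed

lemma digit_class_diff_le:
  "padic_abs p (padic_diff p (digit_class d) (padic_of_rat p (of_nat (digit_sum d k)))) \<le> 1 / real p ^ k"
proof -
  have "padic_abs p (padic_class (\<lambda>n. of_nat (digit_sum d n) - of_nat (digit_sum d k))) \<le> 1 / real p ^ k"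
    using padic_abs_class_le[OF padic_Cauchy_diff[OF digit_sum_Cauchy padic_Cauchy_const]]
      digit_sum_abs by blast
  thus ?thesis
    by (simp add: digit_class_def padic_of_rat_class padic_diff_class digit_sum_Cauchy)
qed

lemma digit_class_Zp: "digit_class d \<in> Zp p"
proof -
  have "padic_abs p (digit_class d) \<le> 1"
    unfolding digit_class_def
  proof (rule padic_abs_class_le[OF digit_sum_Cauchy])
    fix n show "padic_rat_abs p (of_nat (digit_sum d n)) \<le> 1"
      using padic_rat_abs_of_int_le_iff[of "int (digit_sum d n)" 0] by simp
  qed
  thus ?thesis
    using padic_class_in_Qp[OF digit_sum_Cauchy] by (simp add: Zp_def digit_class_def)
qed

lemma digit_class_in_ball_iff:
  "digit_class d \<in> Zp_ball k (padic_of_rat p (of_nat c)) \<longleftrightarrow> int p ^ k dvd int (digit_sum d k) - int c"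
proof -
  let ?s = "padic_of_rat p (of_nat (digit_sum d k))"
  have "digit_class d \<in> Zp_ball k ?s"
    using digit_class_diff_le digit_class_Zp by (simp add: Zp_ball_def)
  hence eq: "Zp_ball k (digit_class d) = Zp_ball k ?s" by (rule Zp_ball_eq[OF Zp_of_nat])
  have "digit_class d \<in> Zp_ball k (padic_of_rat p (of_nat c)) \<longleftrightarrow> ?s \<in> Zp_ball k (padic_of_rat p (of_nat c))"
  proof
    assume "digit_class d \<in> Zp_ball k (padic_of_rat p (of_nat c))"
    from Zp_ball_eq[OF Zp_of_nat this] eq Zp_ball_self[OF Zp_of_nat]
    show "?s \<in> Zp_ball k (padic_of_rat p (of_nat c))" by metis
  next
    assume "?s \<in> Zp_ball k (padic_of_rat p (of_nat c))"
    from Zp_ball_eq[OF Zp_of_nat this] eq Zp_ball_self[OF digit_class_Zp]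
    show "digit_class d \<in> Zp_ball k (padic_of_rat p (of_nat c))" by metis
  qed
  thus ?thesis by (simp only: of_nat_in_ball_iff)
qed

lemma digit_sum_measurable: "(\<lambda>d. digit_sum d k) \<in> measurable digit_measure (count_space UNIV)"
proof -
  have comp: "(\<lambda>d. d i) \<in> measurable digit_measure (count_space UNIV)" for i
  proof -
    have "(\<lambda>d. d i) \<in> measurable digit_measure (measure_pmf (pmf_of_set {..<p}))"
      unfolding digit_measure_def by (rule measurable_component_singleton) simp
    thus ?thesis by (simp cong: measurable_cong_sets)
  qed
  show ?thesis
  proof (induction k)
    case (Suc k)
    have "(\<lambda>d. s + d k * p ^ k) \<in> measurable digit_measure (count_space UNIV)" for s
      using measurable_compose[OF comp[of k], of "\<lambda>j. s + j * p ^ k"] by simp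
    from measurable_compose_countable[OF this Suc] show ?case by (simp add: digit_sum_def)
  qed (simp add: digit_sum_def)
qed

lemma digit_class_vimage:
  "digit_class -` Zp_ball k (padic_of_rat p (of_nat c)) \<inter> space digit_measure
     = (\<lambda>d. digit_sum d k) -` {s. int p ^ k dvd int s - int c} \<inter> space digit_measure"
  by (auto simp: digit_class_in_ball_iff)

lemma digit_class_measurable: "digit_class \<in> measurable digit_measure (Zp_borel p)"
proof (rule measurable_sigma_sets[OF sets_Zp_borel Zp_balls_subset])
  show "digit_class \<in> space digit_measure \<rightarrow> Zp p" by (simp add: digit_class_Zp)
  fix B assume "B \<in> Zp_balls"
  thus "digit_class -` B \<inter> space digit_measure \<in> sets digit_measure"
  proof (cases rule: Zp_balls_cases)
    case (2 k z)
    then obtain c where "B = Zp_ball k (padic_of_rat p (of_nat c))"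
      using Zp_ball_residue[of z k] by blast
    thus ?thesis
      using measurable_sets[OF digit_sum_measurable, of "{s. int p ^ k dvd int s - int c}" k]
      by (simp only: digit_class_vimage) simp
  qed simp
qed

lemma digit_sum_digits: "digit_sum (\<lambda>i. c div p ^ i mod p) k = c mod p ^ k"
proof (induction k)
  case (Suc k)
  have "c mod (p ^ k * p) = p ^ k * (c div p ^ k mod p) + c mod p ^ k" by (rule mod_mult2_eq)
  thus ?case using Suc by (simp add: digit_sum_def algebra_simps)
qed (simp add: digit_sum_def)

lemma prob_space_digit_measure: "prob_space digit_measure"
  unfolding digit_measure_def by (intro prob_space_PiM) (rule prob_space_measure_pmf)

lemma digit_measure_ball_ge:
  assumes "c < p ^ k"
  shows "emeasure (distr digit_measure (Zp_borel p) digit_class)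
    (Zp_ball k (padic_of_rat p (of_nat c))) \<ge> ennreal (1 / real p ^ k)"
proof -
  interpret D: product_prob_space "\<lambda>_::nat. measure_pmf (pmf_of_set {..<p})" UNIV
    by unfold_locales
  define e where "e i = c div p ^ i mod p" for i
  let ?C = "{d \<in> space digit_measure. \<forall>i\<in>{..<k}. d i \<in> {e i}}"
  let ?V = "digit_class -` Zp_ball k (padic_of_rat p (of_nat c)) \<inter> space digit_measure"
  have "emeasure digit_measure ?C = (\<Prod>i<k. emeasure (measure_pmf (pmf_of_set {..<p})) {e i})"
    unfolding digit_measure_def by (rule D.emeasure_PiM_Collect) auto
  also have "\<dots> = (\<Prod>i<k. ennreal (1 / real p))"
  proof (rule prod.cong)
    fix i
    have "e i \<in> {..<p}" using p_gt_1 by (simp add: e_def)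
    moreover have "{..<p} \<noteq> {}" using p_gt_1 by (auto intro: exI[of _ 0])
    ultimately show "emeasure (measure_pmf (pmf_of_set {..<p})) {e i} = ennreal (1 / real p)"
      by (simp add: emeasure_pmf_single)
  qed simp
  also have "\<dots> = ennreal (1 / real p ^ k)"
    by (simp add: ennreal_power power_one_over)
  finally have C: "emeasure digit_measure ?C = ennreal (1 / real p ^ k)" .
  have "?C \<subseteq> ?V"
  proof
    fix d assume d: "d \<in> ?C"
    hence "digit_sum d k = digit_sum e k" unfolding digit_sum_def by (intro sum.cong) auto
    also have "\<dots> = c" unfolding e_def using digit_sum_digits[of c k] assms by simp
    finally show "d \<in> ?V" using d by (simp add: digit_class_in_ball_iff)
  qed
  hence "emeasure digit_measure ?C \<le> emeasure digit_measure ?V"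
    by (intro emeasure_mono measurable_sets[OF digit_class_measurable] Zp_ball_sets Zp_of_nat)
  thus ?thesis
    using C by (subst emeasure_distr[OF digit_class_measurable])
      (simp_all add: Zp_ball_sets Zp_of_nat)
qed

lemma digit_measure_ball:
  assumes "z \<in> Zp p"
  shows "emeasure (distr digit_measure (Zp_borel p) digit_class) (Zp_ball k z) = ennreal (1 / real p ^ k)"
proof -
  let ?M = "distr digit_measure (Zp_borel p) digit_class"
  let ?B = "\<lambda>c. Zp_ball k (padic_of_rat p (of_nat c))"
  interpret D: prob_space digit_measure by (rule prob_space_digit_measure)
  interpret prob_space ?M using digit_class_measurable by (rule D.prob_space_distr)
  have pk: "0 < real p ^ k" using p_gt_1 by simp
  obtain c where c: "c < p ^ k" "Zp_ball k z = ?B c" using Zp_ball_residue[OF assms, of k] by blast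
  have ge: "1 / real p ^ k \<le> measure ?M (?B b)" if "b < p ^ k" for b
    using digit_measure_ball_ge[OF that] by (simp add: emeasure_eq_measure)
  have "1 = measure ?M (\<Union>b<p ^ k. ?B b)"
    using prob_space Zp_eq_Union_ball[of k] by (simp add: space_Zp_borel)
  also have "\<dots> = (\<Sum>b<p ^ k. measure ?M (?B b))"
    using disjoint_Zp_ball by (intro finite_measure_finite_Union) (auto intro!: Zp_ball_sets Zp_of_nat)
  finally have sum: "(\<Sum>b<p ^ k. measure ?M (?B b)) = (\<Sum>b<p ^ k. 1 / real p ^ k)"
    using pk by simp
  have "measure ?M (?B c) = 1 / real p ^ k"
  proof (rule ccontr)
    assume "\<not> ?thesis"
    hence "1 / real p ^ k < measure ?M (?B c)" using ge[OF c(1)] by simp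
    hence "(\<Sum>b<p ^ k. 1 / real p ^ k) < (\<Sum>b<p ^ k. measure ?M (?B b))"
      using ge c(1) by (intro sum_strict_mono_ex1) auto
    thus False using sum by simp
  qed
  thus ?thesis by (simp only: c(2) emeasure_eq_measure)
qed

lemma is_Zp_haar_digit_measure: "is_Zp_haar p (distr digit_measure (Zp_borel p) digit_class)"
proof -
  let ?M = "distr digit_measure (Zp_borel p) digit_class"
  have total: "emeasure ?M (Zp p) = 1"
    unfolding Zp_eq_ball_0 using digit_measure_ball[OF of_rat_0_in_Zp, of 0] by simp
  have inv: "emeasure ?M ((\<lambda>x. padic_add p x y) ` A) = emeasure ?M A"
    if y: "y \<in> Zp p" and A: "A \<in> sets ?M" for y A
  proof -
    let ?t = "\<lambda>x. padic_diff p x y"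
    have vim: "?t -` Zp_ball k z \<inter> space ?M = Zp_ball k (padic_add p z y)" if "z \<in> Zp p" for k z
      using translate_ball[OF y that, of k] by (auto simp: space_Zp_borel)
    have t: "?t \<in> measurable ?M (Zp_borel p)"
    proof (rule measurable_sigma_sets[OF sets_Zp_borel Zp_balls_subset])
      show "?t \<in> space ?M \<rightarrow> Zp p" using y by (simp add: space_Zp_borel Zp_diff)
      fix B assume "B \<in> Zp_balls"
      thus "?t -` B \<inter> space ?M \<in> sets ?M"
      proof (cases rule: Zp_balls_cases)
        case (2 k z)
        show ?thesis
          unfolding 2(1) vim[OF 2(2)] using Zp_ball_sets[OF Zp_add[OF 2(2) y]] by simp
      qed simp
    qed
    have "?M = distr ?M (Zp_borel p) ?t"
    proof (rule Zp_measure_eqI)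
      fix k z assume z: "z \<in> Zp p"
      show "emeasure ?M (Zp_ball k z) = emeasure (distr ?M (Zp_borel p) ?t) (Zp_ball k z)"
        unfolding emeasure_distr[OF t Zp_ball_sets[OF z]] vim[OF z]
          digit_measure_ball[OF z] digit_measure_ball[OF Zp_add[OF z y]] ..
    qed (simp_all add: total)
    hence "emeasure ?M A = emeasure (distr ?M (Zp_borel p) ?t) A" by simp
    also have "\<dots> = emeasure ?M (?t -` A \<inter> space ?M)"
      using A by (intro emeasure_distr[OF t]) simp
    also have "?t -` A \<inter> space ?M = (\<lambda>x. padic_add p x y) ` A"
    proof -
      have "A \<subseteq> Zp p" using sets.sets_into_space[OF A] by (simp add: space_Zp_borel)
      from translate_image[OF y this] show ?thesis by (auto simp: space_Zp_borel)
    qed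
    finally show ?thesis by simp
  qed
  show ?thesis unfolding is_Zp_haar_def using total inv by (simp add: space_Zp_borel)
qed

theorem ex1_Zp_haar: "\<exists>!M. is_Zp_haar p M"
proof (rule ex1I)
  show "is_Zp_haar p (distr digit_measure (Zp_borel p) digit_class)"
    by (rule is_Zp_haar_digit_measure)
next
  fix M assume M: "is_Zp_haar p M"
  show "M = distr digit_measure (Zp_borel p) digit_class"
  proof (rule Zp_measure_eqI)
    show "sets M = sets (Zp_borel p)" "emeasure M (Zp p) \<noteq> \<infinity>"
      using M by (simp_all add: is_Zp_haar_def)
  qed (simp_all add: is_Zp_haar_ball[OF M] digit_measure_ball)
qed

theorem is_Zp_haar_Zp_haar: "is_Zp_haar p (Zp_haar p)"
  unfolding Zp_haar_def using ex1_Zp_haar by (rule theI')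

end

end

theory Submission
  imports Defs "HOL-Number_Theory.Number_Theory" "HOL-Real_Asymp.Real_Asymp"
begin

text \<open>
  Overlaps \<open>A\<^sub>m \<inter> A\<^sub>n\<close> are governed by the pairs of reduced fractions \<open>s / m\<close>, \<open>t / n\<close> for which
  \<open>j = s * n - t * m\<close> is small. If \<open>p\<close> divides neither \<open>m\<close> nor \<open>n\<close>, multiplying \<open>s\<close> and \<open>t\<close> by
  \<open>p ^ k\<close> modulo \<open>m\<close> and \<open>n\<close> turns such a pair into integers \<open>a\<close>, \<open>b\<close> with \<open>\<bar>a\<bar> \<le> m\<close>, \<open>\<bar>b\<bar> \<le> n\<close> and
  \<open>a * n - b * m = p ^ k * j\<close>, that is, into \<open>p\<close>-adically close fractions \<open>a / m\<close>, \<open>b / n\<close>. As long as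
  \<open>n * \<psi> n\<close> is small, the \<open>p\<close>-adic balls around these fractions are disjoint, so quasi-independence on
  average passes from the \<open>p\<close>-adic sets to the real ones, and the Paley--Zygmund inequality gives
  positive measure. A power \<open>p ^ i\<close> exactly dividing all denominators costs only a constant factor.

  If \<open>n * \<psi> n\<close> is bounded below, no hypothesis is needed: the range of \<open>j\<close> is then so long compared to
  the denominators that sieving by the smallest quarter of the primes involved, whose product is
  small, already gives an upper bound for the overlaps of the right order of magnitude. Replacing \<open>\<psi> n\<close>
  by \<open>min (\<psi> n) (1 / \<phi> n)\<close> does not affect divergence and makes the radii tend to 0.

  Positive measure is upgraded to full measure by Gallagher's zero-one law. Since the power of
  \<open>p\<close> dividing the denominators may be assumed constant, the single expanding map
  \<open>x \<mapsto> p * x + 1 / p ^ i\<close> suffices for it.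
\<close>


section \<open>Products over primes and counting residues\<close>

text \<open>The case boundary \<open>1 / (4 * p)\<close> for denominator times radius marks where
  the \<open>p\<close>-adic side breaks down: matching radii are powers of \<open>p\<close>, hence
  controlled only up to a factor \<open>p\<close>, and they must stay below
  \<open>1 / (2 * n)\<close> to separate the balls around \<open>a / n\<close> with
  \<open>\<bar>a\<bar> \<le> n\<close>. Past this boundary, let \<open>m = g * a\<close> and
  \<open>n = g * b\<close> with \<open>g\<close> the gcd. The differences \<open>j\<close> are
  coprime to \<open>a * b\<close>, and counting such \<open>j\<close> with all primes of
  \<open>a * b\<close> leaves an error of size up to \<open>a * b\<close>, whereas \<open>j\<close>
  may range only up to about \<open>a + b\<close>. A product of primes whose fourth power is at most
  \<open>a * b\<close> keeps the error within the order of the main term, while the smallest primes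
  carry the density up to a constant. The second moment is taken of counts with multiplicity on the
  line rather than of unions on the circle, so the first moment is exact; denominators run over
  finite sets of growing weight, and large counts force infinitely many of them. Both the zero-one
  law and Cassels' lemma rest on one density criterion, derived from Vitali coverings.\<close>

lemma sorted_list_of_set_nth_ge:
  fixes Q :: "nat set"
  assumes "finite Q" "\<And>q. q \<in> Q \<Longrightarrow> 2 \<le> q" "i < card Q"
  shows "i + 2 \<le> sorted_list_of_set Q ! i"
  using assms(3)
proof (induction i)
  case 0
  hence "sorted_list_of_set Q ! 0 \<in> Q"
    using assms(1) by (metis length_sorted_list_of_set nth_mem set_sorted_list_of_set)
  thus ?case using assms(2) by fastforce
next
  case (Suc i)
  have "sorted_list_of_set Q ! i < sorted_list_of_set Q ! Suc i"
    using Suc.prems strict_sorted_list_of_set[of Q]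
    by (auto simp: sorted_wrt_iff_nth_less)
  thus ?case using Suc by simp
qed

lemma prod_telescope_ge:
  assumes "r \<le> k"
  shows "(\<Prod>i\<in>{r..<k}. 1 - 1 / real (i + 2)) = (real r + 1) / (real k + 1)"
  using assms
proof (induction k rule: dec_induct)
  case (step k)
  have "(1 - 1 / real (k + 2)) = (real k + 1) / (real k + 2)" by (simp add: field_simps)
  thus ?case using step by (simp add: field_simps)
qed simp

text \<open>The worst case is \<open>Q = {2, 3, ..., k + 1}\<close>, where the product telescopes.
  The index \<open>r\<close> is the number of smallest elements left out.\<close>

lemma prod_sorted_ge:
  fixes Q :: "nat set"
  assumes "finite Q" "\<And>q. q \<in> Q \<Longrightarrow> 2 \<le> q" "r \<le> card Q"
  shows "(real r + 1) / (real (card Q) + 1) \<le> (\<Prod>i\<in>{r..<card Q}. 1 - 1 / real (sorted_list_of_set Q ! i))"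
  unfolding prod_telescope_ge[OF assms(3), symmetric]
proof (intro prod_mono conjI)
  fix i assume i: "i \<in> {r..<card Q}"
  show "0 \<le> 1 - 1 / real (i + 2)" by simp
  have "real (i + 2) \<le> real (sorted_list_of_set Q ! i)"
    using sorted_list_of_set_nth_ge[OF assms(1,2), of i] i by simp
  thus "1 - 1 / real (i + 2) \<le> 1 - 1 / real (sorted_list_of_set Q ! i)"
    by (simp add: frac_le)
qed

lemma prod_sorted_list_of_set:
  fixes Q :: "nat set"
  assumes "finite Q"
  shows "prod f Q = (\<Prod>i<card Q. f (sorted_list_of_set Q ! i))"
  using prod.reindex_bij_betw[OF bij_betw_nth[OF distinct_sorted_list_of_set refl refl], of f Q] assms
  by simp

text \<open>
  \<open>Q0\<close> consists of the smallest quarter of the elements of \<open>Q\<close>: the \<open>i\<close>-th element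
  of \<open>Q\<close> is at least \<open>i + 1\<close>, so the product over the others is at least a telescoping product.
\<close>
lemma prod_quarter:
  fixes Q :: "nat set"
  assumes "finite Q" "\<And>q. q \<in> Q \<Longrightarrow> 2 \<le> q"
  obtains Q0 where "Q0 \<subseteq> Q" "\<Prod>Q0 ^ 4 \<le> \<Prod>Q"
    "(\<Prod>q\<in>Q0. 1 - 1 / real q) \<le> 4 * (\<Prod>q\<in>Q. 1 - 1 / real q)"
proof -
  define x where "x = nth (sorted_list_of_set Q)"
  define k r where "k = card Q" and "r = k div 4"
  have rk: "r \<le> k" "4 * r \<le> k" "k + 1 \<le> 4 * (r + 1)" by (auto simp: r_def)
  have inj: "inj_on x {..<k}"
    unfolding x_def k_def using distinct_sorted_list_of_set[of Q]
    by (auto simp: inj_on_def nth_eq_iff_index_eq)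
  have img: "x ` {..<k} = Q"
    using bij_betw_nth[OF distinct_sorted_list_of_set refl refl, of Q] assms(1)
    by (simp add: bij_betw_def x_def k_def)
  have x1: "1 \<le> x i" if "i < k" for i
    using that sorted_list_of_set_nth_ge[OF assms, of i] by (simp add: x_def k_def)
  have mono: "x i \<le> x j" if "i \<le> j" "j < k" for i j
    using that sorted_nth_mono[of "sorted_list_of_set Q" i j] by (simp add: x_def k_def)
  show ?thesis
  proof
    have inj': "inj_on x {..<r}" by (rule inj_on_subset[OF inj]) (use rk(1) in auto)
    show "x ` {..<r} \<subseteq> Q" using img rk(1) by auto
    have "\<Prod>(x ` {..<r}) ^ 4 = (\<Prod>j<4::nat. \<Prod>i<r. x i)"
      using prod.reindex[OF inj', of "\<lambda>q. q"] by simp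
    \<comment> \<open>The first \<open>4 * r\<close> elements form four consecutive blocks of length
      \<open>r\<close>. As the list is increasing, no block has a smaller product than the first
      one; this is the origin of the fourth power.\<close>
    also have "\<dots> \<le> (\<Prod>j<4. \<Prod>i\<in>{j * r..<j * r + r}. x i)"
    proof (intro prod_mono conjI)
      fix j :: nat assume j: "j \<in> {..<4}"
      hence jr: "j * r \<le> 3 * r" by (intro mult_right_mono) auto
      have "(\<Prod>i<r. x i) \<le> (\<Prod>i<r. x (i + j * r))"
      proof (intro prod_mono conjI mono)
        fix i assume "i \<in> {..<r}"
        hence "i < r" by simp
        thus "i + j * r < k" using rk(2) jr by linarith
      qed auto
      also have "\<dots> = (\<Prod>i\<in>{j * r..<j * r + r}. x i)"
        using prod.shift_bounds_nat_ivl[of x 0 "j * r" r] by (simp add: atLeast0LessThan add.commute)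
      finally show "(\<Prod>i<r. x i) \<le> (\<Prod>i\<in>{j * r..<j * r + r}. x i)" .
    qed simp
    also have "\<dots> = (\<Prod>i<4 * r. x i)" by (rule prod.nat_group)
    also have "\<dots> \<le> (\<Prod>i<k. x i)"
      using rk(2) x1
      by (intro dvd_imp_le prod_dvd_prod_subset prod_pos) (auto simp: Suc_le_eq)
    also have "\<dots> = \<Prod>Q" using prod.reindex[OF inj, of "\<lambda>q. q"] img by simp
    finally show "\<Prod>(x ` {..<r}) ^ 4 \<le> \<Prod>Q" .
    let ?f = "\<lambda>q. 1 - 1 / real q"
    have f: "0 \<le> ?f (x i)" if "i < k" for i using x1[OF that] by simp
    have "1 \<le> 4 * ((real r + 1) / (real k + 1))" using rk(3) by (simp add: field_simps)
    also have "(real r + 1) / (real k + 1) \<le> (\<Prod>i\<in>{r..<k}. ?f (x i))"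
      using prod_sorted_ge[OF assms, of r] rk(1) by (simp add: k_def x_def)
    finally have "(\<Prod>i<r. ?f (x i)) * 1 \<le> (\<Prod>i<r. ?f (x i)) * (4 * (\<Prod>i\<in>{r..<k}. ?f (x i)))"
      using f rk(1) by (intro mult_left_mono prod_nonneg) auto
    also have "\<dots> = 4 * (\<Prod>i<k. ?f (x i))"
      using prod.atLeastLessThan_concat[of 0 r k "\<lambda>i. ?f (x i)"] rk(1)
      by (simp add: atLeast0LessThan)
    also have "(\<Prod>i<k. ?f (x i)) = (\<Prod>q\<in>Q. ?f q)"
      using prod.reindex[OF inj, of ?f] img by simp
    also have "(\<Prod>i<r. ?f (x i)) = (\<Prod>q\<in>x ` {..<r}. ?f q)"
      using prod.reindex[OF inj', of ?f] by simp
    finally show "(\<Prod>q\<in>x ` {..<r}. ?f q) \<le> 4 * (\<Prod>q\<in>Q. ?f q)" by simp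
  qed
qed

lemma prod_one_minus_inverse_ge:
  fixes Q :: "nat set"
  assumes "finite Q" "\<And>q. q \<in> Q \<Longrightarrow> 2 \<le> q"
  shows "1 / (real (card Q) + 1) \<le> (\<Prod>q\<in>Q. 1 - 1 / real q)"
  using prod_sorted_ge[OF assms, of 0] prod_sorted_list_of_set[OF assms(1), of "\<lambda>q. 1 - 1 / real q"]
  by (simp add: atLeast0LessThan)

text \<open>The full product over \<open>2, ..., n\<close> telescopes to
  \<open>(n + 1) / (2 * n)\<close>, and the factors outside \<open>Q\<close> are at most 1.\<close>

lemma prod_one_minus_inverse_square_ge:
  fixes Q :: "nat set"
  assumes "finite Q" "\<And>q. q \<in> Q \<Longrightarrow> 2 \<le> q"
  shows "1 / 2 \<le> (\<Prod>q\<in>Q. 1 - 1 / (real q)\<^sup>2)"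
proof -
  define n where "n = Max (insert 2 Q)"
  have n: "2 \<le> n" "Q \<subseteq> {2..n}" using assms by (auto simp: n_def)
  have eq: "(\<Prod>q=2..n. 1 - 1 / (real q)\<^sup>2) = (real n + 1) / (2 * real n)"
    using n(1)
  proof (induction n rule: dec_induct)
    case (step n)
    have "1 - 1 / (real (Suc n))\<^sup>2 = real n * (real n + 2) / (real n + 1)\<^sup>2"
      by (simp add: divide_simps) (simp add: algebra_simps power2_eq_square)
    thus ?case using step by (simp add: divide_simps) (simp add: algebra_simps power2_eq_square)
  qed (simp add: power2_eq_square)
  have "1 / 2 \<le> (real n + 1) / (2 * real n)" using n(1) by (simp add: field_simps)
  also have "\<dots> = (\<Prod>q=2..n. 1 - 1 / (real q)\<^sup>2)" by (rule eq[symmetric])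
  also have "\<dots> = (\<Prod>q\<in>{2..n} - Q. 1 - 1 / (real q)\<^sup>2) * (\<Prod>q\<in>Q. 1 - 1 / (real q)\<^sup>2)"
    using n(2) by (intro prod.subset_diff) auto
  also have "\<dots> \<le> 1 * (\<Prod>q\<in>Q. 1 - 1 / (real q)\<^sup>2)"
  proof (intro mult_right_mono prod_nonneg prod_le_1)
    fix q assume "q \<in> Q"
    hence "1 \<le> (real q)\<^sup>2" using assms(2)[of q] by (intro one_le_power) auto
    thus "0 \<le> 1 - 1 / (real q)\<^sup>2" by (simp add: divide_le_eq_1, arith)
  next
    fix q assume "q \<in> {2..n} - Q"
    hence "0 < q" "1 \<le> (real q)\<^sup>2" by (auto intro!: one_le_power)
    thus "0 \<le> 1 - 1 / (real q)\<^sup>2 \<and> 1 - 1 / (real q)\<^sup>2 \<le> 1"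
      by (simp add: divide_le_eq_1)
  qed
  finally show ?thesis by simp
qed

text \<open>Expanding the product yields one term \<open>1 / d\<close> per divisor of the squarefree
  number \<open>\<Prod>Q\<close>. The induction separates the divisors containing the new prime
  \<open>q\<close> from the others.\<close>

lemma prod_one_plus_inverse_le:
  fixes Q :: "nat set"
  assumes "finite Q" "\<And>q. q \<in> Q \<Longrightarrow> prime q"
  shows "(\<Prod>q\<in>Q. 1 + 1 / real q) \<le> (\<Sum>d | d dvd \<Prod>Q. 1 / real d)"
  using assms
proof (induction Q rule: finite_induct)
  case (insert q Q)
  let ?P = "\<Prod>Q"
  have P0: "?P > 0" using insert by (intro prod_pos) (auto simp: prime_gt_0_nat)
  have q: "prime q" using insert by simp
  have cop: "\<not> q dvd ?P"
  proof
    assume "q dvd ?P"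
    then obtain x where "x \<in> Q" "q dvd x" using q insert.hyps(1) by (auto simp: prime_dvd_prod_iff)
    thus False using insert primes_dvd_imp_eq[of q x] by auto
  qed
  have fin: "finite {d. d dvd ?P}" using P0 by simp
  have inj: "inj_on (\<lambda>d. q * d) {d. d dvd ?P}" using q by (auto simp: inj_on_def prime_gt_0_nat)
  have "(\<Prod>q\<in>insert q Q. 1 + 1 / real q) \<le> (1 + 1 / real q) * (\<Sum>d | d dvd ?P. 1 / real d)"
    using insert by (simp add: mult_left_mono)
  also have "\<dots> = (\<Sum>d | d dvd ?P. 1 / real d) + (\<Sum>d | d dvd ?P. 1 / real (q * d))"
    by (simp add: algebra_simps sum_distrib_left sum_divide_distrib flip: sum.distrib)
  also have "(\<Sum>d | d dvd ?P. 1 / real (q * d)) = (\<Sum>d\<in>(\<lambda>d. q * d) ` {d. d dvd ?P}. 1 / real d)"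
    using sum.reindex[OF inj, of "\<lambda>d. 1 / real d"] by simp
  also have "(\<Sum>d | d dvd ?P. 1 / real d) + \<dots> = (\<Sum>d\<in>{d. d dvd ?P} \<union> (\<lambda>d. q * d) ` {d. d dvd ?P}. 1 / real d)"
    using fin cop by (intro sum.union_disjoint[symmetric]) auto
  also have "\<dots> \<le> (\<Sum>d | d dvd \<Prod>(insert q Q). 1 / real d)"
    using insert.hyps P0 q by (intro sum_mono2) (auto simp: prime_gt_0_nat)
  finally show ?case .
qed simp

text \<open>This is \<open>\<phi> n / n\<close>. In product form it is positive even at
  \<open>n = 0\<close>, and it splits along sets of primes, as needed in
  \<open>card_close_pairs_le\<close>.\<close>

definition totient_ratio :: "nat \<Rightarrow> real" where
  "totient_ratio n = (\<Prod>q\<in>prime_factors n. 1 - 1 / real q)"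

lemma totient_ratio: "real (totient n) = real n * totient_ratio n"
  by (simp add: totient_formula2 totient_ratio_def)

lemma prime_factors_one_minus:
  assumes "q \<in> prime_factors n"
  shows "0 < 1 - 1 / real q \<and> 1 - 1 / real q \<le> 1"
proof -
  have "prime q" using assms by auto
  thus ?thesis using prime_gt_1_nat[of q] by simp
qed

lemma totient_ratio_pos: "0 < totient_ratio n"
  unfolding totient_ratio_def by (intro prod_pos) (blast dest: prime_factors_one_minus)

lemma prod_prime_factors_dvd:
  fixes n :: nat
  assumes "0 < n"
  shows "\<Prod>(prime_factors n) dvd n"
proof -
  have "\<Prod>(prime_factors n) dvd (\<Prod>q\<in>prime_factors n. q ^ multiplicity q n)"
    by (intro prod_dvd_prod) (auto intro!: dvd_power simp: prime_factors_multiplicity)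
  thus ?thesis using prime_factorization_nat[OF assms] by simp
qed

text \<open>Replacing \<open>1 / (1 - 1 / q)\<close> by \<open>1 + 1 / q\<close> loses a factor
  \<open>1 / (1 - 1 / q ^ 2)\<close> per prime, in total at most 2. The resulting divisor sum can be
  interchanged with a sum over \<open>n\<close>.\<close>

lemma inverse_totient_ratio_le:
  assumes "0 < n"
  shows "1 / totient_ratio n \<le> 2 * (\<Sum>d | d dvd n. 1 / real d)"
proof -
  let ?Q = "prime_factors n"
  have q2: "2 \<le> q" if "q \<in> ?Q" for q using that by (auto intro: prime_ge_2_nat)
  have "(\<Prod>q\<in>?Q. 1 - 1 / (real q)\<^sup>2) = (\<Prod>q\<in>?Q. (1 - 1 / real q) * (1 + 1 / real q))"
    by (intro prod.cong) (auto simp: algebra_simps power2_eq_square)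
  also have "\<dots> = totient_ratio n * (\<Prod>q\<in>?Q. 1 + 1 / real q)"
    by (simp add: prod.distrib totient_ratio_def)
  finally have "1 / 2 \<le> totient_ratio n * (\<Prod>q\<in>?Q. 1 + 1 / real q)"
    using prod_one_minus_inverse_square_ge[of ?Q] q2 by simp
  hence "1 / totient_ratio n \<le> 2 * (\<Prod>q\<in>?Q. 1 + 1 / real q)"
    using totient_ratio_pos[of n] by (simp add: field_simps)
  also have "(\<Prod>q\<in>?Q. 1 + 1 / real q) \<le> (\<Sum>d | d dvd \<Prod>?Q. 1 / real d)"
    by (rule prod_one_plus_inverse_le) auto
  also have "\<dots> \<le> (\<Sum>d | d dvd n. 1 / real d)"
  proof (rule sum_mono2)
    have "\<Prod>?Q dvd n" by (rule prod_prime_factors_dvd[OF assms])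
    thus "{d. d dvd \<Prod>?Q} \<subseteq> {d. d dvd n}" using dvd_trans by blast
  qed (use assms in auto)
  finally show ?thesis by simp
qed

section \<open>Integers coprime to a modulus and averages of \<open>j / \<phi> j\<close>\<close>

lemma card_coprime_lessThan: "card {i. i < n \<and> coprime i n} = totient n"
proof (cases "n \<le> 1")
  case True
  hence "n = 0 \<or> n = 1" by auto
  thus ?thesis
  proof
    assume "n = 1"
    hence "{i. i < n \<and> coprime i n} = {0}" by auto
    thus ?thesis using \<open>n = 1\<close> by simp
  qed simp
next
  case False
  have "{i. i < n \<and> coprime i n} = totatives n"
  proof (intro equalityI subsetI)
    fix i assume "i \<in> {i. i < n \<and> coprime i n}"
    thus "i \<in> totatives n" using False by (cases "i = 0") (auto simp: totatives_def)
  next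
    fix i assume "i \<in> totatives n"
    thus "i \<in> {i. i < n \<and> coprime i n}" using False
      by (auto simp: totatives_def le_less)
  qed
  thus ?thesis by (simp add: totient_def)
qed

lemma card_coprime_block: "card {i. i < M * k \<and> coprime i M} = k * totient M"
proof (induction k)
  case (Suc k)
  let ?A = "{i. i < M * k \<and> coprime i M}" and ?B = "{i. i < M \<and> coprime i M}"
  have cop: "coprime (i + M * k) M \<longleftrightarrow> coprime i M" for i
    by (metis coprime_iff_gcd_eq_1 gcd.commute gcd_add_mult add.commute mult.commute)
  have "{i. i < M * Suc k \<and> coprime i M} = ?A \<union> (\<lambda>i. i + M * k) ` ?B"
  proof (intro equalityI subsetI)
    fix i assume i: "i \<in> {i. i < M * Suc k \<and> coprime i M}"
    show "i \<in> ?A \<union> (\<lambda>i. i + M * k) ` ?B"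
    proof (cases "i < M * k")
      case False
      hence "i = (i - M * k) + M * k" by simp
      moreover from this have "i - M * k \<in> ?B" using i cop[of "i - M * k"] False by auto
      ultimately show ?thesis by blast
    qed (use i in simp)
  qed (auto simp: cop)
  moreover have "card (?A \<union> (\<lambda>i. i + M * k) ` ?B) = card ?A + card ((\<lambda>i. i + M * k) ` ?B)"
    by (rule card_Un_disjoint) auto
  moreover have "card ((\<lambda>i. i + M * k) ` ?B) = card ?B" by (rule card_image) simp
  ultimately show ?case using Suc card_coprime_lessThan[of M] by simp
qed simp

lemma card_coprime_atMost_le:
  assumes "0 < M"
  shows "real (card {i. i \<le> X \<and> 0 < i \<and> coprime i M}) \<le> (real X / real M + 1) * real (totient M)"
proof (cases "M = 1")
  case True
  hence "{i. i \<le> X \<and> 0 < i \<and> coprime i M} = {1..X}" by auto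
  thus ?thesis using True by simp
next
  case False
  let ?k = "X div M + 1"
  have "{i. i \<le> X \<and> 0 < i \<and> coprime i M} \<subseteq> {i. i < M * ?k \<and> coprime i M}"
    using assms by (auto simp: dividend_less_times_div intro: le_less_trans)
  hence "card {i. i \<le> X \<and> 0 < i \<and> coprime i M} \<le> ?k * totient M"
    using card_mono[of "{i. i < M * ?k \<and> coprime i M}"] card_coprime_block[of M ?k] by simp
  hence "real (card {i. i \<le> X \<and> 0 < i \<and> coprime i M}) \<le> real ?k * real (totient M)"
    by (metis of_nat_le_iff of_nat_mult)
  also have "real ?k \<le> real X / real M + 1" using of_nat_div_le_of_nat[of X M, where ?'a = real] by simp
  finally show ?thesis by (simp add: mult_right_mono)
qed

lemma sum_inverse_square_le: "(\<Sum>d=1..X. 1 / (real d)\<^sup>2) \<le> 2"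
proof -
  have "(\<Sum>d=1..X. 1 / (real d)\<^sup>2) \<le> 2 - 1 / real X"
  proof (induction X)
    case (Suc X)
    have "1 / (real X + 1)\<^sup>2 \<le> 1 / real X - 1 / (real X + 1)" if "X > 0"
      using that by (simp add: divide_simps) (simp add: algebra_simps power2_eq_square)
    thus ?case using Suc by (cases "X = 0") (auto simp: add.commute)
  qed simp
  also have "2 - 1 / real X \<le> 2" by simp
  finally show ?thesis .
qed

text \<open>The true order is logarithmic. The square root suits the sieve below, where the sum is
  multiplied by \<open>M0 \<le> sqrt \<kappa> * sqrt X\<close> and so contributes no more than the
  order of the main term \<open>X\<close>.\<close>

lemma sum_inverse_le_sqrt: "(\<Sum>d=1..X. 1 / real d) \<le> 2 * sqrt (real X)"
proof (induction X)
  case (Suc X)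
  have s: "0 < sqrt (real X + 1)" "sqrt (real X) \<le> sqrt (real X + 1)" by simp_all
  have "1 = (sqrt (real X + 1) - sqrt (real X)) * (sqrt (real X + 1) + sqrt (real X))"
    by (simp add: algebra_simps)
  also have "\<dots> \<le> (sqrt (real X + 1) - sqrt (real X)) * (2 * sqrt (real X + 1))"
    using s by (intro mult_left_mono) auto
  finally have "1 / sqrt (real X + 1) \<le> 2 * (sqrt (real X + 1) - sqrt (real X))"
    using s by (simp add: field_simps)
  moreover have "1 / (real X + 1) \<le> 1 / sqrt (real X + 1)"
    by (intro frac_le) (auto simp: real_le_lsqrt power2_eq_square algebra_simps)
  ultimately show ?case using Suc by (simp add: add.commute)
qed simp

text \<open>Sieving by all primes of \<open>M\<close> would leave an error \<open>\<phi> M\<close>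
  for each divisor \<open>d\<close>, too much when \<open>M\<close> is as large as
  \<open>X ^ 2\<close>. Sieving by \<open>M0\<close>, the product of the smallest quarter, changes
  the density by at most a factor 4, and \<open>M0 ^ 4 \<le> M \<le> (\<kappa> * X) ^ 2\<close>
  bounds the error. The weights \<open>1 / totient_ratio j\<close> are handled by expanding them
  into divisor sums.\<close>

lemma sum_inverse_totient_ratio_coprime_le:
  fixes \<kappa> :: real
  assumes "0 < M" "0 < \<kappa>" "real M \<le> (\<kappa> * real X)\<^sup>2"
  shows "(\<Sum>j | j \<le> X \<and> 0 < j \<and> coprime j M. 1 / totient_ratio j)
           \<le> 16 * (1 + sqrt \<kappa>) * totient_ratio M * real X"
proof -
  obtain Q0 where Q0: "Q0 \<subseteq> prime_factors M" "\<Prod>Q0 ^ 4 \<le> \<Prod>(prime_factors M)"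
    "(\<Prod>q\<in>Q0. 1 - 1 / real q) \<le> 4 * (\<Prod>q\<in>prime_factors M. 1 - 1 / real q)"
    using prod_quarter[of "prime_factors M"] by (auto intro: prime_ge_2_nat)
  have fin: "finite Q0" using Q0(1) by (rule finite_subset) simp
  have prime: "prime q" if "q \<in> Q0" for q using that Q0(1) by auto
  define M0 where "M0 = \<Prod>Q0"
  have M0: "0 < M0" unfolding M0_def using prime by (intro prod_pos) (auto simp: prime_gt_0_nat)
  note rad = prod_prime_factors_dvd[OF assms(1)]
  have dvd: "M0 dvd M"
    unfolding M0_def using prod_dvd_prod_subset[OF _ Q0(1), of "\<lambda>q. q"] rad by (auto intro: dvd_trans)
  have pf: "prime_factors M0 = Q0"
  proof (intro equalityI subsetI)
    fix x assume "x \<in> prime_factors M0"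
    hence x: "prime x" "x dvd M0" by auto
    then obtain y where "y \<in> Q0" "x dvd y" unfolding M0_def using fin by (auto simp: prime_dvd_prod_iff)
    thus "x \<in> Q0" using x prime primes_dvd_imp_eq by metis
  next
    fix x assume "x \<in> Q0"
    thus "x \<in> prime_factors M0" using M0 prime dvd_prodI[OF fin, of x "\<lambda>q. q"]
      by (simp add: prime_factors_dvd M0_def)
  qed
  have "real (M0 ^ 4) \<le> real M"
    using Q0(2) rad assms(1) by (simp only: M0_def of_nat_le_iff) (meson dvd_imp_le le_trans)
  hence "((real M0)\<^sup>2)\<^sup>2 \<le> (\<kappa> * real X)\<^sup>2" using assms(3) by (simp flip: power_mult of_nat_power)
  hence "(real M0)\<^sup>2 \<le> \<kappa> * real X"
    using assms(2) by (subst (asm) power2_le_iff_abs_le) auto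
  hence M0_le: "real M0 \<le> sqrt \<kappa> * sqrt (real X)"
    using real_le_rsqrt real_sqrt_mult by metis
  have ratio: "totient_ratio M0 \<le> 4 * totient_ratio M"
    using Q0(3) by (simp add: totient_ratio_def pf)
  let ?J = "{j. j \<le> X \<and> 0 < j \<and> coprime j M0}"
  have finJ: "finite ?J" by (rule finite_subset[of _ "{..X}"]) auto
  have "(\<Sum>j | j \<le> X \<and> 0 < j \<and> coprime j M. 1 / totient_ratio j) \<le> (\<Sum>j\<in>?J. 1 / totient_ratio j)"
    using finJ dvd by (intro sum_mono2) (auto intro: coprime_divisors[OF dvd_refl] less_imp_le[OF totient_ratio_pos])
  also have "\<dots> \<le> (\<Sum>j\<in>?J. 2 * (\<Sum>d | d dvd j. 1 / real d))"
    by (intro sum_mono inverse_totient_ratio_le) auto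
  also have "\<dots> = 2 * (\<Sum>j\<in>?J. \<Sum>d | d \<in> {1..X} \<and> d dvd j. 1 / real d)"
  proof -
    have "{d. d dvd j} = {d. d \<in> {1..X} \<and> d dvd j}" if "j \<in> ?J" for j
      using that by (auto dest: dvd_imp_le intro: Nat.gr0I)
    thus ?thesis by (simp add: sum_distrib_left)
  qed
  also have "(\<Sum>j\<in>?J. \<Sum>d | d \<in> {1..X} \<and> d dvd j. 1 / real d)
      = (\<Sum>d\<in>{1..X}. \<Sum>j | j \<in> ?J \<and> d dvd j. 1 / real d)"
    using finJ by (rule sum.swap_restrict) simp
  also have "\<dots> \<le> (\<Sum>d=1..X. 1 / real d * ((real X / real d / real M0 + 1) * real (totient M0)))"
  proof (rule sum_mono)
    fix d assume d: "d \<in> {1..X}"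
    \<comment> \<open>Write \<open>j = d * i\<close>. Of the coprimality of \<open>j\<close> to
      \<open>M0\<close> only that of \<open>i\<close> is kept.\<close>
    have "{j. j \<in> ?J \<and> d dvd j} \<subseteq> (\<lambda>i. d * i) ` {i. i \<le> X div d \<and> 0 < i \<and> coprime i M0}"
    proof
      fix j assume j: "j \<in> {j. j \<in> ?J \<and> d dvd j}"
      then obtain i where i: "j = d * i" by blast
      have "i \<le> X div d" using j d i by (simp add: less_eq_div_iff_mult_less_eq mult.commute)
      thus "j \<in> (\<lambda>i. d * i) ` {i. i \<le> X div d \<and> 0 < i \<and> coprime i M0}"
        using j i by auto
    qed
    hence "card {j. j \<in> ?J \<and> d dvd j} \<le> card {i. i \<le> X div d \<and> 0 < i \<and> coprime i M0}"
      by (rule surj_card_le[rotated]) (auto intro: finite_subset[of _ "{..X div d}"])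
    hence "real (card {j. j \<in> ?J \<and> d dvd j}) \<le> (real (X div d) / real M0 + 1) * real (totient M0)"
      using card_coprime_atMost_le[OF M0, of "X div d"] by linarith
    also have "\<dots> \<le> (real X / real d / real M0 + 1) * real (totient M0)"
      by (intro mult_right_mono add_right_mono divide_right_mono of_nat_div_le_of_nat) auto
    finally have "real (card {j. j \<in> ?J \<and> d dvd j}) \<le> (real X / real d / real M0 + 1) * real (totient M0)" .
    hence "1 / real d * real (card {j. j \<in> ?J \<and> d dvd j})
       \<le> 1 / real d * ((real X / real d / real M0 + 1) * real (totient M0))"
      by (rule mult_left_mono) simp
    thus "(\<Sum>j | j \<in> ?J \<and> d dvd j. 1 / real d)
       \<le> 1 / real d * ((real X / real d / real M0 + 1) * real (totient M0))" by simp
  qed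
  also have "\<dots> = totient_ratio M0 * (real X * (\<Sum>d=1..X. 1 / (real d)\<^sup>2) + real M0 * (\<Sum>d=1..X. 1 / real d))"
    unfolding sum_distrib_left sum.distrib[symmetric] distrib_left
    using M0 by (intro sum.cong) (auto simp: totient_ratio field_simps power2_eq_square)
  \<comment> \<open>Main term and error are now both of order \<open>X\<close>. The factor 2
    extracted here, the 2 of \<open>inverse_totient_ratio_le\<close> and the 4 of
    \<open>ratio\<close> make up the constant 16.\<close>
  also have "\<dots> \<le> totient_ratio M0 * (real X * 2 + (sqrt \<kappa> * sqrt (real X)) * (2 * sqrt (real X)))"
    using M0_le assms(2) less_imp_le[OF totient_ratio_pos[of M0]]
    by (intro mult_left_mono add_mono mult_mono sum_inverse_square_le sum_inverse_le_sqrt sum_nonneg) auto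
  also have "\<dots> = totient_ratio M0 * (2 * (1 + sqrt \<kappa>) * real X)" by (simp add: algebra_simps)
  also have "\<dots> \<le> 4 * totient_ratio M * (2 * (1 + sqrt \<kappa>) * real X)"
    using ratio assms(2) by (intro mult_right_mono) auto
  finally show ?thesis by (simp add: algebra_simps)
qed


section \<open>Sieving residue classes with the Chinese remainder theorem\<close>

lemma card_avoid_residues:
  fixes B :: "nat \<Rightarrow> nat set"
  assumes "finite Q" "\<And>q. q \<in> Q \<Longrightarrow> prime q" "\<And>q. q \<in> Q \<Longrightarrow> B q \<subseteq> {..<q}"
  shows "card {u. u < \<Prod>Q \<and> (\<forall>q\<in>Q. u mod q \<notin> B q)} = (\<Prod>q\<in>Q. q - card (B q))"
  using assms
proof (induction Q rule: finite_induct)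
  case (insert q Q)
  let ?P = "\<Prod>Q"
  let ?A = "{u. u < ?P \<and> (\<forall>q\<in>Q. u mod q \<notin> B q)}"
  have P0: "?P > 0" using insert by (intro prod_pos) (auto simp: prime_gt_0_nat)
  have q: "prime q" "0 < q" using insert by (auto simp: prime_gt_0_nat)
  have cop: "coprime ?P q"
    using insert by (intro prod_coprime_left) (metis insertCI primes_coprime)
  have dvd: "x dvd ?P" if "x \<in> Q" for x using that insert.hyps(1) by (intro dvd_prodI)
  have "bij_betw (\<lambda>u. (u mod ?P, u mod q)) {u. u < \<Prod>(insert q Q) \<and> (\<forall>x\<in>insert q Q. u mod x \<notin> B x)}
      (?A \<times> ({..<q} - B q))" (is "bij_betw ?f ?S ?T")
  proof (rule bij_betw_imageI)
    show "inj_on ?f ?S"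
    proof (rule inj_onI)
      fix u v assume uv: "u \<in> ?S" "v \<in> ?S" "?f u = ?f v"
      hence "[u = v] (mod ?P)" "[u = v] (mod q)" by (auto simp: cong_def)
      hence "[u = v] (mod ?P * q)" using cop by (rule coprime_cong_mult_nat)
      thus "u = v" using uv insert.hyps by (auto simp: cong_def mult.commute)
    qed
    show "?f ` ?S = ?T"
    proof (intro equalityI subsetI)
      fix y assume "y \<in> ?f ` ?S"
      then obtain u where u: "u \<in> ?S" "y = ?f u" by blast
      have "u mod ?P mod x = u mod x" if "x \<in> Q" for x
        using dvd[OF that] by (rule mod_mod_cancel)
      thus "y \<in> ?T" using u P0 q by auto
    next
      fix y assume "y \<in> ?T"
      then obtain a b where y: "y = (a, b)" "a \<in> ?A" "b < q" "b \<notin> B q" by blast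
      obtain u where u: "u < ?P * q" "[u = a] (mod ?P)" "[u = b] (mod q)"
        using binary_chinese_remainder_unique_nat[OF cop, of a b] P0 q by blast
      have ua: "u mod ?P = a" "u mod q = b" using u y by (auto simp: cong_def)
      have "u mod x = a mod x" if "x \<in> Q" for x
        using mod_mod_cancel[OF dvd[OF that], of u] ua by simp
      hence "u \<in> ?S" using u ua y insert.hyps by (auto simp: mult.commute)
      thus "y \<in> ?f ` ?S" using ua y by (intro image_eqI[of _ _ u]) auto
    qed
  qed
  hence "card ?S = card ?A * card ({..<q} - B q)"
    by (simp add: bij_betw_same_card card_cartesian_product)
  also have "card ({..<q} - B q) = q - card (B q)"
    using insert.prems(2)[of q] finite_subset[of "B q" "{..<q}"] by (subst card_Diff_subset) auto
  also have "card ?A = (\<Prod>q\<in>Q. q - card (B q))" using insert by simp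
  finally show ?case using insert.hyps by (simp add: mult.commute)
qed simp

text \<open>The conditions only see \<open>u\<close> modulo the product of the primes dividing
  \<open>g\<close>. That product divides \<open>g\<close>, so the range consists of full periods,
  each counted by \<open>card_avoid_residues\<close>.\<close>

lemma card_avoid_residues_le:
  fixes B :: "nat \<Rightarrow> nat set"
  assumes "0 < g" "\<And>q. q \<in> prime_factors g \<Longrightarrow> B q \<subseteq> {..<q}"
  shows "real (card {u. u < g \<and> (\<forall>q\<in>prime_factors g. u mod q \<notin> B q)})
           \<le> real g * (\<Prod>q\<in>prime_factors g. 1 - real (card (B q)) / real q)"
proof -
  let ?Q = "prime_factors g" and ?P = "\<Prod>(prime_factors g)"
  let ?A = "{u. u < ?P \<and> (\<forall>q\<in>?Q. u mod q \<notin> B q)}"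
  have P0: "?P > 0" by (intro prod_pos) (auto simp: in_prime_factors_iff prime_gt_0_nat)
  obtain k where k: "g = ?P * k" using prod_prime_factors_dvd[OF assms(1)] by blast
  have dvd: "x dvd ?P" if "x \<in> ?Q" for x using that by (intro dvd_prodI) auto
  have "card {u. u < g \<and> (\<forall>q\<in>?Q. u mod q \<notin> B q)} \<le> card ({..<k} \<times> ?A)"
  proof (rule card_inj_on_le[where f = "\<lambda>u. (u div ?P, u mod ?P)"])
    show "inj_on (\<lambda>u. (u div ?P, u mod ?P)) {u. u < g \<and> (\<forall>q\<in>?Q. u mod q \<notin> B q)}"
      by (rule inj_onI) (metis div_mult_mod_eq prod.inject)
    have "u div ?P < k" if "u < g" for u
      using that k by (metis less_mult_imp_div_less mult.commute)
    moreover have "u mod ?P mod x = u mod x" if "x \<in> ?Q" for u x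
      using dvd[OF that] by (rule mod_mod_cancel)
    ultimately show "(\<lambda>u. (u div ?P, u mod ?P)) ` {u. u < g \<and> (\<forall>q\<in>?Q. u mod q \<notin> B q)} \<subseteq> {..<k} \<times> ?A"
      using P0 by auto
  qed simp
  also have "\<dots> = k * (\<Prod>q\<in>?Q. q - card (B q))"
    using card_avoid_residues[of ?Q B] assms(2)
    by (subst card_cartesian_product) (auto simp: in_prime_factors_iff)
  finally have "real (card {u. u < g \<and> (\<forall>q\<in>?Q. u mod q \<notin> B q)}) \<le> real (k * (\<Prod>q\<in>?Q. q - card (B q)))"
    by (rule of_nat_mono)
  also have "\<dots> = real k * (\<Prod>q\<in>?Q. real q * (1 - real (card (B q)) / real q))"
  proof -
    have "real (q - card (B q)) = real q * (1 - real (card (B q)) / real q)" if "q \<in> ?Q" for q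
    proof -
      have "card (B q) \<le> q" using card_mono[OF _ assms(2)[OF that]] by simp
      moreover have "0 < q" using that by (simp add: in_prime_factors_iff prime_gt_0_nat)
      ultimately show ?thesis by (simp add: of_nat_diff field_simps)
    qed
    thus ?thesis by simp
  qed
  also have "\<dots> = real g * (\<Prod>q\<in>?Q. 1 - real (card (B q)) / real q)"
    by (subst (2) k) (simp add: prod.distrib)
  finally show ?thesis .
qed

lemma ex_root_mod_prime:
  fixes a b :: int
  assumes "prime q" "\<not> int q dvd b"
  obtains v :: nat where "v < q" "int q dvd a + b * int v"
proof -
  have q0: "0 < q" using assms by (simp add: prime_gt_0_nat)
  have "coprime b (int q)"
    using assms by (metis coprime_commute prime_imp_coprime prime_nat_int_transfer)
  then obtain x where x: "[b * x = - a] (mod int q)"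
    using cong_solve_coprime_int by (metis cong_scalar_right mult.assoc mult.commute mult_1)
  define v where "v = nat (x mod int q)"
  have v: "int v = x mod int q" using q0 by (simp add: v_def)
  show ?thesis
  proof
    show "v < q" using q0 v by (metis of_nat_0_less_iff of_nat_less_iff pos_mod_bound)
    have "[b * int v = b * x] (mod int q)" unfolding v by (simp add: cong_def mod_mult_right_eq)
    hence "[b * int v = - a] (mod int q)" using x cong_trans by blast
    thus "int q dvd a + b * int v" by (simp add: cong_iff_dvd_diff add.commute)
  qed
qed

section \<open>Pairs of close reduced fractions\<close>

text \<open>Numerators are normalised to \<open>0 \<le> s < m\<close>, with \<open>s = 0\<close> for
  \<open>m = 1\<close>. Distances are taken on the line without wrap-around, matching the intervals
  in \<open>reduced_count\<close>.\<close>

definition close_pairs :: "nat \<Rightarrow> nat \<Rightarrow> real \<Rightarrow> (nat \<times> nat) set" where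
  "close_pairs m n R = {(s, t). s < m \<and> coprime s m \<and> t < n \<and> coprime t n \<and>
     \<bar>real s / real m - real t / real n\<bar> \<le> R}"

lemma close_pairs_subset: "close_pairs m n R \<subseteq> {..<m} \<times> {..<n}"
  by (auto simp: close_pairs_def)

lemma finite_close_pairs: "finite (close_pairs m n R)"
  by (rule finite_subset[OF close_pairs_subset]) simp

text \<open>For \<open>m = g * a\<close> and \<open>n = g * b\<close> with \<open>g\<close> the gcd,
  \<open>j\<close> is the numerator of \<open>s / m - t / n\<close> over the least common multiple
  \<open>g * a * b\<close>.\<close>

definition int_gcd_pairs :: "nat \<Rightarrow> nat \<Rightarrow> nat \<Rightarrow> int \<Rightarrow> (nat \<times> nat) set" where
  "int_gcd_pairs g a b j = {(s, t). s < g * a \<and> coprime s (g * a) \<and> t < g * b \<and> coprime t (g * b) \<and>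
     int s * int b - int t * int a = j}"

text \<open>A common prime of \<open>j\<close> and \<open>a\<close> would divide
  \<open>s * b\<close>, while \<open>s\<close> and \<open>b\<close> are coprime to \<open>a\<close>.
  This is the restriction on \<open>j\<close> that the sieve exploits.\<close>

lemma int_gcd_pairs_coprime:
  assumes "(s, t) \<in> int_gcd_pairs g a b j" "coprime a b"
  shows "coprime j (int (a * b))"
proof -
  have j: "j = int s * int b - int t * int a" and c: "coprime s a" "coprime t b"
    using assms(1) by (auto simp: int_gcd_pairs_def)
  have "coprime (int s * int b) (int a)" using c(1) assms(2) by (auto simp: coprime_commute)
  hence "coprime j (int a)"
    using coprime_common_divisor[of "int s * int b" "int a"] dvd_add[of _ j "int t * int a"]
    by (intro coprimeI) (auto simp: j)
  moreover have "coprime (int t * int a) (int b)" using c(2) assms(2) by (auto simp: coprime_commute)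
  hence "coprime j (int b)"
    using coprime_common_divisor[of "int t * int a" "int b"] dvd_diff[of _ "int s * int b" j]
    by (intro coprimeI) (auto simp: j)
  ultimately show ?thesis by simp
qed

text \<open>The solutions of \<open>s * b - t * a = j\<close> form a progression
  \<open>s = s0 + a * u\<close> with \<open>0 \<le> u < g\<close>. For a prime \<open>q\<close>
  dividing \<open>g\<close>, coprimality excludes the roots of \<open>s\<close> and of
  \<open>t\<close> modulo \<open>q\<close>: two distinct ones, unless \<open>q\<close> divides
  \<open>a * b\<close>, when there is only one, or \<open>j\<close>, when they coincide. The two
  denominators in the bound correct the factor \<open>(1 - 1 / q) ^ 2\<close> at these exceptional
  primes.\<close>

lemma card_int_gcd_pairs_le:
  assumes pos: "0 < g" "0 < a" "0 < b" and ab: "coprime a b" and j: "j \<noteq> 0"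
  shows "real (card (int_gcd_pairs g a b j)) \<le> real g * (totient_ratio g)\<^sup>2
    / (\<Prod>q\<in>prime_factors g \<inter> prime_factors (a * b). 1 - 1 / real q) / totient_ratio (nat \<bar>j\<bar>)"
proof (cases "int_gcd_pairs g a b j = {}")
  case True
  have "0 < (\<Prod>q\<in>prime_factors g \<inter> prime_factors (a * b). 1 - 1 / real q)"
    by (intro prod_pos) (blast dest: prime_factors_one_minus)
  thus ?thesis using True totient_ratio_pos[of "nat \<bar>j\<bar>"] by simp
next
  case False
  then obtain s1 t1 where st1: "(s1, t1) \<in> int_gcd_pairs g a b j" by auto
  hence j1: "int s1 * int b - int t1 * int a = j" by (simp add: int_gcd_pairs_def)
  define u1 s0 where "u1 = s1 div a" and "s0 = s1 mod a"
  have s1: "s1 = s0 + a * u1" by (simp add: u1_def s0_def)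
  \<comment> \<open>The residues of \<open>u\<close> for which \<open>q\<close> divides
    \<open>s\<close> or \<open>t\<close>, with both expressed through the fixed solution
    \<open>(s1, t1)\<close>.\<close>
  define B where "B q = {v. v < q \<and> (int q dvd int s0 + int a * int v \<or>
    int q dvd (int t1 - int b * int u1) + int b * int v)}" for q
  define U where "U = {u. u < g \<and> (\<forall>q\<in>prime_factors g. u mod q \<notin> B q)}"
  have Bsub: "B q \<subseteq> {..<q}" for q by (auto simp: B_def)
  have param: "s mod a = s0" "int t = int t1 + int b * (int (s div a) - int u1)"
    if st: "(s, t) \<in> int_gcd_pairs g a b j" for s t
  proof -
    have j2: "int s * int b - int t * int a = j" using st by (simp add: int_gcd_pairs_def)
    hence "(int s - int s1) * int b = (int t - int t1) * int a" using j1 by (simp add: algebra_simps)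
    hence "int a dvd (int s - int s1) * int b" by simp
    hence "int a dvd int s - int s1" using ab by (simp add: coprime_dvd_mult_left_iff)
    hence "int s mod int a = int s1 mod int a" by (simp add: mod_eq_dvd_iff)
    thus s: "s mod a = s0" by (simp add: s0_def flip: of_nat_mod)
    have "int s = int s0 + int a * int (s div a)"
      using s by (metis add.commute mult_div_mod_eq of_nat_add of_nat_mult)
    moreover have "int s1 = int s0 + int a * int u1" using s1 by simp
    ultimately have "int a * (int b * (int (s div a) - int u1)) = int a * (int t - int t1)"
      using j1 j2 by (simp add: algebra_simps)
    thus "int t = int t1 + int b * (int (s div a) - int u1)" using pos(2) by simp
  qed
  have "card (int_gcd_pairs g a b j) \<le> card U"
  proof (rule card_inj_on_le[where f = "\<lambda>(s, t). s div a"])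
    show "inj_on (\<lambda>(s, t). s div a) (int_gcd_pairs g a b j)"
    proof (rule inj_onI, clarify)
      fix s t s' t'
      assume *: "(s, t) \<in> int_gcd_pairs g a b j" "(s', t') \<in> int_gcd_pairs g a b j" "s div a = s' div a"
      have "s = s'" using * param(1) by (metis div_mult_mod_eq)
      moreover have "int t = int t'" using * param(2)[OF *(1)] param(2)[OF *(2)] by simp
      ultimately show "s = s' \<and> t = t'" by simp
    qed
    show "(\<lambda>(s, t). s div a) ` int_gcd_pairs g a b j \<subseteq> U"
    proof clarify
      fix s t assume st: "(s, t) \<in> int_gcd_pairs g a b j"
      let ?u = "s div a"
      have "?u < g" using st by (auto simp: int_gcd_pairs_def less_mult_imp_div_less)
      moreover have "?u mod q \<notin> B q" if q: "q \<in> prime_factors g" for q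
      proof
        have q': "prime q" "q dvd g" using q by auto
        have cong: "int q dvd x + y * int (?u mod q) \<longleftrightarrow> int q dvd x + y * int ?u" for x y :: int
        proof -
          have "[y * int (?u mod q) = y * int ?u] (mod int q)"
            by (simp add: cong_def zmod_int mod_mult_right_eq)
          hence "[x + y * int (?u mod q) = x + y * int ?u] (mod int q)" by (simp add: cong_add_lcancel)
          thus ?thesis by (rule cong_dvd_iff[OF _] )
        qed
        assume "?u mod q \<in> B q"
        hence "int q dvd int s0 + int a * int ?u \<or> int q dvd (int t1 - int b * int u1) + int b * int ?u"
          by (auto simp: B_def cong)
        moreover have "int s0 + int a * int ?u = int s"
          using param(1)[OF st] by (metis add.commute mult_div_mod_eq of_nat_add of_nat_mult)
        moreover have "(int t1 - int b * int u1) + int b * int ?u = int t"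
          using param(2)[OF st] by (simp add: algebra_simps)
        ultimately have "q dvd s \<or> q dvd t" by simp
        moreover have "coprime s q" "coprime t q"
          using st coprime_divisors[OF dvd_refl q'(2)] by (auto simp: int_gcd_pairs_def)
        ultimately show False using q'(1) by (metis coprime_absorb_right coprime_commute not_prime_unit)
      qed
      ultimately show "?u \<in> U" by (simp add: U_def)
    qed
  qed (simp add: U_def)
  hence "real (card (int_gcd_pairs g a b j)) \<le> real (card U)" by simp
  also have "\<dots> \<le> real g * (\<Prod>q\<in>prime_factors g. 1 - real (card (B q)) / real q)"
    unfolding U_def using pos(1) Bsub by (intro card_avoid_residues_le)
  finally have bound: "real (card (int_gcd_pairs g a b j))
    \<le> real g * (\<Prod>q\<in>prime_factors g. 1 - real (card (B q)) / real q)" .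
  have "(\<Prod>q\<in>prime_factors g. 1 - real (card (B q)) / real q)
    \<le> (\<Prod>q\<in>prime_factors g. (1 - 1 / real q)\<^sup>2 / (if q \<in> prime_factors (a * b) then 1 - 1 / real q else 1)
        / (if q \<in> prime_factors (nat \<bar>j\<bar>) then 1 - 1 / real q else 1))"
  proof (intro prod_mono conjI)
    fix q assume "q \<in> prime_factors g"
    hence q: "prime q" by auto
    hence q1: "1 < q" by (rule prime_gt_1_nat)
    have finB: "finite (B q)" using Bsub finite_subset by blast
    have card_le: "card (B q) \<le> q" using card_mono[OF _ Bsub[of q]] by simp
    thus "0 \<le> 1 - real (card (B q)) / real q" using q1 by (simp add: field_simps)
    obtain v w where v: "\<not> q dvd a \<longrightarrow> v \<in> B q \<and> int q dvd int s0 + int a * int v"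
      and w: "\<not> q dvd b \<longrightarrow> w \<in> B q \<and> int q dvd (int t1 - int b * int u1) + int b * int w"
    proof -
      have "\<exists>v. v \<in> B q \<and> int q dvd int s0 + int a * int v" if "\<not> q dvd a"
      proof -
        have "\<not> int q dvd int a" using that by simp
        then obtain v where "v < q" "int q dvd int s0 + int a * int v" by (rule ex_root_mod_prime[OF q])
        thus ?thesis unfolding B_def by blast
      qed
      moreover have "\<exists>w. w \<in> B q \<and> int q dvd (int t1 - int b * int u1) + int b * int w" if "\<not> q dvd b"
      proof -
        have "\<not> int q dvd int b" using that by simp
        then obtain w where "w < q" "int q dvd (int t1 - int b * int u1) + int b * int w"
          by (rule ex_root_mod_prime[OF q])
        thus ?thesis unfolding B_def by blast
      qed
      ultimately show ?thesis using that by metis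
    qed
    have "\<not> q dvd a \<or> \<not> q dvd b" using ab q1 coprime_common_divisor_nat[of a b q] by auto
    hence "B q \<noteq> {}" using v w by auto
    hence card1: "1 \<le> card (B q)" using finB by (simp add: Suc_le_eq card_gt_0_iff)
    have card2: "2 \<le> card (B q)" if "\<not> q dvd a * b" "\<not> q dvd nat \<bar>j\<bar>"
    proof -
      have qab: "\<not> q dvd a" "\<not> q dvd b" using that(1) by auto
      \<comment> \<open>At a common root \<open>q\<close> would divide both \<open>s\<close> and
        \<open>t\<close>, hence \<open>s * b - t * a = j\<close>.\<close>
      have "v \<noteq> w"
      proof
        assume "v = w"
        with v w qab have "int q dvd (int s0 + int a * int v) * int b - ((int t1 - int b * int u1) + int b * int v) * int a"
          by (intro dvd_diff dvd_mult2) auto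
        also have "\<dots> = int s1 * int b - int t1 * int a" by (simp add: s1 algebra_simps)
        also have "\<dots> = j" by (rule j1)
        finally show False using that(2) by (simp add: nat_abs_dvd_iff dvd_nat_abs_iff)
      qed
      moreover have "{v, w} \<subseteq> B q" using v w qab by simp
      ultimately show ?thesis using card_mono[OF finB, of "{v, w}"] by simp
    qed
    define x where "x = 1 - 1 / real q"
    have x: "0 < x" "x < 1" using q1 by (auto simp: x_def)
    have e1: "1 - real (card (B q)) / real q \<le> x" using card1 q1 by (simp add: x_def divide_right_mono)
    have e2: "1 - real (card (B q)) / real q \<le> x\<^sup>2" if "2 \<le> card (B q)"
    proof -
      have "1 - real (card (B q)) / real q \<le> 1 - 2 / real q" using that q1 by (simp add: divide_right_mono)
      also have "\<dots> \<le> x\<^sup>2" by (simp add: x_def power2_eq_square algebra_simps)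
      finally show ?thesis .
    qed
    have mem: "q \<in> prime_factors (a * b) \<longleftrightarrow> q dvd a * b" "q \<in> prime_factors (nat \<bar>j\<bar>) \<longleftrightarrow> q dvd nat \<bar>j\<bar>"
      using q pos j by (auto simp: in_prime_factors_iff)
    show "1 - real (card (B q)) / real q \<le> (1 - 1 / real q)\<^sup>2 / (if q \<in> prime_factors (a * b) then 1 - 1 / real q else 1)
        / (if q \<in> prime_factors (nat \<bar>j\<bar>) then 1 - 1 / real q else 1)"
      unfolding mem x_def[symmetric] using e1 e2 card2 x by (auto simp: power2_eq_square)
  qed
  also have "\<dots> = (totient_ratio g)\<^sup>2 / (\<Prod>q\<in>prime_factors g \<inter> prime_factors (a * b). 1 - 1 / real q)
      / (\<Prod>q\<in>prime_factors g \<inter> prime_factors (nat \<bar>j\<bar>). 1 - 1 / real q)"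
    by (simp add: prod_dividef prod_power_distrib totient_ratio_def prod.inter_restrict prod.distrib)
  also have "\<dots> \<le> (totient_ratio g)\<^sup>2 / (\<Prod>q\<in>prime_factors g \<inter> prime_factors (a * b). 1 - 1 / real q)
      / totient_ratio (nat \<bar>j\<bar>)"
  proof -
    note 1 = prime_factors_one_minus
    \<comment> \<open>Passing from the common primes of \<open>g\<close> and \<open>j\<close> to all
      primes of \<open>j\<close> only lowers the product in the denominator.\<close>
    have "totient_ratio (nat \<bar>j\<bar>) = (\<Prod>q\<in>prime_factors (nat \<bar>j\<bar>) - prime_factors g \<inter> prime_factors (nat \<bar>j\<bar>). 1 - 1 / real q)
      * (\<Prod>q\<in>prime_factors g \<inter> prime_factors (nat \<bar>j\<bar>). 1 - 1 / real q)"
      unfolding totient_ratio_def by (rule prod.subset_diff) auto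
    also have "\<dots> \<le> 1 * (\<Prod>q\<in>prime_factors g \<inter> prime_factors (nat \<bar>j\<bar>). 1 - 1 / real q)"
      using 1 by (intro mult_right_mono prod_le_1 prod_nonneg) (auto intro: less_imp_le)
    finally have "totient_ratio (nat \<bar>j\<bar>) \<le> (\<Prod>q\<in>prime_factors g \<inter> prime_factors (nat \<bar>j\<bar>). 1 - 1 / real q)" by simp
    moreover have "0 \<le> (totient_ratio g)\<^sup>2 / (\<Prod>q\<in>prime_factors g \<inter> prime_factors (a * b). 1 - 1 / real q)"
      proof (intro divide_nonneg_pos prod_pos)
        fix q assume "q \<in> prime_factors g \<inter> prime_factors (a * b)"
        hence "q \<in> prime_factors g" by blast
        thus "0 < 1 - 1 / real q" using 1 by blast
      qed simp
    ultimately show ?thesis using totient_ratio_pos[of "nat \<bar>j\<bar>"]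
      by (intro divide_left_mono mult_pos_pos less_le_trans[OF totient_ratio_pos]) auto
  qed
  finally have "real g * (\<Prod>q\<in>prime_factors g. 1 - real (card (B q)) / real q)
    \<le> real g * ((totient_ratio g)\<^sup>2 / (\<Prod>q\<in>prime_factors g \<inter> prime_factors (a * b). 1 - 1 / real q)
      / totient_ratio (nat \<bar>j\<bar>))" by (rule mult_left_mono) simp
  with bound show ?thesis by simp
qed

text \<open>Being coprime to \<open>a * b\<close>, the difference can vanish only for
  \<open>a = b = 1\<close>: reduced fractions coincide only on the diagonal.\<close>

lemma int_gcd_pairs_0:
  assumes "0 < g" "0 < a" "0 < b" "coprime a b"
  shows "card (int_gcd_pairs g a b 0) \<le> (if a = b then totient g else 0)"
proof -
  have 1: "a = 1 \<and> b = 1 \<and> s = t" if "(s, t) \<in> int_gcd_pairs g a b 0" for s t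
  proof -
    have "coprime (int 0) (int (a * b))"
      using int_gcd_pairs_coprime[OF that assms(4)] by simp
    hence "a = 1" "b = 1" by simp_all
    thus ?thesis using that by (simp add: int_gcd_pairs_def)
  qed
  show ?thesis
  proof (cases "a = b")
    case True
    hence "a = 1" "b = 1" using assms(4) by auto
    hence "int_gcd_pairs g a b 0 \<subseteq> (\<lambda>s. (s, s)) ` {s. s < g \<and> coprime s g}"
      by (auto simp: int_gcd_pairs_def)
    hence "card (int_gcd_pairs g a b 0) \<le> card {s. s < g \<and> coprime s g}"
      by (rule surj_card_le[rotated]) simp
    thus ?thesis using True by (simp add: card_coprime_lessThan)
  next
    case False
    hence "int_gcd_pairs g a b 0 = {}" using 1 by auto
    thus ?thesis by simp
  qed
qed

text \<open>The pairs are sorted by \<open>j\<close>, whose absolute value is at most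
  \<open>R * g * a * b\<close>. The hypothesis on \<open>R\<close> makes this range at least
  \<open>c * (a + b)\<close>, so \<open>a * b\<close> is at most the square of a multiple of it, as
  the sieve bound demands.\<close>

lemma card_close_pairs_le:
  fixes c R :: real
  assumes mn: "0 < m" "0 < n" and c: "0 < c" and R: "c / real m + c / real n \<le> R"
  shows "real (card (close_pairs m n R)) \<le> (if m = n then real (totient n) else 0) +
    32 * (1 + sqrt (2 / c)) * R * real (totient m) * real (totient n)"
proof -
  define g a b where "g = gcd m n" and "a = m div g" and "b = n div g"
  have g: "0 < g" "m = g * a" "n = g * b" using mn by (auto simp: g_def a_def b_def)
  have ab: "0 < a" "0 < b" "coprime a b"
  proof -
    show "0 < a" "0 < b" using mn g(2,3) by (auto intro: Nat.gr0I)
    show "coprime a b" unfolding a_def b_def g_def by (rule div_gcd_coprime) (use mn in simp)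
  qed
  define M where "M = a * b"
  define X where "X = nat \<lfloor>R * real (g * a * b)\<rfloor>"
  define I where "I = (\<Prod>q\<in>prime_factors g \<inter> prime_factors M. 1 - 1 / real q)"
  have M: "0 < M" using ab by (simp add: M_def)
  have I: "0 < I" unfolding I_def by (intro prod_pos) (blast dest: prime_factors_one_minus)
  have "0 < c / real m + c / real n" using c mn by (intro add_pos_pos) auto
  hence R0: "0 < R" using R by linarith
  let ?S = "int_gcd_pairs g a b"
  let ?J = "{j. j \<le> X \<and> 0 < j \<and> coprime j M}"
  have finJ: "finite ?J" by (rule finite_subset[of _ "{..X}"]) auto
  have finS: "finite (?S j)" for j
    by (rule finite_subset[of _ "{..<g * a} \<times> {..<g * b}"]) (auto simp: int_gcd_pairs_def)
  have "close_pairs m n R \<subseteq> ?S 0 \<union> (\<Union>j\<in>?J. ?S (int j) \<union> ?S (- int j))"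
  proof clarify
    fix s t assume st: "(s, t) \<in> close_pairs m n R"
      and no: "(s, t) \<notin> (\<Union>j\<in>?J. ?S (int j) \<union> ?S (- int j))"
    define j where "j = int s * int b - int t * int a"
    have S: "(s, t) \<in> ?S j" using st by (simp add: int_gcd_pairs_def close_pairs_def j_def g(2,3))
    have "real s / real m - real t / real n = of_int j / real (g * a * b)"
      using ab g(1) by (simp add: g(2,3) j_def field_simps)
    hence "\<bar>of_int j / real (g * a * b)\<bar> \<le> R" using st by (simp add: close_pairs_def)
    hence "real_of_int \<bar>j\<bar> \<le> R * real (g * a * b)"
      using ab g(1) by (simp add: abs_divide abs_mult field_simps)
    hence X: "nat \<bar>j\<bar> \<le> X" unfolding X_def by (intro nat_mono) (simp add: le_floor_iff)
    have "coprime j (int M)" unfolding M_def using S ab(3) by (rule int_gcd_pairs_coprime)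
    hence cop: "coprime (nat \<bar>j\<bar>) M" by (simp flip: coprime_int_iff)
    show "(s, t) \<in> ?S 0"
    proof (cases "j = 0")
      case False
      hence "nat \<bar>j\<bar> \<in> ?J" using X cop by simp
      moreover have "j = int (nat \<bar>j\<bar>) \<or> j = - int (nat \<bar>j\<bar>)" by auto
      hence "(s, t) \<in> ?S (int (nat \<bar>j\<bar>)) \<union> ?S (- int (nat \<bar>j\<bar>))" using S by (metis UnCI)
      ultimately show ?thesis using no by blast
    qed (use S in simp)
  qed
  hence "card (close_pairs m n R) \<le> card (?S 0 \<union> (\<Union>j\<in>?J. ?S (int j) \<union> ?S (- int j)))"
    using finJ finS by (intro card_mono) auto
  also have "\<dots> \<le> card (?S 0) + (\<Sum>j\<in>?J. card (?S (int j)) + card (?S (- int j)))"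
    using finJ by (intro order_trans[OF card_Un_le] add_left_mono order_trans[OF card_UN_le] sum_mono card_Un_le)
  finally have "real (card (close_pairs m n R)) \<le> real (card (?S 0) + (\<Sum>j\<in>?J. card (?S (int j)) + card (?S (- int j))))"
    by (rule of_nat_mono)
  also have "\<dots> \<le> (if m = n then real (totient n) else 0) +
      (\<Sum>j\<in>?J. 2 * (real g * (totient_ratio g)\<^sup>2 / I * (1 / totient_ratio j)))"
  proof -
    have "real (card (?S 0)) \<le> (if m = n then real (totient n) else 0)"
    proof (cases "a = b")
      case True
      hence "a = 1" "b = 1" using ab(3) by auto
      thus ?thesis using int_gcd_pairs_0[OF g(1) ab] g by simp
    next
      case False
      thus ?thesis using int_gcd_pairs_0[OF g(1) ab] by simp
    qed
    moreover have "real (card (?S (int j))) + real (card (?S (- int j)))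
        \<le> 2 * (real g * (totient_ratio g)\<^sup>2 / I * (1 / totient_ratio j))" if "j \<in> ?J" for j
    proof -
      have "real (card (?S i)) \<le> real g * (totient_ratio g)\<^sup>2 / I * (1 / totient_ratio j)"
        if "i = int j \<or> i = - int j" for i
        using card_int_gcd_pairs_le[OF g(1) ab, of i] that \<open>j \<in> ?J\<close> by (auto simp: I_def M_def)
      from this[of "int j"] this[of "- int j"] show ?thesis by linarith
    qed
    ultimately show ?thesis unfolding of_nat_add of_nat_sum by (intro add_mono sum_mono)
  qed
  also have "(\<Sum>j\<in>?J. 2 * (real g * (totient_ratio g)\<^sup>2 / I * (1 / totient_ratio j)))
      = 2 * real g * (totient_ratio g)\<^sup>2 / I * (\<Sum>j\<in>?J. 1 / totient_ratio j)"
    by (simp add: sum_distrib_left mult.assoc)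
  also have "\<dots> \<le> 2 * real g * (totient_ratio g)\<^sup>2 / I * (16 * (1 + sqrt (2 / c)) * totient_ratio M * (R * real (g * a * b)))"
  proof (rule mult_left_mono)
    show "(\<Sum>j\<in>?J. 1 / totient_ratio j) \<le> 16 * (1 + sqrt (2 / c)) * totient_ratio M * (R * real (g * a * b))"
    proof (cases "X = 0")
      case True
      hence "?J = {}" by auto
      thus ?thesis using R0 c less_imp_le[OF totient_ratio_pos[of M]] by (simp only: sum.empty) simp
    next
      case False
      have D1: "1 \<le> R * real (g * a * b)" using False unfolding X_def by linarith
      have XD: "real X \<le> R * real (g * a * b)" using D1 unfolding X_def by linarith
      have "R * real (g * a * b) \<le> real X + 1" using D1 unfolding X_def by linarith
      \<comment> \<open>For \<open>X \<ge> 1\<close> rounding down loses at most a factor 2; hence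
        the sieve is applied with \<open>\<kappa> = 2 / c\<close>.\<close>
      hence DX: "R * real (g * a * b) \<le> 2 * real X" using False by linarith
      have "(c / real m + c / real n) * real (g * a * b) = c * (real a + real b)"
        using ab g(1) by (simp add: g(2,3) field_simps)
      hence "c * (real a + real b) \<le> R * real (g * a * b)"
        using R by (metis mult_right_mono of_nat_0_le_iff)
      hence "real a + real b \<le> 2 / c * real X" using DX c by (simp add: field_simps)
      hence "real a \<le> 2 / c * real X" "real b \<le> 2 / c * real X" by linarith+
      hence "real M \<le> (2 / c * real X)\<^sup>2"
        using c unfolding M_def power2_eq_square of_nat_mult by (intro mult_mono) auto
      hence "(\<Sum>j\<in>?J. 1 / totient_ratio j) \<le> 16 * (1 + sqrt (2 / c)) * totient_ratio M * real X"
        using c M by (intro sum_inverse_totient_ratio_coprime_le) auto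
      also have "\<dots> \<le> 16 * (1 + sqrt (2 / c)) * totient_ratio M * (R * real (g * a * b))"
        using XD c less_imp_le[OF totient_ratio_pos[of M]] by (intro mult_left_mono) auto
      finally show ?thesis .
    qed
  qed (use I in auto)
  also have "\<dots> = 32 * (1 + sqrt (2 / c)) * R * (real m * real n * ((totient_ratio g)\<^sup>2 * totient_ratio M / I))"
    by (simp add: g(2,3) field_simps)
  \<comment> \<open>Dividing by \<open>I\<close> removes the primes shared with \<open>g\<close>
    from \<open>totient_ratio M\<close>. The remaining primes of \<open>a\<close> and of
    \<open>b\<close> are disjoint sets, which complete the two copies of
    \<open>totient_ratio g\<close> to the ratios of \<open>m\<close> and \<open>n\<close>.\<close>
  also have "(totient_ratio g)\<^sup>2 * totient_ratio M / I = totient_ratio m * totient_ratio n"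
  proof -
    let ?f = "\<lambda>Q. \<Prod>q\<in>Q. 1 - 1 / real q" and ?P = "prime_factors :: nat \<Rightarrow> nat set"
    have PM: "?P M = ?P a \<union> ?P b" using ab by (simp add: M_def prime_factors_product)
    have disj: "?P a \<inter> ?P b = {}"
      using ab(3) by (auto simp: in_prime_factors_iff) (metis coprime_common_divisor_nat not_prime_1)
    have Pg: "?P m = ?P g \<union> (?P a - ?P g)" "?P n = ?P g \<union> (?P b - ?P g)"
      using ab g(1) by (auto simp: g(2,3) prime_factors_product)
    have "totient_ratio m = ?f (?P g) * ?f (?P a - ?P g)" "totient_ratio n = ?f (?P g) * ?f (?P b - ?P g)"
      unfolding totient_ratio_def Pg by (intro prod.union_disjoint; auto)+
    moreover have "?f (?P M - ?P g) = ?f (?P a - ?P g) * ?f (?P b - ?P g)"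
      unfolding PM Un_Diff using disj by (intro prod.union_disjoint) auto
    moreover have "totient_ratio M = ?f (?P M - ?P g) * I"
    proof -
      have "totient_ratio M = ?f (?P M - ?P g \<inter> ?P M) * ?f (?P g \<inter> ?P M)"
        unfolding totient_ratio_def by (rule prod.subset_diff) auto
      moreover have "?P M - ?P g \<inter> ?P M = ?P M - ?P g" by blast
      ultimately show ?thesis by (simp add: I_def)
    qed
    ultimately show ?thesis using I by (simp add: totient_ratio_def[of g] power2_eq_square)
  qed
  also have "32 * (1 + sqrt (2 / c)) * R * (real m * real n * (totient_ratio m * totient_ratio n))
    = 32 * (1 + sqrt (2 / c)) * R * real (totient m) * real (totient n)" by (simp add: totient_ratio)
  finally show ?thesis by simp
qed

text \<open>There are at most \<open>log 2 n\<close> prime factors, as each is at least 2. The bound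
  serves to show that the totient tends to infinity, which forces the truncated radii to 0.\<close>

lemma totient_ge:
  assumes "0 < n"
  shows "real n / (log 2 (real n) + 1) \<le> real (totient n)"
proof -
  let ?Q = "prime_factors n"
  have "2 ^ card ?Q \<le> \<Prod>?Q"
    using prod_mono[of ?Q "\<lambda>_. 2::nat" "\<lambda>q. q"] by (simp add: in_prime_factors_iff prime_ge_2_nat)
  also have "\<Prod>?Q \<le> n" using prod_prime_factors_dvd[OF assms] assms by (rule dvd_imp_le)
  finally have "real (card ?Q) \<le> log 2 (real n)"
    using assms by (simp add: le_log_iff powr_realpow)
  hence "1 / (log 2 (real n) + 1) \<le> 1 / (real (card ?Q) + 1)" by (intro frac_le) auto
  also have "\<dots> \<le> totient_ratio n"
    unfolding totient_ratio_def
    by (rule prod_one_minus_inverse_ge) (auto simp: in_prime_factors_iff prime_ge_2_nat)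
  finally have "real n * (1 / (log 2 (real n) + 1)) \<le> real n * totient_ratio n"
    by (rule mult_left_mono) simp
  thus ?thesis by (simp add: totient_ratio)
qed

lemma finite_totient_le: "finite {n. 0 < n \<and> real (totient n) \<le> B}"
proof -
  have "filterlim (\<lambda>n. real n / (log 2 (real n) + 1)) at_top sequentially" by real_asymp
  hence "eventually (\<lambda>n. B < real n / (log 2 (real n) + 1)) sequentially"
    by (simp add: filterlim_at_top_dense)
  then obtain N where N: "\<And>n. n \<ge> N \<Longrightarrow> B < real n / (log 2 (real n) + 1)"
    by (auto simp: eventually_sequentially)
  have "{n. 0 < n \<and> real (totient n) \<le> B} \<subseteq> {..<N}"
  proof
    fix n assume n: "n \<in> {n. 0 < n \<and> real (totient n) \<le> B}"
    hence "real n / (log 2 (real n) + 1) \<le> B" using totient_ge[of n] by simp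
    hence "\<not> N \<le> n" using N[of n] by linarith
    thus "n \<in> {..<N}" by simp
  qed
  thus ?thesis by (rule finite_subset) simp
qed

section \<open>Density and expanding maps\<close>

text \<open>Suppose \<open>V\<close> had positive measure, and take an open \<open>T\<close> around
  it of slightly larger measure. By Vitali, disjoint balls inside \<open>T\<close> cover almost all
  of \<open>V\<close>, and each is filled by \<open>V\<close> to a share of at most
  \<open>\<theta>\<close>, so \<open>\<mu> V \<le> \<theta> * \<mu> T < \<mu> V\<close>. The balls
  must contain \<open>x\<close> but may be centred elsewhere, for instance at rational
  points.\<close>

lemma negligible_by_density:
  fixes V :: "real set" and a r :: "'i \<Rightarrow> real"
  assumes V: "V \<in> lmeasurable" and \<theta>: "0 \<le> \<theta>" "\<theta> < 1"
    and r: "\<And>i. i \<in> K \<Longrightarrow> 0 < r i"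
    and cover: "\<And>x d. x \<in> V \<Longrightarrow> 0 < d \<Longrightarrow> \<exists>i\<in>K. x \<in> cball (a i) (r i) \<and> r i < d"
    and density: "\<And>i. i \<in> K \<Longrightarrow> measure lebesgue (V \<inter> cball (a i) (r i)) \<le> \<theta> * (2 * r i)"
  shows "negligible V"
proof (rule ccontr)
  let ?\<mu> = "measure lebesgue"
  assume "\<not> negligible V"
  hence pos: "0 < ?\<mu> V" using V by (simp add: negligible_iff_measure0 less_le)
  define e where "e = (1 - \<theta>) * ?\<mu> V / 2"
  have e: "0 < e" using pos \<theta> by (simp add: e_def)
  obtain T where T: "open T" "V \<subseteq> T" "T - V \<in> lmeasurable" "emeasure lebesgue (T - V) < ennreal e"
    using sets_lebesgue_outer_open[OF fmeasurableD[OF V] e] .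
  have Tm: "T \<in> lmeasurable"
    using fmeasurable.Un[OF V T(3)] T(2) by (simp add: Un_absorb1 Un_Diff_cancel)
  have "?\<mu> (T - V) < e" using T(3,4) e by (simp add: emeasure_eq_measure2 ennreal_less_iff)
  hence \<mu>T: "?\<mu> T < ?\<mu> V + e"
    using measurable_measure_Diff[OF Tm fmeasurableD[OF V] T(2)] by simp
  define K' where "K' = {i \<in> K. cball (a i) (r i) \<subseteq> T}"
  have cover': "\<exists>i. i \<in> K' \<and> x \<in> cball (a i) (r i) \<and> r i < d" if xd: "x \<in> V" "0 < d" for x d
  proof -
    have "x \<in> T" using xd(1) T(2) by blast
    then obtain s where s: "0 < s" "cball x s \<subseteq> T" using T(1) open_contains_cball by blast
    obtain i where i: "i \<in> K" "x \<in> cball (a i) (r i)" "r i < min d (s / 2)"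
      using cover[OF xd(1), of "min d (s / 2)"] xd(2) s(1) by auto
    have "cball (a i) (r i) \<subseteq> cball x s"
    proof
      fix y assume "y \<in> cball (a i) (r i)"
      hence "\<bar>a i - y\<bar> \<le> r i" "\<bar>a i - x\<bar> \<le> r i" "2 * r i \<le> s"
        using i(2,3) by (simp_all add: dist_real_def)
      thus "y \<in> cball x s" unfolding mem_cball dist_real_def by linarith
    qed
    thus ?thesis using i s(2) by (auto simp: K'_def)
  qed
  have r': "\<And>i. i \<in> K' \<Longrightarrow> 0 < r i" using r by (simp add: K'_def)
  obtain C where C: "countable C" "C \<subseteq> K'"
    "pairwise (\<lambda>i j. disjnt (cball (a i) (r i)) (cball (a j) (r j))) C"
    "negligible (V - (\<Union>i\<in>C. cball (a i) (r i)))"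
    by (rule Vitali_covering_theorem_cballs[OF r' cover'])
  have Vi: "V \<inter> cball (a i) (r i) \<in> lmeasurable" for i
    using V by (rule fmeasurable.Int) simp
  have bound: "?\<mu> (\<Union>i\<in>I. V \<inter> cball (a i) (r i)) \<le> \<theta> * ?\<mu> T" if I: "I \<subseteq> C" "finite I" for I
  proof -
    have "?\<mu> (\<Union>i\<in>I. V \<inter> cball (a i) (r i)) \<le> (\<Sum>i\<in>I. ?\<mu> (V \<inter> cball (a i) (r i)))"
      using I(2) Vi by (intro measure_UNION_le) auto
    also have "\<dots> \<le> (\<Sum>i\<in>I. \<theta> * ?\<mu> (cball (a i) (r i)))"
    proof (rule sum_mono)
      fix i assume "i \<in> I"
      hence i: "i \<in> K" using I(1) C(2) by (auto simp: K'_def)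
      have "?\<mu> (cball (a i) (r i)) = 2 * r i" using r[OF i] by (simp add: cball_eq_atLeastAtMost)
      thus "?\<mu> (V \<inter> cball (a i) (r i)) \<le> \<theta> * ?\<mu> (cball (a i) (r i))" using density[OF i] by simp
    qed
    also have "\<dots> = \<theta> * ?\<mu> (\<Union>i\<in>I. cball (a i) (r i))"
      using I pairwise_mono[OF C(3) _ I(1)]
      by (subst measure_UNION') (auto simp: sum_distrib_left)
    also have "\<dots> \<le> \<theta> * ?\<mu> T"
      using I C(2) \<theta>(1) Tm
      by (intro mult_left_mono measure_mono_fmeasurable) (auto simp: K'_def intro!: sets.finite_UN)
    finally show ?thesis .
  qed
  let ?A = "V - (\<Union>i\<in>C. cball (a i) (r i))" and ?B = "\<Union>i\<in>C. V \<inter> cball (a i) (r i)"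
  have AB: "?A \<in> lmeasurable" "?B \<in> lmeasurable"
    using fmeasurable_UN_bound[OF C(1) Vi bound] C(4) by (auto intro: negligible_imp_measurable)
  have "?\<mu> V \<le> ?\<mu> (?A \<union> ?B)"
    using V AB by (intro measure_mono_fmeasurable fmeasurable.Un fmeasurableD) auto
  also have "\<dots> \<le> ?\<mu> ?A + ?\<mu> ?B"
    using AB by (intro measure_Un_le fmeasurableD)
  also have "\<dots> \<le> 0 + \<theta> * ?\<mu> T"
    using measure_UN_bound[OF C(1) Vi bound] negligible_imp_measure0[OF C(4)] by simp
  also have "\<dots> \<le> \<theta> * (?\<mu> V + e)" using \<mu>T \<theta> by (simp add: mult_left_mono)
  also have "\<dots> < ?\<mu> V"
  proof -
    have "\<theta> * e \<le> 1 * e" using \<theta> e by (intro mult_right_mono) auto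
    moreover have "e < (1 - \<theta>) * ?\<mu> V" using pos \<theta> by (simp add: e_def)
    ultimately show ?thesis by (simp add: algebra_simps)
  qed
  finally show False by simp
qed

section \<open>Sets of period 1 on the line\<close>

lemma periodic_int:
  fixes U :: "real set"
  assumes "\<And>x. x + 1 \<in> U \<longleftrightarrow> x \<in> U"
  shows "x + of_int k \<in> U \<longleftrightarrow> x \<in> U"
proof -
  have n: "x + of_nat n \<in> U \<longleftrightarrow> x \<in> U" for n x
  proof (induction n)
    case (Suc n)
    thus ?case using assms[of "x + of_nat n"] by (simp add: algebra_simps)
  qed simp
  show ?thesis
  proof (cases "0 \<le> k")
    case True
    thus ?thesis using n[of x "nat k"] by simp
  next
    case False
    thus ?thesis using n[of "x + of_int k" "nat (- k)"] by simp
  qed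
qed

lemma periodic_negligible:
  fixes U :: "real set"
  assumes per: "\<And>x. x + 1 \<in> U \<longleftrightarrow> x \<in> U" and neg: "negligible (U \<inter> {0..1})"
  shows "negligible U"
proof -
  have "U \<subseteq> (\<Union>k::int. (+) (of_int k) ` (U \<inter> {0..1}))"
  proof
    fix x assume x: "x \<in> U"
    have "frac x \<in> U" using periodic_int[OF per, of x "- \<lfloor>x\<rfloor>"] x by (simp add: frac_def)
    hence "frac x \<in> U \<inter> {0..1}" using frac_lt_1[of x] by simp
    moreover have "x = of_int \<lfloor>x\<rfloor> + frac x" by (simp add: frac_def)
    ultimately show "x \<in> (\<Union>k::int. (+) (of_int k) ` (U \<inter> {0..1}))" by blast
  qed
  moreover have "negligible (\<Union>k::int. (+) (of_int k) ` (U \<inter> {0..1}))"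
    using negligible_countable_Union[of "range (\<lambda>k::int. (+) (of_int k) ` (U \<inter> {0..1}))"]
      negligible_translation[OF neg] by auto
  ultimately show ?thesis using negligible_subset by blast
qed

text \<open>Cut at an integer \<open>k\<close> in \<open>{y..y + 1}\<close> and move the right-hand
  piece back by 1: the pieces then fill \<open>{k - 1..k}\<close>, an integer translate of the unit
  interval.\<close>

lemma periodic_measure_unit_interval:
  fixes U :: "real set"
  assumes per: "\<And>x. x + 1 \<in> U \<longleftrightarrow> x \<in> U" and U: "U \<in> sets lebesgue"
  shows "measure lebesgue (U \<inter> {y..y + 1}) \<le> measure lebesgue (U \<inter> {0..1})"
proof -
  let ?\<mu> = "measure lebesgue"
  define k where "k = \<lfloor>y\<rfloor> + 1"
  have k: "y \<le> of_int k" "of_int k \<le> y + 1" unfolding k_def by linarith+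
  have m: "U \<inter> {u..v} \<in> lmeasurable" for u v
    using fmeasurable_Int_fmeasurable[of "{u..v}" lebesgue U] U by (simp add: Int_commute)
  have tr: "(+) (of_int j) ` (U \<inter> {u..v}) = U \<inter> {of_int j + u..of_int j + v}" for j :: int and u v
  proof (intro equalityI subsetI)
    fix x assume "x \<in> (+) (of_int j) ` (U \<inter> {u..v})"
    thus "x \<in> U \<inter> {of_int j + u..of_int j + v}"
      using periodic_int[OF per, of _ j] by (auto simp: add.commute)
  next
    fix x assume x: "x \<in> U \<inter> {of_int j + u..of_int j + v}"
    hence "x - of_int j \<in> U \<inter> {u..v}" using periodic_int[OF per, of "x - of_int j" j] by auto
    thus "x \<in> (+) (of_int j) ` (U \<inter> {u..v})" by (intro image_eqI[of _ _ "x - of_int j"]) auto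
  qed
  have neg: "negligible {y}" by simp
  have "?\<mu> (U \<inter> {y..y + 1}) = ?\<mu> (U \<inter> {y..of_int k} \<union> U \<inter> {of_int k..y + 1})"
    using k by (intro arg_cong[of _ _ ?\<mu>]) auto
  also have "\<dots> \<le> ?\<mu> (U \<inter> {y..of_int k}) + ?\<mu> (U \<inter> {of_int k..y + 1})"
    by (intro measure_Un_le fmeasurableD m)
  also have "U \<inter> {of_int k..y + 1} = (+) (of_int 1) ` (U \<inter> {of_int k - 1..y})"
    unfolding tr by (simp add: add.commute)
  also have "?\<mu> \<dots> = ?\<mu> (U \<inter> {of_int k - 1..y})" by (rule measure_translation)
  also have "?\<mu> (U \<inter> {y..of_int k}) + ?\<mu> (U \<inter> {of_int k - 1..y})
      = ?\<mu> (U \<inter> {of_int k - 1..y} \<union> U \<inter> {y..of_int k})"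
  proof -
    have "negligible ((U \<inter> {of_int k - 1..y}) \<inter> (U \<inter> {y..of_int k}))"
      by (rule negligible_subset[OF neg]) auto
    thus ?thesis using measure_Un3[OF m m, of "of_int k - 1" y y "of_int k"]
      by (simp add: negligible_imp_measure0)
  qed
  also have "U \<inter> {of_int k - 1..y} \<union> U \<inter> {y..of_int k} = (+) (of_int (k - 1)) ` (U \<inter> {0..1})"
    unfolding tr using k by auto
  also have "?\<mu> \<dots> = ?\<mu> (U \<inter> {0..1})" by (rule measure_translation)
  finally show ?thesis .
qed

text \<open>An iterate \<open>p ^ k * x + d\<close> maps \<open>U\<close> into itself and magnifies
  an interval of length \<open>1 / p ^ k\<close> to a full period. Hence the share of
  \<open>U\<close> in each such interval is at most \<open>\<theta>\<close>, its measure in a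
  period, and \<open>negligible_by_density\<close> rules out \<open>\<theta> < 1\<close>.\<close>

lemma periodic_expanding_zero_one:
  fixes U :: "real set" and p :: nat
  assumes per: "\<And>x. x + 1 \<in> U \<longleftrightarrow> x \<in> U" and Ub: "U \<in> sets borel"
    and p: "2 \<le> p" and inv: "\<And>x. x \<in> U \<Longrightarrow> real p * x + c \<in> U"
    and pos: "\<not> negligible U"
  shows "negligible (- U)"
proof -
  let ?\<mu> = "measure lebesgue"
  have U: "U \<in> sets lebesgue" using Ub by auto
  define \<theta> where "\<theta> = ?\<mu> (U \<inter> {0..1})"
  have m: "U \<inter> {u..v} \<in> lmeasurable" for u v
    using fmeasurable_Int_fmeasurable[of "{u..v}" lebesgue U] U by (simp add: Int_commute)
  have iter: "\<exists>d. \<forall>x\<in>U. real p ^ k * x + d \<in> U" for k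
  proof (induction k)
    case 0
    show ?case by (rule exI[of _ 0]) simp
  next
    case (Suc k)
    then obtain d where "\<forall>x\<in>U. real p ^ k * x + d \<in> U" by blast
    hence "\<forall>x\<in>U. real p ^ Suc k * x + (real p * d + c) \<in> U"
    proof (intro ballI)
      fix x assume "x \<in> U"
      hence "real p * (real p ^ k * x + d) + c \<in> U" using inv \<open>\<forall>x\<in>U. real p ^ k * x + d \<in> U\<close> by blast
      thus "real p ^ Suc k * x + (real p * d + c) \<in> U" by (simp add: algebra_simps)
    qed
    thus ?case by blast
  qed
  have dens: "?\<mu> (U \<inter> cball x (1 / (2 * real p ^ k))) \<le> \<theta> * (2 * (1 / (2 * real p ^ k)))" for x k
  proof -
    obtain d where d: "\<forall>x\<in>U. real p ^ k * x + d \<in> U" using iter by blast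
    define y where "y = real p ^ k * x - 1 / 2 + d"
    let ?B = "U \<inter> cball x (1 / (2 * real p ^ k))"
    have pk: "0 < real p ^ k" using p by simp
    have "(\<lambda>x. real p ^ k *\<^sub>R x + d) ` ?B \<subseteq> U \<inter> {y..y + 1}"
    proof clarify
      fix z assume z: "z \<in> U" "z \<in> cball x (1 / (2 * real p ^ k))"
      have "\<bar>real p ^ k * (z - x)\<bar> \<le> 1 / 2"
        using z(2) pk unfolding abs_mult by (simp add: dist_real_def abs_minus_commute field_simps)
      hence "real p ^ k * z + d \<in> {y..y + 1}" unfolding y_def atLeastAtMost_iff right_diff_distrib abs_le_iff by linarith
      thus "real p ^ k *\<^sub>R z + d \<in> U \<inter> {y..y + 1}" using d z(1) by simp
    qed
    moreover have "(\<lambda>x. real p ^ k *\<^sub>R x + d) ` ?B \<in> sets lebesgue"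
    proof -
      have "(\<lambda>z. (z - d) / real p ^ k) -` ?B \<inter> space borel \<in> sets borel"
        by (rule measurable_sets[of _ borel borel]) (use Ub in auto)
      also have "(\<lambda>z. (z - d) / real p ^ k) -` ?B \<inter> space borel = (\<lambda>x. real p ^ k *\<^sub>R x + d) ` ?B"
      proof (intro equalityI subsetI)
        fix z assume "z \<in> (\<lambda>z. (z - d) / real p ^ k) -` ?B \<inter> space borel"
        thus "z \<in> (\<lambda>x. real p ^ k *\<^sub>R x + d) ` ?B"
          using pk by (intro image_eqI[of _ _ "(z - d) / real p ^ k"]) auto
      qed (use pk in auto)
      finally show ?thesis by auto
    qed
    ultimately have "?\<mu> ((\<lambda>x. real p ^ k *\<^sub>R x + d) ` ?B) \<le> ?\<mu> (U \<inter> {y..y + 1})"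
      by (intro measure_mono_fmeasurable m)
    also have "\<dots> \<le> \<theta>" unfolding \<theta>_def by (rule periodic_measure_unit_interval[OF per U])
    also have "?\<mu> ((\<lambda>x. real p ^ k *\<^sub>R x + d) ` ?B) = real p ^ k * ?\<mu> ?B"
      using measure_lebesgue_affine[of "real p ^ k" d ?B] by simp
    finally show ?thesis using pk by (simp add: field_simps)
  qed
  have \<theta>1: "1 \<le> \<theta>"
  proof (rule ccontr)
    assume "\<not> 1 \<le> \<theta>"
    have "negligible (U \<inter> {0..1})"
    proof (rule negligible_by_density[where K = UNIV and a = fst and r = "\<lambda>(x, k). 1 / (2 * real p ^ k)" and \<theta> = \<theta>])
      fix x d :: real assume "0 < d"
      then obtain k where "(1 / real p) ^ k < d"
        using real_arch_pow_inv[of d "1 / real p"] p by auto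
      moreover have "1 / (2 * real p ^ k) \<le> (1 / real p) ^ k"
        using p by (simp add: power_one_over frac_le)
      ultimately have "1 / (2 * real p ^ k) < d" by linarith
      thus "\<exists>i\<in>UNIV. x \<in> cball (fst i) (case i of (x, k) \<Rightarrow> 1 / (2 * real p ^ k)) \<and> (case i of (x, k) \<Rightarrow> 1 / (2 * real p ^ k)) < d"
        by (intro bexI[of _ "(x, k)"]) auto
    next
      fix i :: "real \<times> nat"
      obtain x k where i: "i = (x, k)" by fastforce
      have "?\<mu> (U \<inter> {0..1} \<inter> cball x (1 / (2 * real p ^ k))) \<le> ?\<mu> (U \<inter> cball x (1 / (2 * real p ^ k)))"
        using m U by (intro measure_mono_fmeasurable) (auto simp: cball_eq_atLeastAtMost intro!: sets.Int)
      thus "?\<mu> (U \<inter> {0..1} \<inter> cball (fst i) (case i of (x, k) \<Rightarrow> 1 / (2 * real p ^ k)))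
          \<le> \<theta> * (2 * (case i of (x, k) \<Rightarrow> 1 / (2 * real p ^ k)))"
        using dens[of x k] i by simp
    qed (use m p \<open>\<not> 1 \<le> \<theta>\<close> in \<open>auto simp: \<theta>_def\<close>)
    thus False using pos periodic_negligible[OF per] by blast
  qed
  show ?thesis
  proof (rule periodic_negligible)
    have eq: "- U \<inter> {0..1} = {0..1} - U \<inter> {0..1}" by blast
    have "?\<mu> (- U \<inter> {0..1}) = ?\<mu> {0..1::real} - \<theta>"
      unfolding \<theta>_def eq using m by (intro measurable_measure_Diff) (auto simp: fmeasurableD)
    hence "?\<mu> (- U \<inter> {0..1}) = 0"
      using \<theta>1 measure_nonneg[of lebesgue "- U \<inter> {0..1}"] by simp
    moreover have "- U \<inter> {0..1} \<in> lmeasurable"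
      unfolding eq using m by (intro fmeasurable.Diff) auto
    ultimately show "negligible (- U \<inter> {0..1})" by (simp add: negligible_iff_measure)
  qed (use per in simp)
qed

section \<open>Cassels' lemma and the zero-one law\<close>

text \<open>All integer numerators are allowed, which makes this a periodic set on the line, where
  affine maps and coverings by balls are available; \<open>circle_approx_eq\<close> restricts it to
  the circle.\<close>

definition reduced_nbhd :: "nat \<Rightarrow> real \<Rightarrow> real set" where
  "reduced_nbhd n \<rho> = {x. \<exists>a. coprime a (int n) \<and> \<bar>x - of_int a / real n\<bar> \<le> \<rho>}"

definition limsup_nbhd :: "nat set \<Rightarrow> (nat \<Rightarrow> real) \<Rightarrow> real set" where
  "limsup_nbhd K \<rho> = {x. infinite {n \<in> K. x \<in> reduced_nbhd n (\<rho> n)}}"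

lemma reduced_nbhd_eq: "reduced_nbhd n \<rho> = (\<Union>a\<in>{a. coprime a (int n)}. cball (of_int a / real n) \<rho>)"
  by (auto simp: reduced_nbhd_def dist_real_def abs_minus_commute)

lemma reduced_nbhd_borel [measurable]: "reduced_nbhd n \<rho> \<in> sets borel"
  unfolding reduced_nbhd_eq by (intro sets.countable_UN'') auto

lemma limsup_nbhd_eq: "limsup_nbhd K \<rho> = (\<Inter>l. \<Union>n\<in>{n \<in> K. l \<le> n}. reduced_nbhd n (\<rho> n))"
  by (auto simp: limsup_nbhd_def infinite_nat_iff_unbounded_le)

lemma limsup_nbhd_borel [measurable]: "limsup_nbhd K \<rho> \<in> sets borel"
  unfolding limsup_nbhd_eq by (intro sets.countable_INT'' sets.countable_UN'') auto

lemma reduced_nbhd_mono: "\<rho> \<le> \<sigma> \<Longrightarrow> reduced_nbhd n \<rho> \<subseteq> reduced_nbhd n \<sigma>"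
  by (force simp: reduced_nbhd_def)

lemma limsup_nbhd_mono:
  assumes "K \<subseteq> K'" "\<And>n. n \<in> K \<Longrightarrow> \<rho> n \<le> \<sigma> n"
  shows "limsup_nbhd K \<rho> \<subseteq> limsup_nbhd K' \<sigma>"
proof
  fix x assume "x \<in> limsup_nbhd K \<rho>"
  moreover have "{n \<in> K. x \<in> reduced_nbhd n (\<rho> n)} \<subseteq> {n \<in> K'. x \<in> reduced_nbhd n (\<sigma> n)}"
    using assms reduced_nbhd_mono by blast
  ultimately show "x \<in> limsup_nbhd K' \<sigma>"
    unfolding limsup_nbhd_def using finite_subset by blast
qed

lemma coprime_add_mult_iff: "coprime (a + k * n) n \<longleftrightarrow> coprime a n" for a k n :: int
  using gcd_add_mult[of n k a] by (simp add: coprime_iff_gcd_eq_1 gcd.commute[of _ n] add.commute)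

lemma reduced_nbhd_periodic:
  assumes "0 < n"
  shows "x + 1 \<in> reduced_nbhd n \<rho> \<longleftrightarrow> x \<in> reduced_nbhd n \<rho>"
proof
  assume "x + 1 \<in> reduced_nbhd n \<rho>"
  then obtain a where a: "coprime a (int n)" "\<bar>x + 1 - of_int a / real n\<bar> \<le> \<rho>"
    by (auto simp: reduced_nbhd_def)
  have "coprime (a - int n) (int n)"
    using a(1) coprime_add_mult_iff[of a "- 1" "int n"] by simp
  moreover have "x - of_int (a - int n) / real n = x + 1 - of_int a / real n"
    using assms by (simp add: field_simps)
  ultimately show "x \<in> reduced_nbhd n \<rho>" using a(2) by (auto simp: reduced_nbhd_def intro!: exI[of _ "a - int n"])
next
  assume "x \<in> reduced_nbhd n \<rho>"
  then obtain a where a: "coprime a (int n)" "\<bar>x - of_int a / real n\<bar> \<le> \<rho>"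
    by (auto simp: reduced_nbhd_def)
  have "coprime (a + int n) (int n)"
    using a(1) coprime_add_mult_iff[of a 1 "int n"] by simp
  moreover have "x + 1 - of_int (a + int n) / real n = x - of_int a / real n"
    using assms by (simp add: field_simps)
  ultimately show "x + 1 \<in> reduced_nbhd n \<rho>" using a(2) by (auto simp: reduced_nbhd_def intro!: exI[of _ "a + int n"])
qed

lemma limsup_nbhd_periodic:
  assumes "0 \<notin> K"
  shows "x + 1 \<in> limsup_nbhd K \<rho> \<longleftrightarrow> x \<in> limsup_nbhd K \<rho>"
proof -
  have "{n \<in> K. x + 1 \<in> reduced_nbhd n (\<rho> n)} = {n \<in> K. x \<in> reduced_nbhd n (\<rho> n)}"
    using assms reduced_nbhd_periodic[of _ x] by (metis (mono_tags, lifting) neq0_conv)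
  thus ?thesis by (simp add: limsup_nbhd_def)
qed

text \<open>Cassels' lemma: a point of density of the difference lies in arbitrarily small
  balls of radius \<open>\<kappa> * \<rho> n\<close> that miss the concentric ball of radius \<open>\<rho> n\<close>.\<close>
lemma limsup_nbhd_scale:
  assumes pos: "\<And>n. n \<in> K \<Longrightarrow> 0 < \<rho> n" and null: "\<And>e. 0 < e \<Longrightarrow> finite {n \<in> K. e \<le> \<rho> n}"
    and \<kappa>: "1 \<le> \<kappa>"
  shows "negligible (limsup_nbhd K (\<lambda>n. \<kappa> * \<rho> n) - limsup_nbhd K \<rho>)"
proof -
  \<comment> \<open>Countably many pieces exhaust the difference: from index \<open>l\<close> on all
    smaller neighbourhoods are avoided, and \<open>N\<close> bounds the piece so that its measure is
    finite.\<close>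
  define V where "V l N = limsup_nbhd K (\<lambda>n. \<kappa> * \<rho> n) \<inter> (\<Inter>n\<in>{n \<in> K. l \<le> n}. - reduced_nbhd n (\<rho> n))
    \<inter> cball 0 (real N)" for l N :: nat
  have neg: "negligible (V l N)" for l N
  proof (rule negligible_by_density[where K = "{(n, a). n \<in> K \<and> l \<le> n \<and> coprime a (int n)}"
        and a = "\<lambda>(n, a). of_int a / real n" and r = "\<lambda>(n, a). \<kappa> * \<rho> n" and \<theta> = "1 - 1 / \<kappa>"])
    have "V l N \<in> sets borel"
      unfolding V_def by (intro sets.Int sets.countable_INT'' limsup_nbhd_borel) auto
    thus "V l N \<in> lmeasurable"
      by (intro bounded_set_imp_lmeasurable) (auto simp: V_def intro: bounded_subset[OF bounded_cball])
    show "0 \<le> 1 - 1 / \<kappa>" "1 - 1 / \<kappa> < 1" using \<kappa> by auto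
  next
    fix i assume "i \<in> {(n, a). n \<in> K \<and> l \<le> n \<and> coprime a (int n)}"
    thus "0 < (case i of (n, a) \<Rightarrow> \<kappa> * \<rho> n)" using pos \<kappa> by auto
  next
    fix x d :: real assume x: "x \<in> V l N" and d: "0 < d"
    have "infinite {n \<in> K. x \<in> reduced_nbhd n (\<kappa> * \<rho> n)}" using x by (simp add: V_def limsup_nbhd_def)
    moreover have "finite ({..<l} \<union> {n \<in> K. d / \<kappa> \<le> \<rho> n})" using null[of "d / \<kappa>"] d \<kappa> by simp
    ultimately have "{n \<in> K. x \<in> reduced_nbhd n (\<kappa> * \<rho> n)} - ({..<l} \<union> {n \<in> K. d / \<kappa> \<le> \<rho> n}) \<noteq> {}"
      by (metis Diff_eq_empty_iff finite_subset)
    then obtain n where n: "n \<in> K" "x \<in> reduced_nbhd n (\<kappa> * \<rho> n)" "l \<le> n" "\<rho> n < d / \<kappa>" by force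
    then obtain a where "coprime a (int n)" "x \<in> cball (of_int a / real n) (\<kappa> * \<rho> n)"
      by (auto simp: reduced_nbhd_eq)
    moreover have "\<kappa> * \<rho> n < d" using n(4) \<kappa> by (simp add: field_simps)
    ultimately show "\<exists>i\<in>{(n, a). n \<in> K \<and> l \<le> n \<and> coprime a (int n)}.
        x \<in> cball (case i of (n, a) \<Rightarrow> of_int a / real n) (case i of (n, a) \<Rightarrow> \<kappa> * \<rho> n) \<and>
        (case i of (n, a) \<Rightarrow> \<kappa> * \<rho> n) < d"
      using n by (intro bexI[of _ "(n, a)"]) auto
  next
    fix i assume i: "i \<in> {(n, a). n \<in> K \<and> l \<le> n \<and> coprime a (int n)}"
    then obtain n a where na: "i = (n, a)" "n \<in> K" "l \<le> n" "coprime a (int n)" by auto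
    let ?c = "of_int a / real n :: real"
    have \<rho>: "0 < \<rho> n" "\<rho> n \<le> \<kappa> * \<rho> n" using pos[OF na(2)] \<kappa> by auto
    have "V l N \<inter> cball ?c (\<kappa> * \<rho> n) \<subseteq> cball ?c (\<kappa> * \<rho> n) - cball ?c (\<rho> n)"
      using na by (auto simp: V_def reduced_nbhd_eq)
    hence "measure lebesgue (V l N \<inter> cball ?c (\<kappa> * \<rho> n))
        \<le> measure lebesgue (cball ?c (\<kappa> * \<rho> n) - cball ?c (\<rho> n))"
    proof (rule measure_mono_fmeasurable)
      have "V l N \<in> sets borel"
        unfolding V_def by (intro sets.Int sets.countable_INT'' limsup_nbhd_borel) auto
      thus "V l N \<inter> cball ?c (\<kappa> * \<rho> n) \<in> sets lebesgue" by auto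
    qed (intro fmeasurable.Diff; simp)
    also have "\<dots> = measure lebesgue (cball ?c (\<kappa> * \<rho> n)) - measure lebesgue (cball ?c (\<rho> n))"
      using \<rho> by (intro measurable_measure_Diff subset_cball) auto
    also have "\<dots> = 2 * (\<kappa> * \<rho> n) - 2 * \<rho> n"
      using \<rho> by (simp add: cball_eq_atLeastAtMost)
    also have "\<dots> = (1 - 1 / \<kappa>) * (2 * (\<kappa> * \<rho> n))" using \<kappa> by (simp add: field_simps)
    finally show "measure lebesgue (V l N \<inter> cball (case i of (n, a) \<Rightarrow> of_int a / real n) (case i of (n, a) \<Rightarrow> \<kappa> * \<rho> n))
       \<le> (1 - 1 / \<kappa>) * (2 * (case i of (n, a) \<Rightarrow> \<kappa> * \<rho> n))" using na(1) by simp
  qed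
  have "limsup_nbhd K (\<lambda>n. \<kappa> * \<rho> n) - limsup_nbhd K \<rho> \<subseteq> (\<Union>i. V (fst i) (snd i))"
  proof
    fix x assume x: "x \<in> limsup_nbhd K (\<lambda>n. \<kappa> * \<rho> n) - limsup_nbhd K \<rho>"
    hence "finite {n \<in> K. x \<in> reduced_nbhd n (\<rho> n)}" by (simp add: limsup_nbhd_def)
    then obtain l where l: "\<forall>n\<in>{n \<in> K. x \<in> reduced_nbhd n (\<rho> n)}. n < l"
      using finite_nat_set_iff_bounded by blast
    obtain N :: nat where "\<bar>x\<bar> \<le> real N" using real_arch_simple by blast
    hence "x \<in> V l N" using x l by (force simp: V_def)
    thus "x \<in> (\<Union>i. V (fst i) (snd i))" by (intro UN_I[of "(l, N)"]) auto
  qed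
  moreover have "negligible (\<Union>i::nat \<times> nat. V (fst i) (snd i))"
    using negligible_countable_Union[of "range (\<lambda>i. V (fst i) (snd i))"] neg by auto
  ultimately show ?thesis using negligible_subset by blast
qed

text \<open>
  If \<open>p ^ i\<close> is the exact power of \<open>p\<close> dividing \<open>n\<close>, then \<open>x \<mapsto> p * x + 1 / p ^ i\<close> maps reduced
  fractions with denominator \<open>n\<close> to such fractions. By Cassels' lemma the union over \<open>\<nu>\<close> of the
  limsup sets for \<open>p ^ \<nu> * \<rho>\<close>, which this map preserves, is essentially the limsup set for \<open>\<rho>\<close>.
\<close>
lemma limsup_nbhd_zero_one:
  assumes p: "prime p" and K: "\<And>n. n \<in> K \<Longrightarrow> 0 < n \<and> multiplicity p n = i"
    and pos: "\<And>n. n \<in> K \<Longrightarrow> 0 < \<rho> n" and null: "\<And>e. 0 < e \<Longrightarrow> finite {n \<in> K. e \<le> \<rho> n}"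
    and nontrivial: "\<not> negligible (limsup_nbhd K \<rho>)"
  shows "negligible (- limsup_nbhd K \<rho>)"
proof -
  have p2: "2 \<le> p" using p by (rule prime_ge_2_nat)
  define U where "U = (\<Union>\<nu>. limsup_nbhd K (\<lambda>n. real p ^ \<nu> * \<rho> n))"
  have step: "real p * x + 1 / real p ^ i \<in> reduced_nbhd n (real p * \<sigma>)"
    if n: "n \<in> K" and x: "x \<in> reduced_nbhd n \<sigma>" for n x \<sigma>
  proof -
    obtain a where a: "coprime a (int n)" "\<bar>x - of_int a / real n\<bar> \<le> \<sigma>"
      using x by (auto simp: reduced_nbhd_def)
    have n0: "0 < n" and mult: "multiplicity p n = i" using K[OF n] by auto
    obtain m where m: "n = p ^ i * m" "\<not> p dvd m"
      using multiplicity_decompose'[of n p] n0 p mult by (metis multiplicity_decompose' neq0_conv not_prime_unit)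
    have m0: "0 < m" using m n0 by (auto intro: Nat.gr0I)
    \<comment> \<open>The image of \<open>a / n\<close> is \<open>b / n\<close>. A prime
      \<open>q\<close> dividing \<open>n\<close> divides exactly one of \<open>p * a\<close> and
      \<open>m\<close>: if it divides \<open>m\<close>, it differs from \<open>p\<close> and does
      not divide \<open>a\<close>; otherwise \<open>q = p\<close>.\<close>
    define b where "b = int p * a + int m"
    have "coprime b (int n)"
    proof (rule ccontr)
      assume "\<not> coprime b (int n)"
      hence "\<not> is_unit (gcd b (int n))" by (simp add: coprime_iff_gcd_eq_1)
      moreover have "gcd b (int n) \<noteq> 0" using n0 by simp
      ultimately obtain q where "prime q" "q dvd gcd b (int n)" using prime_divisor_exists by blast
      hence q: "prime q" "q dvd b" "q dvd int n" by auto
      show False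
      proof (cases "q dvd int m")
        case True
        hence "q dvd int p * a" using q(2) by (simp add: b_def dvd_add_left_iff)
        moreover have "\<not> q dvd a" using a(1) q by (metis coprime_common_divisor not_prime_unit)
        ultimately have "q dvd int p" using q(1) by (simp add: prime_dvd_mult_iff)
        hence "q = int p" using q(1) p by (simp add: primes_dvd_imp_eq)
        thus False using True m(2) by simp
      next
        case False
        hence "q dvd int p ^ i" using q m(1) by (simp add: prime_dvd_mult_iff)
        hence "q dvd int p" using q(1) prime_dvd_power by blast
        hence "q dvd int m" using q(2) by (simp add: b_def dvd_add_right_iff)
        thus False using False by simp
      qed
    qed
    moreover have "real p * x + 1 / real p ^ i - of_int b / real n = real p * (x - of_int a / real n)"
      using p2 m0 by (simp add: b_def m(1) field_simps)
    hence "\<bar>real p * x + 1 / real p ^ i - of_int b / real n\<bar> \<le> real p * \<sigma>"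
      using a(2) p2 by (simp add: abs_mult)
    ultimately show ?thesis by (auto simp: reduced_nbhd_def)
  qed
  have inv: "real p * x + 1 / real p ^ i \<in> U" if "x \<in> U" for x
  proof -
    obtain \<nu> where \<nu>: "infinite {n \<in> K. x \<in> reduced_nbhd n (real p ^ \<nu> * \<rho> n)}"
      using \<open>x \<in> U\<close> by (auto simp: U_def limsup_nbhd_def)
    have "{n \<in> K. x \<in> reduced_nbhd n (real p ^ \<nu> * \<rho> n)}
      \<subseteq> {n \<in> K. real p * x + 1 / real p ^ i \<in> reduced_nbhd n (real p ^ Suc \<nu> * \<rho> n)}"
      using step by (auto simp: mult.assoc)
    hence "real p * x + 1 / real p ^ i \<in> limsup_nbhd K (\<lambda>n. real p ^ Suc \<nu> * \<rho> n)"
      using \<nu> finite_subset unfolding limsup_nbhd_def by blast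
    thus ?thesis unfolding U_def by blast
  qed
  have sub: "limsup_nbhd K \<rho> \<subseteq> U" unfolding U_def by (rule order_trans[OF _ UN_upper[of 0]]) auto
  have "negligible (- U)"
  proof (rule periodic_expanding_zero_one[OF _ _ p2 inv])
    show "x + 1 \<in> U \<longleftrightarrow> x \<in> U" for x
      using limsup_nbhd_periodic[of K x] K unfolding U_def by blast
    show "U \<in> sets borel" unfolding U_def by auto
    show "\<not> negligible U" using nontrivial sub negligible_subset by blast
  qed
  moreover have "negligible (U - limsup_nbhd K \<rho>)"
  proof -
    have "negligible (limsup_nbhd K (\<lambda>n. real p ^ \<nu> * \<rho> n) - limsup_nbhd K \<rho>)" for \<nu>
      using p2 by (intro limsup_nbhd_scale pos null) auto
    hence "negligible (\<Union>\<nu>. limsup_nbhd K (\<lambda>n. real p ^ \<nu> * \<rho> n) - limsup_nbhd K \<rho>)"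
      using negligible_countable_Union[of "range (\<lambda>\<nu>. limsup_nbhd K (\<lambda>n. real p ^ \<nu> * \<rho> n) - limsup_nbhd K \<rho>)"]
      by auto
    thus ?thesis by (rule negligible_subset) (auto simp: U_def)
  qed
  ultimately have "negligible (- U \<union> (U - limsup_nbhd K \<rho>))" by (rule negligible_Un)
  thus ?thesis by (rule negligible_subset) blast
qed

section \<open>Positive measure from quasi-independence on average\<close>

text \<open>On \<open>{-1..2}\<close>, \<open>X\<close> is at most \<open>E / 6\<close> off the set,
  and at most \<open>t / 2 * X ^ 2 + 1 / (2 * t)\<close> on it by completing a square. The first
  part costs at most \<open>E / 2\<close> since the interval has length 3, and \<open>t\<close> is
  chosen so that the quadratic part costs at most \<open>E / 4\<close>. The remaining
  \<open>E / 4\<close> bounds the measure from below.\<close>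

lemma measure_large_values_ge:
  fixes X :: "real \<Rightarrow> real" and C E :: real
  assumes int: "integrable lborel X" "integrable lborel (\<lambda>x. (X x)\<^sup>2)"
    and supp: "\<And>x. x \<notin> {-1..2} \<Longrightarrow> X x = 0" and nonneg: "\<And>x. 0 \<le> X x"
    and E: "E = (\<integral>x. X x \<partial>lborel)" "0 < E" and C: "0 < C" "(\<integral>x. (X x)\<^sup>2 \<partial>lborel) \<le> C * E\<^sup>2"
  shows "1 / (4 * C) \<le> measure lborel {x \<in> {-1..2}. E / 6 < X x}"
proof -
  let ?Z = "{x \<in> {-1..2}. E / 6 < X x}"
  define t where "t = 1 / (2 * C * E)"
  have t: "0 < t" using E C by (simp add: t_def)
  have [measurable]: "X \<in> borel_measurable borel" using int(1) by auto
  have Zm [measurable]: "?Z \<in> sets borel" by measurable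
  have fin: "emeasure lborel {-1..2::real} < \<infinity>" by simp
  have finZ: "emeasure lborel ?Z < \<infinity>"
    by (rule le_less_trans[OF emeasure_mono fin]) auto
  let ?f = "\<lambda>x. E / 6 * indicator {-1..2} x + (t / 2 * (X x)\<^sup>2 + 1 / (2 * t) * indicator ?Z x)"
  have int_f: "integrable lborel ?f"
    using int finZ by (intro Bochner_Integration.integrable_add integrable_mult_right integrable_real_indicator) auto
  have le: "X x \<le> ?f x" for x
  proof (cases "x \<in> {-1..2}")
    case False
    thus ?thesis using supp[OF False] by (simp add: indicator_def) (use False in auto)
  next
    case True
    have sq: "X x \<le> t / 2 * (X x)\<^sup>2 + 1 / (2 * t)"
    proof -
      have "0 \<le> (t * X x - 1)\<^sup>2" by simp
      hence "2 * t * X x \<le> t * (t * (X x)\<^sup>2) + 1" by (simp add: power2_eq_square algebra_simps)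
      thus ?thesis using t by (simp add: field_simps)
    qed
    have "0 \<le> t / 2 * (X x)\<^sup>2" using t by simp
    thus ?thesis using sq True E(2) by (auto simp: indicator_def)
  qed
  have "(\<integral>x. X x \<partial>lborel) \<le> (\<integral>x. ?f x \<partial>lborel)"
    by (rule integral_mono[OF int(1) int_f le])
  hence "E \<le> (\<integral>x. ?f x \<partial>lborel)" by (simp only: E(1))
  also have "\<dots> = E / 6 * measure lborel {-1..2::real} + (t / 2 * (\<integral>x. (X x)\<^sup>2 \<partial>lborel) + 1 / (2 * t) * measure lborel ?Z)"
    using int finZ by (subst Bochner_Integration.integral_add)
      (auto intro!: Bochner_Integration.integrable_add integrable_mult_right integrable_real_indicator
        simp: Bochner_Integration.integral_add)
  also have "\<dots> \<le> E / 6 * 3 + (t / 2 * (C * E\<^sup>2) + 1 / (2 * t) * measure lborel ?Z)"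
    using C(2) t E(2) by (intro add_mono mult_left_mono) auto
  also have "\<dots> = E / 2 + (E / 4 + C * E * measure lborel ?Z)"
    using E(2) C(1) by (simp add: t_def field_simps power2_eq_square)
  finally have "E / 4 \<le> C * E * measure lborel ?Z" by linarith
  thus ?thesis using E(2) C(1) by (simp add: field_simps)
qed

text \<open>Counting with multiplicity makes the integral exactly
  \<open>2 * \<phi> n * \<rho>\<close>, even when the intervals overlap.\<close>

definition reduced_count :: "nat \<Rightarrow> real \<Rightarrow> real \<Rightarrow> real" where
  "reduced_count n \<rho> x = (\<Sum>s | s < n \<and> coprime s n. indicator (cball (real s / real n) \<rho>) x)"

lemma reduced_count_nonneg: "0 \<le> reduced_count n \<rho> x"
  unfolding reduced_count_def by (intro sum_nonneg) auto

lemma finite_cball_real: "emeasure lborel (cball (c::real) \<rho>) < \<infinity>"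
  using emeasure_bounded_finite[OF bounded_cball] by (simp add: less_top)

lemma reduced_count_integrable: "integrable lborel (reduced_count n \<rho>)"
  unfolding reduced_count_def
  using finite_cball_real by (intro Bochner_Integration.integrable_sum integrable_real_indicator) auto

lemma reduced_count_integral:
  assumes "0 \<le> \<rho>"
  shows "(\<integral>x. reduced_count n \<rho> x \<partial>lborel) = 2 * real (totient n) * \<rho>"
proof -
  have "(\<integral>x. reduced_count n \<rho> x \<partial>lborel) = (\<Sum>s | s < n \<and> coprime s n. measure lborel (cball (real s / real n) \<rho>))"
    unfolding reduced_count_def
    using finite_cball_real by (subst Bochner_Integration.integral_sum) (auto intro!: integrable_real_indicator)
  also have "\<dots> = (\<Sum>s | s < n \<and> coprime s n. 2 * \<rho>)"
    using assms by (intro sum.cong) (auto simp: cball_eq_atLeastAtMost)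
  finally show ?thesis by (simp add: card_coprime_lessThan)
qed

lemma reduced_count_mult:
  "reduced_count m \<rho> x * reduced_count n \<sigma> x = (\<Sum>s | s < m \<and> coprime s m. \<Sum>t | t < n \<and> coprime t n.
     indicator (cball (real s / real m) \<rho> \<inter> cball (real t / real n) \<sigma>) x)"
  by (simp add: reduced_count_def sum_product indicator_inter_arith)

lemma finite_cball_Int: "emeasure lborel (cball (c::real) \<rho> \<inter> A) < \<infinity>"
  by (rule le_less_trans[OF emeasure_mono finite_cball_real]) auto

lemma reduced_count_mult_integrable:
  "integrable lborel (\<lambda>x. reduced_count m \<rho> x * reduced_count n \<sigma> x)"
  unfolding reduced_count_mult using finite_cball_Int
  by (intro Bochner_Integration.integrable_sum integrable_real_indicator) auto

text \<open>Two intervals meet only if their centres differ by at most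
  \<open>\<rho> + \<sigma>\<close>, and their intersection is no longer than the shorter
  one.\<close>

lemma reduced_count_mult_integral_le:
  assumes "0 \<le> \<rho>" "0 \<le> \<sigma>"
  shows "(\<integral>x. reduced_count m \<rho> x * reduced_count n \<sigma> x \<partial>lborel)
    \<le> 2 * (min \<rho> \<sigma> * real (card (close_pairs m n (\<rho> + \<sigma>))))"
proof -
  let ?S = "\<lambda>n. {s. s < n \<and> coprime s n}"
  let ?I = "\<lambda>s t. cball (real s / real m) \<rho> \<inter> cball (real t / real n) \<sigma>"
  have "(\<integral>x. reduced_count m \<rho> x * reduced_count n \<sigma> x \<partial>lborel)
      = (\<Sum>s\<in>?S m. \<Sum>t\<in>?S n. measure lborel (?I s t))"
    unfolding reduced_count_mult
    using finite_cball_Int by (simp add: Bochner_Integration.integral_sum)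
  also have "\<dots> \<le> (\<Sum>s\<in>?S m. \<Sum>t\<in>?S n. if (s, t) \<in> close_pairs m n (\<rho> + \<sigma>) then 2 * min \<rho> \<sigma> else 0)"
  proof (intro sum_mono)
    fix s t assume st: "s \<in> ?S m" "t \<in> ?S n"
    show "measure lborel (?I s t) \<le> (if (s, t) \<in> close_pairs m n (\<rho> + \<sigma>) then 2 * min \<rho> \<sigma> else 0)"
    proof (cases "(s, t) \<in> close_pairs m n (\<rho> + \<sigma>)")
      case True
      have "measure lborel (?I s t) \<le> measure lborel (cball (real s / real m) \<rho>)"
        "measure lborel (?I s t) \<le> measure lborel (cball (real t / real n) \<sigma>)"
        using finite_cball_real by (auto intro!: measure_mono_fmeasurable fmeasurableI)
      thus ?thesis using True assms by (simp add: cball_eq_atLeastAtMost)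
    next
      case False
      have "?I s t = {}"
      proof (rule ccontr)
        assume "?I s t \<noteq> {}"
        then obtain x where "\<bar>real s / real m - x\<bar> \<le> \<rho>" "\<bar>real t / real n - x\<bar> \<le> \<sigma>"
          by (auto simp: dist_real_def)
        hence "\<bar>real s / real m - real t / real n\<bar> \<le> \<rho> + \<sigma>" by linarith
        thus False using False st by (simp add: close_pairs_def)
      qed
      thus ?thesis using False by simp
    qed
  qed
  also have "\<dots> = (\<Sum>z\<in>?S m \<times> ?S n. if z \<in> close_pairs m n (\<rho> + \<sigma>) then 2 * min \<rho> \<sigma> else 0)"
    by (simp add: sum.cartesian_product case_prod_unfold)
  also have "\<dots> = (\<Sum>z\<in>(?S m \<times> ?S n) \<inter> close_pairs m n (\<rho> + \<sigma>). 2 * min \<rho> \<sigma>)"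
    by (rule sum.inter_restrict[symmetric]) simp
  also have "(?S m \<times> ?S n) \<inter> close_pairs m n (\<rho> + \<sigma>) = close_pairs m n (\<rho> + \<sigma>)"
    by (auto simp: close_pairs_def)
  finally show ?thesis by (simp add: mult_ac)
qed

text \<open>Finite sets of weight at least \<open>k + 1\<close> give sets of measure at least
  \<open>1 / (2 * C)\<close> on which the count exceeds \<open>(k + 1) / 3\<close>. The points lying
  in infinitely many of these again have positive measure, and their unbounded counts cannot come
  from finitely many denominators.\<close>

lemma limsup_nbhd_not_negligible:
  fixes \<rho> :: "nat \<Rightarrow> real" and C :: real
  assumes K: "\<And>n. n \<in> K \<Longrightarrow> 0 < n \<and> 0 \<le> \<rho> n \<and> \<rho> n \<le> 1" and C: "0 < C"
    and overlap: "\<And>B. \<exists>F. finite F \<and> F \<subseteq> K \<and> B \<le> (\<Sum>n\<in>F. real (totient n) * \<rho> n) \<and>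
      (\<Sum>m\<in>F. \<Sum>n\<in>F. min (\<rho> m) (\<rho> n) * real (card (close_pairs m n (\<rho> m + \<rho> n))))
        \<le> C * (\<Sum>n\<in>F. real (totient n) * \<rho> n)\<^sup>2"
  shows "\<not> negligible (limsup_nbhd K \<rho>)"
proof -
  let ?w = "\<lambda>F. \<Sum>n\<in>F. real (totient n) * \<rho> n"
  have "\<exists>F. \<forall>k::nat. finite (F k) \<and> F k \<subseteq> K \<and> real k + 1 \<le> ?w (F k) \<and>
      (\<Sum>m\<in>F k. \<Sum>n\<in>F k. min (\<rho> m) (\<rho> n) * real (card (close_pairs m n (\<rho> m + \<rho> n))))
        \<le> C * (?w (F k))\<^sup>2"
    using overlap by (intro choice allI) blast
  then obtain F where F: "\<And>k::nat. finite (F k)" "\<And>k. F k \<subseteq> K" "\<And>k. real k + 1 \<le> ?w (F k)"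
    "\<And>k. (\<Sum>m\<in>F k. \<Sum>n\<in>F k. min (\<rho> m) (\<rho> n) * real (card (close_pairs m n (\<rho> m + \<rho> n))))
        \<le> C * (?w (F k))\<^sup>2" by blast
  define X where "X k x = (\<Sum>n\<in>F k. reduced_count n (\<rho> n) x)" for k x
  define E where "E k = (\<integral>x. X k x \<partial>lborel)" for k
  define Z where "Z k = {x \<in> {-1..2}. E k / 6 < X k x}" for k
  have \<rho>0: "0 \<le> \<rho> n" if "n \<in> F k" for n k using K F(2) that by blast
  have Xint: "integrable lborel (X k)" for k
    unfolding X_def by (intro Bochner_Integration.integrable_sum reduced_count_integrable)
  have [measurable]: "X k \<in> borel_measurable borel" for k using Xint by auto
  have Zm: "Z k \<in> sets borel" for k unfolding Z_def by measurable
  have E: "E k = 2 * ?w (F k)" for k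
    unfolding E_def X_def using reduced_count_integral \<rho>0
    by (simp add: Bochner_Integration.integral_sum reduced_count_integrable sum_distrib_left mult.assoc)
  have X2: "(X k x)\<^sup>2 = (\<Sum>m\<in>F k. \<Sum>n\<in>F k. reduced_count m (\<rho> m) x * reduced_count n (\<rho> n) x)" for k x
    by (simp add: X_def power2_eq_square sum_product)
  have X2int: "integrable lborel (\<lambda>x. (X k x)\<^sup>2)" for k
    unfolding X2 by (intro Bochner_Integration.integrable_sum reduced_count_mult_integrable)
  have measure_Z: "1 / (2 * C) \<le> measure lborel (Z k)" for k
  proof -
    \<comment> \<open>As \<open>E k\<close> is twice the weight of \<open>F k\<close>, the overlap
      constant \<open>C\<close> turns into \<open>C / 2\<close>.\<close>
    have "1 / (4 * (C / 2)) \<le> measure lborel {x \<in> {-1..2}. E k / 6 < X k x}"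
    proof (rule measure_large_values_ge[OF Xint X2int])
      fix x :: real assume x: "x \<notin> {-1..2}"
      show "X k x = 0"
        unfolding X_def reduced_count_def
      proof (intro sum.neutral ballI)
        fix n s assume "n \<in> F k" "s \<in> {s. s < n \<and> coprime s n}"
        hence n: "s < n" "\<rho> n \<le> 1" using K F(2) by auto
        hence "0 \<le> real s / real n" "real s / real n \<le> 1" by auto
        hence "x \<notin> cball (real s / real n) (\<rho> n)"
          using x n(2) unfolding mem_cball dist_real_def atLeastAtMost_iff by linarith
        thus "indicator (cball (real s / real n) (\<rho> n)) x = (0::real)" by simp
      qed
    next
      show "0 \<le> X k x" for x unfolding X_def by (intro sum_nonneg reduced_count_nonneg)
      show "0 < E k" using F(3)[of k] unfolding E by linarith
      have "(\<integral>x. (X k x)\<^sup>2 \<partial>lborel) = (\<Sum>m\<in>F k. \<Sum>n\<in>F k. \<integral>x. reduced_count m (\<rho> m) x * reduced_count n (\<rho> n) x \<partial>lborel)"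
        unfolding X2 by (simp add: Bochner_Integration.integral_sum reduced_count_mult_integrable)
      also have "\<dots> \<le> (\<Sum>m\<in>F k. \<Sum>n\<in>F k. 2 * (min (\<rho> m) (\<rho> n) * real (card (close_pairs m n (\<rho> m + \<rho> n)))))"
        using \<rho>0 by (intro sum_mono reduced_count_mult_integral_le)
      also have "\<dots> \<le> 2 * (C * (?w (F k))\<^sup>2)"
        using F(4)[of k] by (simp flip: sum_distrib_left)
      also have "\<dots> = C / 2 * (E k)\<^sup>2" unfolding E by (simp add: power2_eq_square)
      finally show "(\<integral>x. (X k x)\<^sup>2 \<partial>lborel) \<le> C / 2 * (E k)\<^sup>2" .
    qed (use C in \<open>auto simp: E_def\<close>)
    thus ?thesis by (simp add: Z_def)
  qed
  define A where "A l = (\<Union>k\<in>{l..}. Z k)" for l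
  have Am: "A l \<in> sets borel" for l unfolding A_def by (intro sets.countable_UN'' Zm) auto
  have Asub: "A l \<subseteq> {-1..2}" for l by (auto simp: A_def Z_def)
  have Afin: "emeasure lborel (A l) < \<infinity>" for l
    by (rule le_less_trans[OF emeasure_mono[OF Asub]]) auto
  have "ennreal (1 / (2 * C)) \<le> (INF l. emeasure lborel (A l))"
  proof (rule INF_greatest)
    fix l
    have "measure lborel (Z l) \<le> measure lborel (A l)"
      using Am Zm Afin by (intro measure_mono_fmeasurable fmeasurableI) (auto simp: A_def)
    hence "ennreal (1 / (2 * C)) \<le> ennreal (measure lborel (A l))"
      using measure_Z[of l] by (intro ennreal_leI) linarith
    also have "\<dots> = emeasure lborel (A l)" using Afin by (simp add: emeasure_eq_ennreal_measure less_top)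
    finally show "ennreal (1 / (2 * C)) \<le> emeasure lborel (A l)" .
  qed
  also have "\<dots> = emeasure lborel (\<Inter>l. A l)"
  proof (rule INF_emeasure_decseq)
    show "decseq A" unfolding decseq_def A_def by (intro allI impI UN_mono) auto
  qed (use Am Afin in \<open>auto simp: less_top\<close>)
  finally have "ennreal (1 / (2 * C)) \<le> emeasure lborel (\<Inter>l. A l)" .
  moreover have "0 < ennreal (1 / (2 * C))" using C by simp
  ultimately have pos: "0 < emeasure lborel (\<Inter>l. A l)" by order
  have sub: "(\<Inter>l. A l) \<subseteq> limsup_nbhd K \<rho>"
  proof
    fix x assume x: "x \<in> (\<Inter>l. A l)"
    show "x \<in> limsup_nbhd K \<rho>"
    proof (rule ccontr)
      define T where "T = {n \<in> K. x \<in> reduced_nbhd n (\<rho> n)}"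
      assume "x \<notin> limsup_nbhd K \<rho>"
      hence T: "finite T" by (simp add: limsup_nbhd_def T_def)
      define B where "B = (\<Sum>n\<in>T. reduced_count n (\<rho> n) x)"
      have XB: "X k x \<le> B" for k
      proof -
        have "X k x = (\<Sum>n\<in>F k \<inter> T. reduced_count n (\<rho> n) x)"
          unfolding X_def
        proof (rule sum.mono_neutral_right[OF F(1)])
          show "\<forall>n\<in>F k - F k \<inter> T. reduced_count n (\<rho> n) x = 0"
          proof
            fix n assume "n \<in> F k - F k \<inter> T"
            hence "x \<notin> reduced_nbhd n (\<rho> n)" using F(2) by (auto simp: T_def)
            moreover have "x \<in> reduced_nbhd n (\<rho> n)"
              if "coprime s n" "x \<in> cball (real s / real n) (\<rho> n)" for s
              unfolding reduced_nbhd_eq using that by (intro UN_I[of "int s"]) auto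
            ultimately have "x \<notin> cball (real s / real n) (\<rho> n)" if "coprime s n" for s
              using that by blast
            thus "reduced_count n (\<rho> n) x = 0" unfolding reduced_count_def by (intro sum.neutral) auto
          qed
        qed auto
        also have "\<dots> \<le> B" unfolding B_def using T by (intro sum_mono2 reduced_count_nonneg) auto
        finally show ?thesis .
      qed
      obtain l :: nat where l: "3 * B \<le> real l" using real_arch_simple by blast
      obtain k where k: "l \<le> k" "x \<in> Z k" using x by (force simp: A_def)
      have "(real k + 1) / 3 < X k x" using k(2) F(3)[of k] unfolding Z_def E by simp
      hence "real k + 1 < 3 * B" using XB[of k] by simp
      thus False using l k(1) by simp
    qed
  qed
  show ?thesis
  proof
    assume "negligible (limsup_nbhd K \<rho>)"
    hence neg: "negligible (\<Inter>l. A l)" using sub negligible_subset by blast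
    have meas: "(\<Inter>l. A l) \<in> sets borel" using Am by (intro sets.countable_INT'') auto
    have "emeasure lebesgue (\<Inter>l. A l) = emeasure lborel (\<Inter>l. A l)"
      using meas by simp
    thus False using pos neg meas by (simp add: negligible_iff_emeasure0)
  qed
qed

section \<open>\<open>p\<close>-adic overlaps\<close>

text \<open>The range \<open>\<bar>a\<bar> \<le> m\<close> is that of \<open>padic_approx\<close>.
  For \<open>m\<close> and \<open>n\<close> prime to \<open>p\<close>, the divisibility says that
  \<open>a / m\<close> and \<open>b / n\<close> have \<open>p\<close>-adic distance at most
  \<open>1 / p ^ k\<close>.\<close>

definition padic_close_pairs :: "nat \<Rightarrow> nat \<Rightarrow> nat \<Rightarrow> nat \<Rightarrow> (int \<times> int) set" where
  "padic_close_pairs p m n k = {(a, b). \<bar>a\<bar> \<le> int m \<and> coprime a (int m) \<and> \<bar>b\<bar> \<le> int n \<and> coprime b (int n) \<and>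
     int p ^ k dvd a * int n - b * int m}"

lemma finite_padic_close_pairs: "finite (padic_close_pairs p m n k)"
  by (rule finite_subset[of _ "{- int m..int m} \<times> {- int n..int n}"])
    (auto simp: padic_close_pairs_def)

lemma card_padic_close_pairs_swap: "card (padic_close_pairs p n m k) = card (padic_close_pairs p m n k)"
proof (rule bij_betw_same_card[of prod.swap])
  have "int p ^ k dvd a * int n - b * int m \<longleftrightarrow> int p ^ k dvd b * int m - a * int n" for a b
    by (rule dvd_diff_commute)
  thus "bij_betw prod.swap (padic_close_pairs p n m k) (padic_close_pairs p m n k)"
    by (intro bij_betw_imageI) (auto simp: padic_close_pairs_def inj_on_def image_iff)
qed

text \<open>
  If \<open>s / M\<close> and \<open>t / N\<close> are close, where \<open>M = p ^ i * m\<close> and \<open>N = p ^ i * n\<close>, then \<open>j = s * n - t * m\<close>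
  is small, and the residues of \<open>p ^ k * s\<close> modulo \<open>m\<close> and \<open>p ^ k * t\<close> modulo \<open>n\<close> have representatives
  \<open>a\<close>, \<open>b\<close> with \<open>a * n - b * m = p ^ k * j\<close>, so \<open>a / m\<close> and \<open>b / n\<close> are close \<open>p\<close>-adically.
\<close>
lemma card_close_pairs_le_padic:
  assumes p: "prime p" and mn: "0 < m" "0 < n" "\<not> p dvd m" "\<not> p dvd n"
    and R: "real p ^ i * real p ^ k * R < 1"
  shows "card (close_pairs (p ^ i * m) (p ^ i * n) R) \<le> p ^ i * p ^ i * card (padic_close_pairs p m n k)"
proof -
  have p0: "0 < p" using p by (simp add: prime_gt_0_nat)
  have cop_p: "coprime (int p ^ k) (int l)" if "\<not> p dvd l" for l
  proof -
    have "coprime p l" using p that by (rule prime_imp_coprime)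
    thus ?thesis by simp
  qed
  have ex: "\<exists>a b. (a, b) \<in> padic_close_pairs p m n k \<and> [a = int p ^ k * int s] (mod int m) \<and>
      [b = int p ^ k * int t] (mod int n)"
    if st: "(s, t) \<in> close_pairs (p ^ i * m) (p ^ i * n) R" for s t
  proof -
    define j where "j = int s * int n - int t * int m"
    have cop: "coprime (int s) (int m)" "coprime (int t) (int n)"
      using st by (auto simp: close_pairs_def)
    define a0 b0 where "a0 = (int p ^ k * int s) mod int m" and "b0 = (int p ^ k * int t) mod int n"
    have a0: "0 \<le> a0" "a0 < int m" and b0: "0 \<le> b0" "b0 < int n"
      using mn by (auto simp: a0_def b0_def)
    define u v where "u = (int p ^ k * int s) div int m" and "v = (int p ^ k * int t) div int n"
    have a0': "a0 = int p ^ k * int s - u * int m" and b0': "b0 = int p ^ k * int t - v * int n"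
      by (auto simp: a0_def b0_def u_def v_def minus_div_mult_eq_mod)
    have eq: "a0 * int n - b0 * int m - int p ^ k * j = (v - u) * (int m * int n)"
      by (simp add: a0' b0' j_def algebra_simps)
    have "real s / real (p ^ i * m) - real t / real (p ^ i * n) = of_int j / (real p ^ i * real m * real n)"
      using mn p0 by (simp add: j_def field_simps)
    hence "\<bar>of_int j / (real p ^ i * real m * real n)\<bar> \<le> R" using st by (simp add: close_pairs_def)
    hence "\<bar>of_int j\<bar> \<le> R * (real p ^ i * real m * real n)"
      using mn p0 by (simp add: abs_divide abs_mult field_simps)
    hence "real p ^ k * \<bar>of_int j\<bar> \<le> real p ^ k * (R * (real p ^ i * real m * real n))"
      by (rule mult_left_mono) simp
    also have "\<dots> = (real p ^ i * real p ^ k * R) * (real m * real n)" by simp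
    also have "\<dots> < 1 * (real m * real n)" using R mn by (intro mult_strict_right_mono) auto
    finally have "of_int \<bar>int p ^ k * j\<bar> < real_of_int (int m * int n)" by (simp add: abs_mult)
    hence j: "\<bar>int p ^ k * j\<bar> < int m * int n" by (simp only: of_int_less_iff)
    have bnd: "0 \<le> a0 * int n" "a0 * int n < int m * int n" "0 \<le> b0 * int m" "b0 * int m < int m * int n"
      using a0 b0 mn by (auto simp: mult.commute[of "int m"] intro!: mult_strict_right_mono)
    \<comment> \<open>The integers \<open>a0 * n - b0 * m\<close> and \<open>p ^ k * j\<close> agree
      modulo \<open>m * n\<close>, and both are smaller than \<open>m * n\<close> in absolute
      value.\<close>
    have vu: "v - u \<in> {-1, 0, 1}"
    proof -
      have "\<bar>(v - u) * (int m * int n)\<bar> < 2 * (int m * int n)" unfolding eq[symmetric] using j bnd by linarith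
      hence "\<bar>v - u\<bar> * (int m * int n) < 2 * (int m * int n)" using mn by (simp add: abs_mult)
      hence "\<bar>v - u\<bar> < 2" using mn by (simp add: mult_less_cancel_right)
      thus ?thesis by auto
    qed
    \<comment> \<open>The leftover multiple of \<open>m * n\<close> is absorbed by moving one
      representative down by a full period, which uses the negative numerators of the
      \<open>p\<close>-adic sets.\<close>
    define a b where "a = (if v - u = 1 then a0 - int m else a0)" and "b = (if v - u = -1 then b0 - int n else b0)"
    have ab_eq: "a * int n - b * int m = int p ^ k * j"
      using vu eq by (auto simp: a_def b_def algebra_simps)
    have ca: "[a = int p ^ k * int s] (mod int m)"
    proof -
      have "[a = a0] (mod int m)" by (auto simp: a_def cong_def)
      thus ?thesis by (simp add: a0_def cong_def)
    qed
    have cb: "[b = int p ^ k * int t] (mod int n)"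
    proof -
      have "[b = b0] (mod int n)" by (auto simp: b_def cong_def)
      thus ?thesis by (simp add: b0_def cong_def)
    qed
    have "coprime a (int m)" "coprime b (int n)"
      using cong_imp_coprime[OF cong_sym[OF ca]] cong_imp_coprime[OF cong_sym[OF cb]] cop cop_p[OF mn(3)] cop_p[OF mn(4)]
      by simp_all
    moreover have "\<bar>a\<bar> \<le> int m" "\<bar>b\<bar> \<le> int n" using a0 b0 by (auto simp: a_def b_def)
    ultimately have "(a, b) \<in> padic_close_pairs p m n k"
      using ab_eq by (simp add: padic_close_pairs_def)
    thus ?thesis using ca cb by blast
  qed
  define f where "f s t = (SOME ab. ab \<in> padic_close_pairs p m n k \<and> [fst ab = int p ^ k * int s] (mod int m) \<and>
      [snd ab = int p ^ k * int t] (mod int n))" for s t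
  have f: "f s t \<in> padic_close_pairs p m n k \<and> [fst (f s t) = int p ^ k * int s] (mod int m) \<and>
      [snd (f s t) = int p ^ k * int t] (mod int n)"
    if "(s, t) \<in> close_pairs (p ^ i * m) (p ^ i * n) R" for s t
    unfolding f_def using ex[OF that] by (intro someI_ex[of "\<lambda>ab. ab \<in> padic_close_pairs p m n k \<and> _ ab"]) auto
  have inj: "s = s'" if "s div l = s' div l" "[x = int p ^ k * int s] (mod int l)" "[x = int p ^ k * int s'] (mod int l)"
    "\<not> p dvd l" for s s' l :: nat and x
  proof -
    have "[int p ^ k * int s = int p ^ k * int s'] (mod int l)" using that(2,3) cong_trans cong_sym by blast
    hence "[int s = int s'] (mod int l)" using cop_p[OF that(4)] by (simp add: cong_mult_lcancel coprime_commute)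
    hence "s mod l = s' mod l" by (metis cong_def cong_int_iff)
    thus ?thesis using that(1) by (metis div_mult_mod_eq)
  qed
  \<comment> \<open>The value of \<open>f\<close> determines only \<open>s\<close> modulo
    \<open>m\<close> and \<open>t\<close> modulo \<open>n\<close>. The quotients
    \<open>s div m\<close> and \<open>t div n\<close>, each below \<open>p ^ i\<close>, recover the
    rest and account for the two factors \<open>p ^ i\<close>.\<close>
  have "card (close_pairs (p ^ i * m) (p ^ i * n) R)
    \<le> card (({..<p ^ i} \<times> {..<p ^ i}) \<times> padic_close_pairs p m n k)"
  proof (rule card_inj_on_le[where f = "\<lambda>(s, t). ((s div m, t div n), f s t)"])
    show "inj_on (\<lambda>(s, t). ((s div m, t div n), f s t)) (close_pairs (p ^ i * m) (p ^ i * n) R)"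
    proof (rule inj_onI, clarify)
      fix s t s' t' assume st: "(s, t) \<in> close_pairs (p ^ i * m) (p ^ i * n) R"
        "(s', t') \<in> close_pairs (p ^ i * m) (p ^ i * n) R" "s div m = s' div m" "t div n = t' div n" "f s t = f s' t'"
      show "s = s' \<and> t = t'"
        using inj[OF st(3) _ _ mn(3)] inj[OF st(4) _ _ mn(4)] f[OF st(1)] f[OF st(2)] st(5) by auto
    qed
    show "(\<lambda>(s, t). ((s div m, t div n), f s t)) ` close_pairs (p ^ i * m) (p ^ i * n) R
      \<subseteq> ({..<p ^ i} \<times> {..<p ^ i}) \<times> padic_close_pairs p m n k"
      using f by (auto simp: close_pairs_def less_mult_imp_div_less)
  qed (simp add: finite_padic_close_pairs)
  thus ?thesis by (simp add: card_cartesian_product)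
qed

section \<open>Haar measure of the \<open>p\<close>-adic approximation sets\<close>

context
  fixes p :: nat
  assumes prime_p: "prime p"
begin

interpretation haar: prob_space "Zp_haar p"
  using is_Zp_haar_Zp_haar[OF prime_p] by (intro prob_spaceI) (simp add: is_Zp_haar_def)

lemma sets_Zp_haar: "sets (Zp_haar p) = sets (Zp_borel p)"
  using is_Zp_haar_Zp_haar[OF prime_p] by (simp add: is_Zp_haar_def)

lemma Zp_ball_sets_haar: "z \<in> Zp p \<Longrightarrow> Zp_ball p k z \<in> sets (Zp_haar p)"
  using Zp_ball_sets[OF prime_p] by (simp add: sets_Zp_haar)

lemma measure_Zp_ball: "z \<in> Zp p \<Longrightarrow> measure (Zp_haar p) (Zp_ball p k z) = 1 / real p ^ k"
  using is_Zp_haar_ball[OF prime_p is_Zp_haar_Zp_haar[OF prime_p], of z k] by (simp add: measure_def)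

lemma padic_rat_abs_fraction:
  assumes "0 < n" "\<not> p dvd n"
  shows "padic_rat_abs p (of_int a / of_nat n) = padic_rat_abs p (of_int a)"
proof (cases "a = 0")
  case False
  have "multiplicity (int p) (int n) = 0" using assms(2) by (intro not_dvd_imp_multiplicity_0) simp
  thus ?thesis
    using padic_rat_abs_divide[OF prime_p False, of "int n"] padic_rat_abs_divide[OF prime_p False, of 1] assms(1)
    by simp
qed simp

lemma fraction_in_Zp:
  assumes "0 < n" "\<not> p dvd n"
  shows "padic_of_rat p (of_int a / of_nat n) \<in> Zp p"
  using padic_rat_abs_of_int_le_iff[OF prime_p, of a 0] padic_rat_abs_fraction[OF assms]
  by (simp add: Zp_def padic_of_rat_in_Qp[OF prime_p] padic_abs_of_rat[OF prime_p])

lemma fraction_in_Zp_ball_iff: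
  assumes "0 < m" "0 < n" "\<not> p dvd m" "\<not> p dvd n"
  shows "padic_of_rat p (of_int a / of_nat m) \<in> Zp_ball p k (padic_of_rat p (of_int b / of_nat n))
     \<longleftrightarrow> int p ^ k dvd a * int n - b * int m"
proof -
  have "(of_int a / of_nat m - of_int b / of_nat n :: rat) = of_int (a * int n - b * int m) / of_nat (m * n)"
    using assms(1,2) by (simp add: field_simps)
  moreover have "\<not> p dvd m * n" using prime_p assms(3,4) by (simp add: prime_dvd_mult_iff)
  ultimately have "padic_rat_abs p (of_int a / of_nat m - of_int b / of_nat n) = padic_rat_abs p (of_int (a * int n - b * int m))"
    using assms(1,2) padic_rat_abs_fraction[of "m * n" "a * int n - b * int m"] by simp
  thus ?thesis
    using padic_rat_abs_of_int_le_iff[OF prime_p, of "a * int n - b * int m" k]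
    by (simp only: Zp_ball_def[OF prime_p] mem_Collect_eq fraction_in_Zp[OF assms(1,3)] padic_diff_of_rat[OF prime_p]
        padic_abs_of_rat[OF prime_p] simp_thms)
qed

lemma Zp_ball_disjoint:
  assumes "z \<in> Zp p" "w \<in> Zp p" "z \<notin> Zp_ball p k w"
  shows "Zp_ball p k z \<inter> Zp_ball p k w = {}"
proof (rule ccontr)
  assume "\<not> ?thesis"
  then obtain x where "x \<in> Zp_ball p k z" "x \<in> Zp_ball p k w" by blast
  hence "Zp_ball p k z = Zp_ball p k w"
    using Zp_ball_eq[OF prime_p assms(1)] Zp_ball_eq[OF prime_p assms(2)] by metis
  thus False using Zp_ball_self[OF prime_p assms(1)] assms(3) by blast
qed

lemma padic_approx_eq:
  assumes "\<Psi> n = 1 / real p ^ k"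
  shows "padic_approx p \<Psi> n = (\<Union>a\<in>{a. \<bar>a\<bar> \<le> int n \<and> coprime a (int n)}. Zp_ball p k (padic_of_rat p (of_int a / of_nat n)))"
  unfolding padic_approx_def Zp_ball_def[OF prime_p] assms by (intro SUP_cong) auto

lemma finite_numerators: "finite {a. \<bar>a\<bar> \<le> int n \<and> coprime a (int n)}"
  by (rule finite_subset[of _ "{- int n..int n}"]) auto

lemma padic_approx_sets:
  assumes "0 < n" "\<not> p dvd n" "\<Psi> n = 1 / real p ^ k"
  shows "padic_approx p \<Psi> n \<in> sets (Zp_haar p)"
  unfolding padic_approx_eq[of \<Psi> n k, OF assms(3)]
  using assms(1,2) finite_numerators by (intro sets.finite_UN Zp_ball_sets_haar fraction_in_Zp) auto

text \<open>Every numerator is \<open>e * n + s\<close> with \<open>0 \<le> s < n\<close> and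
  \<open>e\<close> in \<open>{-1, 0, 1}\<close>, so at most \<open>3 * \<phi> n\<close> balls occur;
  \<open>e = 1\<close> is there for the numerator \<open>n\<close>.\<close>

lemma measure_padic_approx_le:
  assumes "0 < n" "\<not> p dvd n" "\<Psi> n = 1 / real p ^ k"
  shows "measure (Zp_haar p) (padic_approx p \<Psi> n) \<le> 3 * real (totient n) / real p ^ k"
proof -
  let ?A = "{a. \<bar>a\<bar> \<le> int n \<and> coprime a (int n)}" and ?S = "{s. s < n \<and> coprime s n}"
  have "card ?A \<le> card ({-1, 0, 1::int} \<times> ?S)"
  proof (rule surj_card_le)
    show "finite ({-1, 0, 1::int} \<times> ?S)" by simp
    show "?A \<subseteq> (\<lambda>(e, s). e * int n + int s) ` ({-1, 0, 1} \<times> ?S)"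
    proof
      fix a assume a: "a \<in> ?A"
      define s where "s = nat (a mod int n)"
      have s: "int s = a mod int n" using assms(1) by (simp add: s_def)
      have "coprime (int s) (int n)" using a unfolding s
        by (simp add: coprime_iff_gcd_eq_1 gcd.commute[of _ "int n"] gcd_red_int[symmetric])
      moreover have "s < n" using s assms(1) by (metis of_nat_0_less_iff of_nat_less_iff pos_mod_bound)
      moreover have "a div int n \<in> {-1, 0, 1}"
      proof -
        have "- int n \<le> a" "a \<le> int n" using a by auto
        hence "- int n div int n \<le> a div int n" "a div int n \<le> int n div int n"
          using assms(1) zdiv_mono1[of "- int n" a "int n"] zdiv_mono1[of a "int n" "int n"] by simp_all
        moreover have "- int n div int n = -1" "int n div int n = 1" using assms(1) nonzero_mult_div_cancel_right[of "int n" "-1"]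
          by simp_all
        ultimately show ?thesis by auto
      qed
      moreover have "a = a div int n * int n + int s" unfolding s by simp
      ultimately show "a \<in> (\<lambda>(e, s). e * int n + int s) ` ({-1, 0, 1} \<times> ?S)"
        by (intro image_eqI[of _ _ "(a div int n, s)"]) auto
    qed
  qed
  hence card: "card ?A \<le> 3 * totient n" by (simp add: card_cartesian_product card_coprime_lessThan)
  have "measure (Zp_haar p) (padic_approx p \<Psi> n)
      \<le> (\<Sum>a\<in>?A. measure (Zp_haar p) (Zp_ball p k (padic_of_rat p (of_int a / of_nat n))))"
    unfolding padic_approx_eq[of \<Psi> n k, OF assms(3)]
    using assms(1,2) finite_numerators
    by (intro haar.finite_measure_subadditive_finite) (auto intro: Zp_ball_sets_haar fraction_in_Zp)
  also have "\<dots> = real (card ?A) / real p ^ k" using assms(1,2) by (simp add: measure_Zp_ball fraction_in_Zp)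
  also have "\<dots> \<le> real (3 * totient n) / real p ^ k" using card by (intro divide_right_mono) auto
  finally show ?thesis by simp
qed

text \<open>For each close pair \<open>(a, b)\<close> the smaller ball, around \<open>a / m\<close>,
  lies in both sets. The condition \<open>2 * n < p ^ l\<close> makes \<open>b\<close> a function of
  \<open>a\<close>, and \<open>2 * m < p ^ k\<close> makes the balls for different \<open>a\<close>
  disjoint, so their measures add up.\<close>

lemma measure_padic_approx_Int_ge_aux:
  assumes m: "0 < m" "\<not> p dvd m" "\<Psi> m = 1 / real p ^ k" "2 * m < p ^ k"
    and n: "0 < n" "\<not> p dvd n" "\<Psi> n = 1 / real p ^ l" "2 * n < p ^ l" and kl: "l \<le> k"
  shows "real (card (padic_close_pairs p m n l)) / real p ^ k
    \<le> measure (Zp_haar p) (padic_approx p \<Psi> m \<inter> padic_approx p \<Psi> n)"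
proof -
  let ?D = "padic_close_pairs p m n l" and ?f = "\<lambda>a m. padic_of_rat p (of_int a / of_nat m)"
  have small: "x = y" if "int p ^ j dvd (x - y) * int c" "\<not> p dvd c" "\<bar>x\<bar> \<le> int d" "\<bar>y\<bar> \<le> int d" "2 * d < p ^ j"
    for x y :: int and c d j
  proof -
    have "coprime p c" using prime_p that(2) by (rule prime_imp_coprime)
    hence "coprime (int p ^ j) (int c)" by simp
    hence "int p ^ j dvd x - y" using that(1) by (simp add: coprime_dvd_mult_left_iff)
    moreover have "\<bar>x - y\<bar> < int p ^ j"
    proof -
      have "int (2 * d) < int (p ^ j)" using that(5) by (simp only: of_nat_less_iff)
      thus ?thesis using that(3,4) by simp
    qed
    ultimately show ?thesis using dvd_imp_le_int[of "x - y" "int p ^ j"] by auto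
  qed
  have ball: "?f a m \<in> Zp_ball p l (?f b n)" if "(a, b) \<in> ?D" for a b
    using that m n by (simp add: fraction_in_Zp_ball_iff padic_close_pairs_def)
  have inj: "inj_on fst ?D"
  proof (rule inj_onI)
    fix x y assume xy: "x \<in> ?D" "y \<in> ?D" "fst x = fst y"
    obtain a b b' where ab: "x = (a, b)" "y = (a, b')" using xy(3) by (metis prod.collapse)
    hence D: "(a, b) \<in> ?D" "(a, b') \<in> ?D" using xy by simp_all
    have "int p ^ l dvd (a * int n - b' * int m) - (a * int n - b * int m)"
      using D by (intro dvd_diff[of _ "_ - _" "_ - _"]) (auto simp: padic_close_pairs_def)
    hence "int p ^ l dvd (b - b') * int m" by (simp add: algebra_simps)
    hence "b = b'" using D m n by (intro small[of l b b' m n]) (auto simp: padic_close_pairs_def)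
    thus "x = y" using ab by simp
  qed
  have "real (card ?D) / real p ^ k = real (card (fst ` ?D)) / real p ^ k" using inj by (simp add: card_image)
  also have "\<dots> = (\<Sum>a\<in>fst ` ?D. measure (Zp_haar p) (Zp_ball p k (?f a m)))"
    using m by (simp add: measure_Zp_ball fraction_in_Zp)
  also have "\<dots> = measure (Zp_haar p) (\<Union>a\<in>fst ` ?D. Zp_ball p k (?f a m))"
  proof (rule haar.finite_measure_finite_Union[symmetric])
    show "disjoint_family_on (\<lambda>a. Zp_ball p k (?f a m)) (fst ` ?D)"
      unfolding disjoint_family_on_def
    proof (intro ballI impI)
      fix a a' assume a: "a \<in> fst ` ?D" "a' \<in> fst ` ?D" "a \<noteq> a'"
      have "\<bar>a\<bar> \<le> int m" "\<bar>a'\<bar> \<le> int m" using a by (auto simp: padic_close_pairs_def)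
      hence "\<not> int p ^ k dvd (a - a') * int m" using small[of k a a' m m] m a(3) by blast
      hence "?f a m \<notin> Zp_ball p k (?f a' m)" using m by (simp add: fraction_in_Zp_ball_iff algebra_simps)
      thus "Zp_ball p k (?f a m) \<inter> Zp_ball p k (?f a' m) = {}"
        using m by (intro Zp_ball_disjoint fraction_in_Zp)
    qed
  qed (use m in \<open>auto simp: finite_padic_close_pairs intro!: Zp_ball_sets_haar fraction_in_Zp\<close>)
  also have "\<dots> \<le> measure (Zp_haar p) (padic_approx p \<Psi> m \<inter> padic_approx p \<Psi> n)"
  proof (rule haar.finite_measure_mono)
    show "padic_approx p \<Psi> m \<inter> padic_approx p \<Psi> n \<in> sets (Zp_haar p)"
      using m n padic_approx_sets by blast
    show "(\<Union>a\<in>fst ` ?D. Zp_ball p k (?f a m)) \<subseteq> padic_approx p \<Psi> m \<inter> padic_approx p \<Psi> n"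
    proof
      fix x assume "x \<in> (\<Union>a\<in>fst ` ?D. Zp_ball p k (?f a m))"
      then obtain a b where D: "(a, b) \<in> ?D" and x: "x \<in> Zp_ball p k (?f a m)" by auto
      have "x \<in> Zp_ball p l (?f a m)" using x Zp_ball_mono[OF prime_p kl] by blast
      also have "Zp_ball p l (?f a m) = Zp_ball p l (?f b n)"
        using Zp_ball_eq[OF prime_p fraction_in_Zp ball[OF D]] n by simp
      finally have "x \<in> padic_approx p \<Psi> n"
        unfolding padic_approx_eq[of \<Psi> n l, OF n(3)] using D by (auto simp: padic_close_pairs_def)
      moreover have "x \<in> padic_approx p \<Psi> m"
        unfolding padic_approx_eq[of \<Psi> m k, OF m(3)] using D x by (auto simp: padic_close_pairs_def)
      ultimately show "x \<in> padic_approx p \<Psi> m \<inter> padic_approx p \<Psi> n" by blast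
    qed
  qed
  finally show ?thesis .
qed

lemma measure_padic_approx_Int_ge:
  assumes "0 < m" "\<not> p dvd m" "\<Psi> m = 1 / real p ^ k" "2 * m < p ^ k"
    and "0 < n" "\<not> p dvd n" "\<Psi> n = 1 / real p ^ l" "2 * n < p ^ l"
  shows "real (card (padic_close_pairs p m n (min k l))) / real p ^ max k l
    \<le> measure (Zp_haar p) (padic_approx p \<Psi> m \<inter> padic_approx p \<Psi> n)"
proof (cases "l \<le> k")
  case True
  thus ?thesis using measure_padic_approx_Int_ge_aux[OF assms True] by (simp add: min_absorb2 max_absorb1)
next
  case False
  hence "k \<le> l" by simp
  from measure_padic_approx_Int_ge_aux[OF assms(5-8) assms(1-4) this] False show ?thesis
    by (simp add: min_absorb1 max_absorb2 card_padic_close_pairs_swap Int_commute)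
qed

text \<open>Radius 0 still leaves the fractions that lie in \<open>Zp p\<close>. A nonempty slice is
  an intersection of balls whose measures tend to 0. This covers the arguments at which the
  transferred radius function is set to 0.\<close>

lemma measure_padic_approx_zero:
  assumes "\<Psi> n = 0"
  shows "measure (Zp_haar p) (padic_approx p \<Psi> n) = 0"
proof -
  have "{x \<in> Zp p. padic_abs p (padic_diff p x (padic_of_rat p r)) \<le> 0} \<in> null_sets (Zp_haar p)" (is "?S \<in> _") for r
  proof (cases "?S = {}")
    case False
    then obtain z where z: "z \<in> Zp p" "padic_abs p (padic_diff p z (padic_of_rat p r)) \<le> 0" by blast
    have Q: "padic_of_rat p r \<in> Qp p" by (rule padic_of_rat_in_Qp[OF prime_p])
    have ZQ: "x \<in> Qp p" if "x \<in> Zp p" for x using that Zp_subset_Qp[OF prime_p] by blast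
    have eq: "?S = (\<Inter>k. Zp_ball p k z)"
    proof (intro equalityI subsetI)
      fix x assume x: "x \<in> ?S"
      have "padic_abs p (padic_diff p x z) \<le> 0"
        using padic_abs_diff_triangle[OF prime_p ZQ Q ZQ, of x z] x z
          padic_abs_diff_commute[OF prime_p ZQ Q, of z] by (auto simp: max_def split: if_splits)
      hence "padic_abs p (padic_diff p x z) \<le> 1 / real p ^ k" for k
        by (rule order_trans) simp
      thus "x \<in> (\<Inter>k. Zp_ball p k z)" using x by (simp add: Zp_ball_def[OF prime_p])
    next
      fix x assume "x \<in> (\<Inter>k. Zp_ball p k z)"
      hence x: "x \<in> Zp p" "\<And>k. padic_abs p (padic_diff p x z) \<le> 1 / real p ^ k"
        by (auto simp: Zp_ball_def[OF prime_p])
      have "padic_abs p (padic_diff p x z) \<le> 0"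
      proof (rule ccontr)
        assume "\<not> ?thesis"
        then obtain k where "(1 / real p) ^ k < padic_abs p (padic_diff p x z)"
          using real_arch_pow_inv[of "padic_abs p (padic_diff p x z)" "1 / real p"] prime_gt_1_nat[OF prime_p] by auto
        thus False using x(2)[of k] by (simp add: power_one_over)
      qed
      thus "x \<in> ?S"
        using padic_abs_diff_triangle[OF prime_p ZQ ZQ Q, of x z] x z
        by (auto simp: max_def split: if_splits)
    qed
    have sets: "?S \<in> sets (Zp_haar p)"
      unfolding eq using Zp_ball_sets_haar[OF z(1)] by (intro sets.countable_INT) auto
    have "measure (Zp_haar p) ?S \<le> 1 / real p ^ k" for k
    proof -
      have "measure (Zp_haar p) ?S \<le> measure (Zp_haar p) (Zp_ball p k z)"
        using eq Zp_ball_sets_haar[OF z(1)] by (intro haar.finite_measure_mono) auto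
      thus ?thesis using measure_Zp_ball[OF z(1)] by simp
    qed
    hence "measure (Zp_haar p) ?S \<le> 0"
      using real_arch_pow_inv[of "measure (Zp_haar p) ?S" "1 / real p"] prime_gt_1_nat[OF prime_p]
      by (force simp: power_one_over not_less[symmetric])
    hence "emeasure (Zp_haar p) ?S = 0" by (simp add: haar.emeasure_eq_measure measure_le_0_iff)
    thus ?thesis using sets by (rule null_setsI)
  next
    case True
    show ?thesis unfolding True by simp
  qed
  hence "padic_approx p \<Psi> n \<in> null_sets (Zp_haar p)"
    unfolding padic_approx_def assms
    by (intro null_sets_UN') (auto intro: countable_finite finite_subset[of _ "{- int n..int n}"])
  thus ?thesis by (simp add: measure_eq_0_null_sets)
qed

end

section \<open>Transferring quasi-independence\<close>

text \<open>For non-negative \<open>w\<close> this is divergence of the series over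
  \<open>K\<close>. Finite subsets make it easy to split \<open>K\<close>, and they directly provide
  the sets used in \<open>limsup_nbhd_not_negligible\<close>.\<close>

definition unbounded_sum :: "'a set \<Rightarrow> ('a \<Rightarrow> real) \<Rightarrow> bool" where
  "unbounded_sum K w \<longleftrightarrow> (\<forall>B. \<exists>F. finite F \<and> F \<subseteq> K \<and> B \<le> sum w F)"

lemma unbounded_sum_Un:
  assumes "unbounded_sum (A \<union> B) w" "\<And>x. x \<in> A \<union> B \<Longrightarrow> 0 \<le> w x"
  shows "unbounded_sum A w \<or> unbounded_sum B w"
proof (rule ccontr)
  assume "\<not> ?thesis"
  then obtain a b where a: "\<And>F. finite F \<Longrightarrow> F \<subseteq> A \<Longrightarrow> sum w F < a"
    and b: "\<And>F. finite F \<Longrightarrow> F \<subseteq> B \<Longrightarrow> sum w F < b"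
    unfolding unbounded_sum_def by (metis not_less)
  obtain F where F: "finite F" "F \<subseteq> A \<union> B" "a + b \<le> sum w F"
    using assms(1) unfolding unbounded_sum_def by blast
  have "sum w F = sum w (F \<inter> A) + sum w (F - A)" using F(1) by (rule sum.Int_Diff)
  also have "\<dots> < a + b" using F(1,2) by (intro add_strict_mono a b) auto
  finally show False using F(3) by simp
qed

lemma unbounded_sum_UN:
  assumes "finite J" "unbounded_sum (\<Union>j\<in>J. K j) w" "\<And>j x. j \<in> J \<Longrightarrow> x \<in> K j \<Longrightarrow> 0 \<le> w x"
  shows "\<exists>j\<in>J. unbounded_sum (K j) w"
  using assms
proof (induction J rule: finite_induct)
  case empty
  hence "1 \<le> sum w {}" unfolding unbounded_sum_def by (metis UN_empty subset_empty)
  thus ?case by simp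
next
  case (insert j J)
  have "unbounded_sum (K j) w \<or> unbounded_sum (\<Union>j\<in>J. K j) w"
    using insert.prems by (intro unbounded_sum_Un) auto
  thus ?case using insert by auto
qed

text \<open>The bound \<open>c \<le> n * \<rho> n\<close> is what \<open>card_close_pairs_le\<close>
  asks of \<open>R = \<rho> m + \<rho> n\<close>, and
  \<open>min x y * (x + y) \<le> 2 * x * y\<close> turns its estimate into a product of
  weights.\<close>

lemma limsup_nbhd_not_negligible_large:
  assumes K: "\<And>n. n \<in> K \<Longrightarrow> 0 < n \<and> \<rho> n \<le> 1 \<and> c \<le> real n * \<rho> n" and c: "0 < c"
    and div: "unbounded_sum K (\<lambda>n. real (totient n) * \<rho> n)"
  shows "\<not> negligible (limsup_nbhd K \<rho>)"
proof -
  define C where "C = 32 * (1 + sqrt (2 / c))"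
  have C: "0 < C" using c by (simp add: C_def add_pos_nonneg)
  have \<rho>0: "0 < \<rho> n" if "n \<in> K" for n
    using K[OF that] c by (metis less_le_trans of_nat_0_less_iff zero_less_mult_pos)
  have "\<exists>F. finite F \<and> F \<subseteq> K \<and> B \<le> (\<Sum>n\<in>F. real (totient n) * \<rho> n) \<and>
      (\<Sum>m\<in>F. \<Sum>n\<in>F. min (\<rho> m) (\<rho> n) * real (card (close_pairs m n (\<rho> m + \<rho> n))))
        \<le> (1 + 2 * C) * (\<Sum>n\<in>F. real (totient n) * \<rho> n)\<^sup>2" for B
  proof -
    let ?w = "\<lambda>n. real (totient n) * \<rho> n"
    \<comment> \<open>Total weight at least 1 lets the diagonal contribution be absorbed into the
      square of the weight.\<close>
    obtain F where F: "finite F" "F \<subseteq> K" "max B 1 \<le> sum ?w F"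
      using div unfolding unbounded_sum_def by blast
    have "min (\<rho> m) (\<rho> n) * real (card (close_pairs m n (\<rho> m + \<rho> n)))
        \<le> (if m = n then ?w n else 0) + 2 * C * (?w m * ?w n)" if "m \<in> F" "n \<in> F" for m n
    proof -
      have mn: "0 < m" "0 < n" "c \<le> real m * \<rho> m" "c \<le> real n * \<rho> n" "0 < \<rho> m" "0 < \<rho> n"
        using that F(2) K \<rho>0 by auto
      have "c / real m + c / real n \<le> \<rho> m + \<rho> n" using mn by (intro add_mono) (simp_all add: field_simps)
      from card_close_pairs_le[OF mn(1,2) c this]
      have "min (\<rho> m) (\<rho> n) * real (card (close_pairs m n (\<rho> m + \<rho> n)))
        \<le> min (\<rho> m) (\<rho> n) * ((if m = n then real (totient n) else 0)
          + C * (\<rho> m + \<rho> n) * real (totient m) * real (totient n))"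
        using mn unfolding C_def by (intro mult_left_mono) auto
      also have "\<dots> = (if m = n then ?w n else 0) + (min (\<rho> m) (\<rho> n) * (\<rho> m + \<rho> n)) * (C * real (totient m) * real (totient n))"
        by (simp add: algebra_simps)
      also have "\<dots> \<le> (if m = n then ?w n else 0) + (2 * (\<rho> m * \<rho> n)) * (C * real (totient m) * real (totient n))"
      proof (intro add_left_mono mult_right_mono)
        show "min (\<rho> m) (\<rho> n) * (\<rho> m + \<rho> n) \<le> 2 * (\<rho> m * \<rho> n)"
          using mn by (cases "\<rho> m \<le> \<rho> n") (auto simp: min_def algebra_simps)
      qed (use C in auto)
      finally show ?thesis by (simp add: mult_ac)
    qed
    hence "(\<Sum>m\<in>F. \<Sum>n\<in>F. min (\<rho> m) (\<rho> n) * real (card (close_pairs m n (\<rho> m + \<rho> n))))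
      \<le> (\<Sum>m\<in>F. \<Sum>n\<in>F. (if m = n then ?w n else 0) + 2 * C * (?w m * ?w n))"
      by (intro sum_mono)
    also have "\<dots> = sum ?w F + 2 * C * (sum ?w F)\<^sup>2"
      using F(1) by (simp add: sum.distrib sum_product power2_eq_square flip: sum_distrib_left)
    also have "\<dots> \<le> (1 + 2 * C) * (sum ?w F)\<^sup>2"
      using F(3) self_le_power[of "sum ?w F" 2] by (simp add: algebra_simps)
    finally show ?thesis using F by (intro exI[of _ F]) auto
  qed
  thus ?thesis
    using K \<rho>0 C by (intro limsup_nbhd_not_negligible[where C = "1 + 2 * C"]) (auto intro: less_imp_le)
qed

lemma ex_padic_radius:
  fixes p :: nat and d :: real
  assumes "1 < p" "0 < d" "d < 1"
  obtains k where "d < 1 / real p ^ k" "1 / real p ^ k \<le> real p * d"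
proof -
  obtain l where "(1 / real p) ^ l < d"
    using real_arch_pow_inv[OF assms(2), of "1 / real p"] assms(1) by auto
  hence ex: "1 / real p ^ l \<le> d" by (simp add: power_one_over)
  define l0 where "l0 = (LEAST l. 1 / real p ^ l \<le> d)"
  have l0: "1 / real p ^ l0 \<le> d" unfolding l0_def using ex by (rule LeastI)
  have "l0 \<noteq> 0" using l0 assms(3) by (auto intro: ccontr)
  then obtain k where k: "l0 = Suc k" using not0_implies_Suc by blast
  have "\<not> 1 / real p ^ k \<le> d" using not_less_Least[of k "\<lambda>l. 1 / real p ^ l \<le> d"] k by (simp add: l0_def)
  moreover have "1 / real p ^ k \<le> real p * d" using l0 assms(1) unfolding k by (simp add: field_simps)
  ultimately show ?thesis using that[of k] by linarith
qed

text \<open>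
  The \<open>p\<close>-adic radius at \<open>n\<close> is chosen comparable to the real radius at \<open>p ^ i * n\<close>. Overlaps in
  the two worlds are then comparable, so quasi-independence carries over.
\<close>
lemma limsup_nbhd_not_negligible_small:
  assumes p: "prime p" and QIA: "QIA p" and K: "\<And>n. n \<in> K \<Longrightarrow> 0 < n \<and> multiplicity p n = i"
    and pos: "\<And>n. n \<in> K \<Longrightarrow> 0 < \<rho> n" and small: "\<And>n. n \<in> K \<Longrightarrow> real n * \<rho> n < 1 / (4 * real p)"
    and div: "unbounded_sum K (\<lambda>n. real (totient n) * \<rho> n)"
  shows "\<not> negligible (limsup_nbhd K \<rho>)"
proof -
  have p1: "1 < p" using p by (rule prime_gt_1_nat)
  let ?q = "p ^ i"
  have q0: "0 < ?q" using p1 by simp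
  let ?\<mu> = "measure (Zp_haar p)"
  let ?w = "\<lambda>n. real (totient n) * \<rho> n"
  interpret haar: prob_space "Zp_haar p"
    using is_Zp_haar_Zp_haar[OF p] by (intro prob_spaceI) (simp add: is_Zp_haar_def)
  \<comment> \<open>The exact power of \<open>p\<close> is stripped from the denominators, since a
    reduced fraction lies in \<open>Zp p\<close> only if \<open>p\<close> does not divide its
    denominator.\<close>
  define L where "L = {n. ?q * n \<in> K}"
  have K_eq: "K = (\<lambda>n. ?q * n) ` L"
  proof (intro equalityI subsetI)
    fix n assume n: "n \<in> K"
    have "?q dvd n" using K[OF n] by (metis multiplicity_dvd)
    thus "n \<in> (\<lambda>n. ?q * n) ` L" using n by (auto simp: L_def elim!: dvdE)
  qed (auto simp: L_def)
  have inj: "inj_on (\<lambda>n. ?q * n) A" for A using q0 by (auto simp: inj_on_def)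
  have L: "0 < n" "\<not> p dvd n" if "n \<in> L" for n
  proof -
    have n: "0 < ?q * n" "multiplicity p (?q * n) = i" using K[of "?q * n"] that unfolding L_def by blast+
    thus "0 < n" by simp
    show "\<not> p dvd n"
    proof
      assume "p dvd n"
      hence "p ^ Suc i dvd ?q * n" by (simp add: mult.commute mult_dvd_mono)
      hence "Suc i \<le> multiplicity p (?q * n)"
        using n(1) p1 by (intro multiplicity_geI) auto
      thus False using n(2) by simp
    qed
  qed
  \<comment> \<open>The factor \<open>p ^ i\<close> makes up for the stripped power. The 2 lets each
    of two radii use less than half of the room in the smallness condition of
    \<open>card_close_pairs_le_padic\<close>.\<close>
  define d where "d n = 2 * real ?q * \<rho> (?q * n)" for n
  have d: "0 < d n" "d n < 1" "4 * real n * (real p * d n) < 2" if "n \<in> L" for n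
  proof -
    have n: "?q * n \<in> K" "1 \<le> real n" using that L[OF that] by (auto simp: L_def)
    show d0: "0 < d n" using pos[OF n(1)] q0 by (simp add: d_def)
    have "real n * d n < 2 * (1 / (4 * real p))" using small[OF n(1)] by (simp add: d_def mult_ac)
    also have "\<dots> = 1 / (2 * real p)" by simp
    finally have *: "real n * d n < 1 / (2 * real p)" .
    thus "4 * real n * (real p * d n) < 2" using p1 by (simp add: field_simps)
    have "d n \<le> real n * d n" using n(2) d0 by simp
    also have "\<dots> < 1 / (2 * real p)" by (rule *)
    also have "\<dots> \<le> 1" using p1 by (simp add: divide_le_eq)
    finally show "d n < 1" .
  qed
  have "\<exists>k. \<forall>n\<in>L. d n < 1 / real p ^ k n \<and> 1 / real p ^ k n \<le> real p * d n"
    using ex_padic_radius[OF p1] d by (intro bchoice ballI) metis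
  then obtain k where k: "\<And>n. n \<in> L \<Longrightarrow> d n < 1 / real p ^ k n"
    "\<And>n. n \<in> L \<Longrightarrow> 1 / real p ^ k n \<le> real p * d n" by blast
  define \<Psi> where "\<Psi> n = (if n \<in> L then 1 / real p ^ k n else 0)" for n
  define E where "E n = padic_approx p \<Psi> n" for n
  have \<Psi>: "\<Psi> n = 1 / real p ^ k n" if "n \<in> L" for n using that by (simp add: \<Psi>_def)
  have k_large: "2 * n < p ^ k n" if "n \<in> L" for n
  proof -
    have "2 * real n * (1 / real p ^ k n) \<le> 2 * real n * (real p * d n)"
      using k(2)[OF that] by (intro mult_left_mono) auto
    also have "\<dots> < 1" using d(3)[OF that] by simp
    finally have "real (2 * n) < real (p ^ k n)" using p1 by (simp add: field_simps)
    thus ?thesis by (simp only: of_nat_less_iff)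
  qed
  have overlap: "min (\<rho> (?q * m)) (\<rho> (?q * n)) * real (card (close_pairs (?q * m) (?q * n) (\<rho> (?q * m) + \<rho> (?q * n))))
      \<le> real ?q * ?\<mu> (E m \<inter> E n)" if m: "m \<in> L" and n: "n \<in> L" for m n
  proof -
    let ?r = "\<rho> (?q * m)" and ?s = "\<rho> (?q * n)"
    \<comment> \<open>The smaller exponent, that is the larger radius, decides whether two balls
      meet; the larger exponent gives the measure of their intersection.\<close>
    let ?k = "min (k m) (k n)" and ?l = "max (k m) (k n)"
    let ?P = "padic_close_pairs p m n ?k"
    have rs: "0 < ?r" "0 < ?s" using pos m n by (auto simp: L_def)
    have half: "real p ^ i * real p ^ ?k * \<rho> (?q * x) < 1 / 2" if x: "x \<in> L" "?k \<le> k x" for x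
    proof -
      have "real p ^ ?k * d x \<le> real p ^ k x * d x"
        using d(1)[OF x(1)] p1 x(2) by (intro mult_right_mono power_increasing) auto
      also have "\<dots> < 1" using k(1)[OF x(1)] p1 by (simp add: field_simps)
      finally show ?thesis by (simp add: d_def mult_ac)
    qed
    have "real p ^ i * real p ^ ?k * (?r + ?s) < 1" using half[OF m] half[OF n] by (simp add: distrib_left)
    hence "card (close_pairs (?q * m) (?q * n) (?r + ?s)) \<le> ?q * ?q * card ?P"
      using L[OF m] L[OF n] by (intro card_close_pairs_le_padic p)
    hence "real (card (close_pairs (?q * m) (?q * n) (?r + ?s))) \<le> real (?q * ?q * card ?P)" by (rule of_nat_mono)
    hence "min ?r ?s * real (card (close_pairs (?q * m) (?q * n) (?r + ?s))) \<le> min ?r ?s * real (?q * ?q * card ?P)"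
      using rs by (intro mult_left_mono) auto
    also have "\<dots> = real ?q * (real (card ?P) * (real ?q * min ?r ?s))" by simp
    also have "\<dots> \<le> real ?q * (real (card ?P) * (1 / real p ^ ?l))"
    proof (intro mult_left_mono)
      have "real ?q * min ?r ?s \<le> 1 / real p ^ k x" if "x = m \<or> x = n" for x
      proof -
        have x: "min ?r ?s \<le> \<rho> (?q * x)" "0 < \<rho> (?q * x)" "d x < 1 / real p ^ k x"
          using that rs k(1)[OF m] k(1)[OF n] by auto
        have "real ?q * min ?r ?s \<le> real ?q * \<rho> (?q * x)" using x(1) by (intro mult_left_mono) auto
        also have "\<dots> \<le> d x" using x(2) by (simp add: d_def)
        finally show ?thesis using x(3) by linarith
      qed
      thus "real ?q * min ?r ?s \<le> 1 / real p ^ ?l" unfolding max_def by metis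
    qed auto
    also have "\<dots> \<le> real ?q * ?\<mu> (E m \<inter> E n)"
      using measure_padic_approx_Int_ge[OF p L[OF m] \<Psi>[OF m] k_large[OF m] L[OF n] \<Psi>[OF n] k_large[OF n]] q0
      unfolding E_def by (intro mult_left_mono) auto
    finally show ?thesis .
  qed
  have lower: "?w (?q * n) \<le> real ?q * ?\<mu> (E n)" if n: "n \<in> L" for n
  proof -
    let ?N = "?q * n"
    have r: "0 < \<rho> ?N" using pos n by (simp add: L_def)
    \<comment> \<open>The lower bound for a single measure is the overlap estimate with
      \<open>m = n\<close>, where the diagonal already supplies \<open>totient ?N\<close> close
      pairs.\<close>
    have "(\<lambda>s. (s, s)) ` {s. s < ?N \<and> coprime s ?N} \<subseteq> close_pairs ?N ?N (\<rho> ?N + \<rho> ?N)"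
      using r by (auto simp: close_pairs_def)
    hence "card ((\<lambda>s. (s, s)) ` {s. s < ?N \<and> coprime s ?N}) \<le> card (close_pairs ?N ?N (\<rho> ?N + \<rho> ?N))"
      by (rule card_mono[OF finite_close_pairs])
    hence "totient ?N \<le> card (close_pairs ?N ?N (\<rho> ?N + \<rho> ?N))"
      by (subst (asm) card_image) (auto simp: inj_on_def card_coprime_lessThan simp del: coprime_mult_right_iff)
    hence "\<rho> ?N * real (totient ?N) \<le> \<rho> ?N * real (card (close_pairs ?N ?N (\<rho> ?N + \<rho> ?N)))"
      using r by (intro mult_left_mono) auto
    thus ?thesis using overlap[OF n n] by (simp add: mult.commute)
  qed
  have upper: "?\<mu> (E n) \<le> 6 * real p * real ?q * ?w (?q * n)" if n: "n \<in> L" for n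
  proof -
    have "?\<mu> (E n) \<le> 3 * real (totient n) * (1 / real p ^ k n)"
      using measure_padic_approx_le[where \<Psi> = \<Psi> and k = "k n", OF p L[OF n] \<Psi>[OF n]] by (simp add: E_def)
    also have "\<dots> \<le> 3 * real (totient (?q * n)) * (real p * d n)"
      using k(2)[OF n] L[OF n] q0 by (intro mult_mono) (auto intro!: totient_dvd_mono)
    finally show ?thesis by (simp add: d_def mult_ac)
  qed
  have E0: "?\<mu> (E n) = 0" if "n \<notin> L" for n
    unfolding E_def using that by (intro measure_padic_approx_zero[OF p]) (simp add: \<Psi>_def)
  have sum_L: "(\<Sum>n=1..N. ?\<mu> (E n)) = (\<Sum>n\<in>{1..N} \<inter> L. ?\<mu> (E n))" for N
    using E0 by (intro sum.mono_neutral_right) auto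
  have reindex: "sum ?w ((\<lambda>n. ?q * n) ` A) = (\<Sum>n\<in>A. ?w (?q * n))" for A
    by (subst sum.reindex[OF inj]) simp
  have large: "\<exists>N0. \<forall>N\<ge>N0. B \<le> (\<Sum>n\<in>{1..N} \<inter> L. ?w (?q * n))" for B
  proof -
    obtain F where F: "finite F" "F \<subseteq> K" "B \<le> sum ?w F" using div unfolding unbounded_sum_def by blast
    obtain A where A: "A \<subseteq> L" "F = (\<lambda>n. ?q * n) ` A" using F(2) unfolding K_eq by (meson subset_imageE)
    have finA: "finite A" using F(1) A(2) finite_imageD[OF _ inj] by blast
    then obtain N0 where N0: "\<And>n. n \<in> A \<Longrightarrow> n \<le> N0"
      unfolding finite_nat_set_iff_bounded_le by blast
    have "B \<le> (\<Sum>n\<in>{1..N} \<inter> L. ?w (?q * n))" if "N0 \<le> N" for N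
    proof -
      have "A \<subseteq> {1..N} \<inter> L"
      proof
        fix n assume n: "n \<in> A"
        hence "n \<in> L" using A(1) by blast
        thus "n \<in> {1..N} \<inter> L" using N0[OF n] L(1)[of n] that by simp
      qed
      hence "(\<Sum>n\<in>A. ?w (?q * n)) \<le> (\<Sum>n\<in>{1..N} \<inter> L. ?w (?q * n))"
        using pos by (intro sum_mono2) (auto simp: L_def less_imp_le)
      thus ?thesis using F(3) unfolding A(2) reindex by simp
    qed
    thus ?thesis by blast
  qed
  have "(\<Sum>n. emeasure (Zp_haar p) (padic_approx p \<Psi> (Suc n))) = \<infinity>"
  proof (rule ccontr)
    assume "\<not> ?thesis"
    hence fin: "(\<Sum>n. ennreal (?\<mu> (E (Suc n)))) \<noteq> \<infinity>"
      unfolding E_def by (simp add: haar.emeasure_eq_measure)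
    have summ: "summable (\<lambda>n. ?\<mu> (E (Suc n)))"
      using fin by (intro summable_suminf_not_top) auto
    define T where "T = (\<Sum>n. ?\<mu> (E (Suc n)))"
    obtain N where N: "real ?q * T + 1 \<le> (\<Sum>n\<in>{1..N} \<inter> L. ?w (?q * n))"
      using large[of "real ?q * T + 1"] by blast
    have "(\<Sum>n\<in>{1..N} \<inter> L. ?w (?q * n)) \<le> (\<Sum>n\<in>{1..N} \<inter> L. real ?q * ?\<mu> (E n))"
      by (intro sum_mono lower) auto
    also have "\<dots> = real ?q * (\<Sum>n=1..N. ?\<mu> (E n))" unfolding sum_L by (simp add: sum_distrib_left)
    also have "(\<Sum>n=1..N. ?\<mu> (E n)) = (\<Sum>n<N. ?\<mu> (E (Suc n)))"
      by (simp add: sum.atLeast1_atMost_eq)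
    also have "real ?q * \<dots> \<le> real ?q * T"
      unfolding T_def using summ by (intro mult_left_mono sum_le_suminf) auto
    finally show False using N by simp
  qed
  hence "QIA_for p \<Psi>"
    using QIA unfolding QIA_def by (auto simp: \<Psi>_def)
  define Q where "Q N = (\<Sum>n=1..N. ?\<mu> (E n))\<^sup>2 / (\<Sum>m=1..N. \<Sum>n=1..N. ?\<mu> (E m \<inter> E n))" for N
  have "limsup (\<lambda>N. ereal (Q N)) > 0"
    using \<open>QIA_for p \<Psi>\<close> unfolding QIA_for_def Q_def E_def .
  then obtain \<eta> where \<eta>: "0 < ereal \<eta>" "ereal \<eta> < limsup (\<lambda>N. ereal (Q N))"
    using ereal_dense2 by blast
  have freq: "\<exists>N\<ge>N0. \<eta> < Q N" for N0
  proof (rule ccontr)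
    assume "\<not> ?thesis"
    hence "eventually (\<lambda>N. ereal (Q N) \<le> ereal \<eta>) sequentially"
      by (auto simp: eventually_sequentially not_less)
    hence "limsup (\<lambda>N. ereal (Q N)) \<le> ereal \<eta>" by (rule Limsup_bounded)
    thus False using \<eta>(2) by simp
  qed
  \<comment> \<open>One \<open>p ^ i\<close> comes from \<open>overlap\<close>, the squared factor
    from \<open>upper\<close>, and \<open>1 / \<eta>\<close> from quasi-independence.\<close>
  define C where "C = real ?q * (6 * real p * real ?q)\<^sup>2 / \<eta>"
  have C: "0 < C" using \<eta>(1) q0 p1 by (simp add: C_def)
  show ?thesis
  proof (rule limsup_nbhd_not_negligible[OF _ C])
    fix n assume n: "n \<in> K"
    have "1 * \<rho> n \<le> real n * \<rho> n" using K[OF n] pos[OF n] by (intro mult_right_mono) auto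
    also have "\<dots> < 1 / (4 * real p)" by (rule small[OF n])
    also have "\<dots> \<le> 1" using p1 by (simp add: divide_le_eq)
    finally show "0 < n \<and> 0 \<le> \<rho> n \<and> \<rho> n \<le> 1" using K[OF n] pos[OF n] by simp
  next
    fix B
    obtain N0 where N0: "\<And>N. N0 \<le> N \<Longrightarrow> B \<le> (\<Sum>n\<in>{1..N} \<inter> L. ?w (?q * n))" using large by blast
    obtain N where N: "N0 \<le> N" "\<eta> < Q N" using freq by blast
    define A where "A = {1..N} \<inter> L"
    let ?F = "(\<lambda>n. ?q * n) ` A"
    let ?D = "\<Sum>m=1..N. \<Sum>n=1..N. ?\<mu> (E m \<inter> E n)"
    have \<eta>0: "0 < \<eta>" using \<eta>(1) by simp
    have "0 \<le> ?D" by (intro sum_nonneg) auto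
    \<comment> \<open>A vanishing denominator would make the quotient 0 by the convention
      \<open>x / 0 = 0\<close>, contradicting \<open>\<eta> < Q N\<close>.\<close>
    moreover have "?D \<noteq> 0" using N(2) \<eta>0 unfolding Q_def by auto
    ultimately have "0 < ?D" by simp
    hence D: "?D \<le> (\<Sum>n=1..N. ?\<mu> (E n))\<^sup>2 / \<eta>"
      using N(2) \<eta>0 unfolding Q_def by (simp add: field_simps)
    have "(\<Sum>m\<in>?F. \<Sum>n\<in>?F. min (\<rho> m) (\<rho> n) * real (card (close_pairs m n (\<rho> m + \<rho> n))))
      = (\<Sum>m\<in>A. \<Sum>n\<in>A. min (\<rho> (?q * m)) (\<rho> (?q * n)) * real (card (close_pairs (?q * m) (?q * n) (\<rho> (?q * m) + \<rho> (?q * n)))))"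
      by (simp add: sum.reindex[OF inj])
    also have "\<dots> \<le> (\<Sum>m\<in>A. \<Sum>n\<in>A. real ?q * ?\<mu> (E m \<inter> E n))"
      by (intro sum_mono overlap) (auto simp: A_def)
    also have "\<dots> = real ?q * (\<Sum>m\<in>A. \<Sum>n\<in>A. ?\<mu> (E m \<inter> E n))" by (simp add: sum_distrib_left)
    also have "\<dots> \<le> real ?q * (\<Sum>m=1..N. \<Sum>n\<in>A. ?\<mu> (E m \<inter> E n))"
      by (intro mult_left_mono sum_mono2) (auto simp: A_def intro!: sum_nonneg)
    also have "\<dots> \<le> real ?q * ?D"
      by (intro mult_left_mono sum_mono sum_mono2) (auto simp: A_def)
    also have "\<dots> \<le> real ?q * ((\<Sum>n=1..N. ?\<mu> (E n))\<^sup>2 / \<eta>)" using D by (intro mult_left_mono) auto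
    also have "\<dots> \<le> real ?q * ((6 * real p * real ?q * sum ?w ?F)\<^sup>2 / \<eta>)"
    proof (intro mult_left_mono divide_right_mono power_mono)
      have "(\<Sum>n=1..N. ?\<mu> (E n)) \<le> (\<Sum>n\<in>A. 6 * real p * real ?q * ?w (?q * n))"
        unfolding sum_L A_def by (intro sum_mono upper) auto
      thus "(\<Sum>n=1..N. ?\<mu> (E n)) \<le> 6 * real p * real ?q * sum ?w ?F"
        unfolding reindex by (simp add: sum_distrib_left)
    qed (use \<eta>0 in \<open>auto intro!: sum_nonneg\<close>)
    also have "\<dots> = C * (sum ?w ?F)\<^sup>2" unfolding C_def power_mult_distrib by simp
    finally show "\<exists>F. finite F \<and> F \<subseteq> K \<and> B \<le> sum ?w F \<and>
      (\<Sum>m\<in>F. \<Sum>n\<in>F. min (\<rho> m) (\<rho> n) * real (card (close_pairs m n (\<rho> m + \<rho> n)))) \<le> C * (sum ?w F)\<^sup>2"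
      using N0[OF N(1)] by (intro exI[of _ ?F]) (auto simp: A_def K_eq reindex)
  qed
qed

section \<open>The circle\<close>

lemma circle_approx_eq:
  assumes "0 < n"
  shows "circle_approx \<psi> n = {0..<1} \<inter> reduced_nbhd n (\<psi> n)"
proof (intro equalityI subsetI)
  fix x assume "x \<in> circle_approx \<psi> n"
  then obtain a y where a: "coprime a n" "\<bar>y - real a / real n\<bar> \<le> \<psi> n" and x: "x = frac y"
    unfolding circle_approx_def by (auto simp: abs_le_iff algebra_simps)
  have "y \<in> reduced_nbhd n (\<psi> n)"
    using a by (auto simp: reduced_nbhd_def intro!: exI[of _ "int a"])
  hence "y + of_int (- \<lfloor>y\<rfloor>) \<in> reduced_nbhd n (\<psi> n)"
    using periodic_int[where x = y and k = "- \<lfloor>y\<rfloor>", OF reduced_nbhd_periodic[OF assms]] by blast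
  thus "x \<in> {0..<1} \<inter> reduced_nbhd n (\<psi> n)" using x frac_lt_1[of y] by (simp add: frac_def)
next
  fix x assume x: "x \<in> {0..<1} \<inter> reduced_nbhd n (\<psi> n)"
  then obtain a where a: "coprime a (int n)" "\<bar>x - of_int a / real n\<bar> \<le> \<psi> n"
    by (auto simp: reduced_nbhd_def)
  \<comment> \<open>Shifting by 1 before reducing modulo \<open>n\<close> puts the representative in
    \<open>1..n\<close>, the numerator range of \<open>circle_approx\<close>, instead of
    \<open>0..n - 1\<close>.\<close>
  define k b where "k = (a - 1) div int n" and "b = nat ((a - 1) mod int n + 1)"
  have b: "int b = a - k * int n" "1 \<le> b" "b \<le> n"
  proof -
    have "0 \<le> (a - 1) mod int n" "(a - 1) mod int n < int n" using assms by auto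
    thus "int b = a - k * int n" "1 \<le> b" "b \<le> n"
      by (auto simp: b_def k_def minus_div_mult_eq_mod[symmetric] algebra_simps)
  qed
  have "coprime (int b) (int n)" using a(1) coprime_add_mult_iff[of a "- k" "int n"] b(1) by simp
  hence cop: "coprime b n" by simp
  define y where "y = x - of_int k"
  have "of_int a / real n = real b / real n + of_int k"
  proof -
    have "real b = of_int a - of_int k * real n" using b(1) by (metis of_int_diff of_int_mult of_int_of_nat_eq)
    thus ?thesis using assms by (simp add: field_simps)
  qed
  hence "\<bar>y - real b / real n\<bar> \<le> \<psi> n" using a(2) by (simp add: y_def algebra_simps)
  hence "y \<in> {real b / real n - \<psi> n..real b / real n + \<psi> n}" by (auto simp: abs_le_iff)
  moreover have "frac y = x"
    unfolding frac_unique_iff using x by (simp add: y_def)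
  ultimately show "x \<in> circle_approx \<psi> n"
    unfolding circle_approx_def using b cop by (auto intro!: bexI[of _ b] image_eqI[of _ frac y])
qed

lemma circle_limsup_eq: "circle_limsup \<psi> = {0..<1} \<inter> limsup_nbhd {1..} \<psi>"
proof -
  have "{n. 1 \<le> n \<and> x \<in> circle_approx \<psi> n} = {n \<in> {1..}. x \<in> reduced_nbhd n (\<psi> n)}" if "x \<in> {0..<1}" for x
    using that by (auto simp: circle_approx_eq)
  thus ?thesis by (auto simp: circle_limsup_def limsup_nbhd_def)
qed

section \<open>Lebesgue measure of the approximation sets on the circle\<close>

lemma emeasure_circle:
  assumes "A \<in> sets borel" "A \<subseteq> {0..<1}"
  shows "emeasure circle_measure A = emeasure lborel A"
  using assms unfolding circle_measure_def by (subst emeasure_restrict_space) auto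

lemma prob_space_circle: "prob_space circle_measure"
proof (rule prob_spaceI)
  have "space circle_measure = {0..<1}" by (simp add: circle_measure_def space_restrict_space)
  thus "emeasure circle_measure (space circle_measure) = 1" using emeasure_circle[of "{0..<1}"] by simp
qed

lemma sets_circle:
  assumes "A \<in> sets borel" "A \<subseteq> {0..<1}"
  shows "A \<in> sets circle_measure"
  using assms unfolding circle_measure_def by (subst sets_restrict_space_iff) auto

lemma circle_approx_borel: "0 < n \<Longrightarrow> circle_approx \<psi> n \<in> sets borel"
  by (simp add: circle_approx_eq)

lemma circle_approx_subset: "0 < n \<Longrightarrow> circle_approx \<psi> n \<subseteq> {0..<1}"
  by (auto simp: circle_approx_eq)

text \<open>For \<open>\<psi> n > 1 / \<phi> n\<close> the minimum contributes weight 1 and the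
  bound is trivial. Otherwise \<open>\<psi> n \<le> 1\<close>, so the relevant numerators lie in
  \<open>{- n..2 * n}\<close> and fall into four periods, giving at most \<open>4 * \<phi> n\<close>
  intervals of length \<open>2 * \<psi> n\<close>.\<close>

lemma emeasure_circle_approx_le:
  assumes n: "0 < n" and \<psi>: "0 \<le> \<psi> n"
  shows "emeasure circle_measure (circle_approx \<psi> n) \<le> ennreal (8 * (real (totient n) * min (\<psi> n) (1 / real (totient n))))"
proof -
  have t: "1 \<le> real (totient n)" using n by (simp add: Suc_le_eq)
  show ?thesis
  proof (cases "\<psi> n \<le> 1 / real (totient n)")
    case False
    hence "real (totient n) * min (\<psi> n) (1 / real (totient n)) = 1" using n by (simp add: min_def)
    moreover have "emeasure circle_measure (circle_approx \<psi> n) \<le> 1"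
      using prob_space.emeasure_le_1[OF prob_space_circle] .
    moreover have "(1::ennreal) \<le> ennreal 8" by simp
    ultimately show ?thesis by (metis mult.right_neutral order_trans)
  next
    case True
    have "1 / real (totient n) \<le> 1" using t frac_le[of 1 1 1 "real (totient n)"] by simp
    hence \<psi>1: "\<psi> n \<le> 1" using True by linarith
    let ?S = "{s. s < n \<and> coprime s n}"
    let ?A = "(\<lambda>(e, s). e * int n + int s) ` ({-1..2} \<times> ?S)"
    have finA: "finite ?A" by simp
    have cardA: "card ?A \<le> 4 * totient n"
      using card_image_le[of "{-1..2::int} \<times> ?S" "\<lambda>(e, s). e * int n + int s"]
      by (simp add: card_cartesian_product card_coprime_lessThan)
    have sub: "circle_approx \<psi> n \<subseteq> (\<Union>a\<in>?A. cball (of_int a / real n) (\<psi> n))"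
    proof
      fix x assume "x \<in> circle_approx \<psi> n"
      hence x: "0 \<le> x" "x < 1" "x \<in> reduced_nbhd n (\<psi> n)" using circle_approx_eq[OF n] by auto
      then obtain a where a: "coprime a (int n)" "\<bar>x - of_int a / real n\<bar> \<le> \<psi> n"
        by (auto simp: reduced_nbhd_def)
      have "-1 \<le> of_int a / real n" "of_int a / real n \<le> 2" using a(2) x \<psi>1 by linarith+
      hence "- real n \<le> of_int a" "of_int a \<le> 2 * real n" using n by (simp_all add: field_simps)
      hence "- int n \<le> a" "a \<le> 2 * int n" by linarith+
      hence "(- 1 * int n) div int n \<le> a div int n" "a div int n \<le> (2 * int n) div int n"
        using n by (intro zdiv_mono1; simp)+
      moreover have "(- 1 * int n) div int n = - 1" "(2 * int n) div int n = 2"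
        using n nonzero_mult_div_cancel_right[of "int n" "- 1"] nonzero_mult_div_cancel_right[of "int n" 2] by simp_all
      ultimately have e: "a div int n \<in> {-1..2}" by simp
      define s where "s = nat (a mod int n)"
      have s: "int s = a mod int n" using n by (simp add: s_def)
      have "coprime (int s) (int n)" using a(1) unfolding s
        by (simp add: coprime_iff_gcd_eq_1 gcd.commute[of _ "int n"] gcd_red_int[symmetric])
      moreover have "s < n" using s n by (metis of_nat_0_less_iff of_nat_less_iff pos_mod_bound)
      moreover have "a = a div int n * int n + int s" unfolding s by simp
      ultimately have "a \<in> ?A" using e by (intro image_eqI[of _ _ "(a div int n, s)"]) auto
      thus "x \<in> (\<Union>a\<in>?A. cball (of_int a / real n) (\<psi> n))"
        using a(2) by (intro UN_I[of a]) (auto simp: dist_real_def abs_minus_commute)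
    qed
    have "emeasure circle_measure (circle_approx \<psi> n) = emeasure lborel (circle_approx \<psi> n)"
      using n by (intro emeasure_circle circle_approx_borel circle_approx_subset)
    also have "\<dots> \<le> emeasure lborel (\<Union>a\<in>?A. cball (of_int a / real n) (\<psi> n))"
      using sub by (intro emeasure_mono) auto
    also have "\<dots> \<le> (\<Sum>a\<in>?A. emeasure lborel (cball (of_int a / real n) (\<psi> n)))"
      using finA by (intro emeasure_subadditive_finite) auto
    also have "\<dots> = (\<Sum>a\<in>?A. ennreal (2 * \<psi> n))"
      using \<psi> by (intro sum.cong) (simp_all add: cball_eq_atLeastAtMost)
    also have "\<dots> = ennreal (real (card ?A) * (2 * \<psi> n))"
      using \<psi> by (simp add: ennreal_mult ennreal_of_nat_eq_real_of_nat)
    also have "\<dots> \<le> ennreal (real (4 * totient n) * (2 * \<psi> n))"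
      using \<psi> cardA by (intro ennreal_leI mult_right_mono) auto
    also have "real (4 * totient n) * (2 * \<psi> n) = 8 * (real (totient n) * min (\<psi> n) (1 / real (totient n)))"
      using True by simp
    finally show ?thesis .
  qed
qed

theorem theorem1:
  fixes p :: nat and \<psi> :: "nat \<Rightarrow> real" and S :: "nat set"
  assumes "prime p"
    and "QIA p"
    and "\<forall>n\<ge>1. 0 \<le> \<psi> n"
    and "S \<subseteq> {1..}"
    and "\<forall>n\<ge>1. n \<notin> S \<longrightarrow> \<psi> n = 0"
    and "\<exists>N::nat. \<forall>n\<in>S. \<not> p ^ (N + 1) dvd n"
  shows "emeasure circle_measure (circle_limsup \<psi>) =
    (if (\<Sum>n. emeasure circle_measure (circle_approx \<psi> (Suc n))) = \<infinity> then 1 else 0)"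
proof (cases "(\<Sum>n. emeasure circle_measure (circle_approx \<psi> (Suc n))) = \<infinity>")
  case False
  interpret circle: prob_space circle_measure by (rule prob_space_circle)
  let ?A = "\<lambda>n. circle_approx \<psi> (Suc n)"
  have sets: "?A n \<in> sets circle_measure" for n
    by (intro sets_circle circle_approx_borel circle_approx_subset) auto
  have "summable (\<lambda>n. measure circle_measure (?A n))"
    using False by (intro summable_suminf_not_top) (auto simp: circle.emeasure_eq_measure)
  hence "AE x in circle_measure. eventually (\<lambda>n. x \<in> space circle_measure - ?A n) sequentially"
    using sets by (intro borel_cantelli_AE1) (auto simp: circle.emeasure_eq_measure)
  hence "AE x in circle_measure. x \<notin> circle_limsup \<psi>"
  proof (rule AE_mp[OF _ AE_I2], intro impI)
    fix x assume "eventually (\<lambda>n. x \<in> space circle_measure - ?A n) sequentially"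
    then obtain l where l: "\<And>n. l \<le> n \<Longrightarrow> x \<notin> ?A n" by (auto simp: eventually_sequentially)
    \<comment> \<open>The sets are indexed by \<open>Suc n\<close>, so avoiding them from index
      \<open>l\<close> on leaves only denominators up to \<open>l\<close>.\<close>
    have "{n. 1 \<le> n \<and> x \<in> circle_approx \<psi> n} \<subseteq> {..l}"
    proof
      fix n assume n: "n \<in> {n. 1 \<le> n \<and> x \<in> circle_approx \<psi> n}"
      hence "n = Suc (n - 1)" by simp
      hence "\<not> l \<le> n - 1" using l[of "n - 1"] n by auto
      thus "n \<in> {..l}" by simp
    qed
    thus "x \<notin> circle_limsup \<psi>" by (auto simp: circle_limsup_def intro: finite_subset)
  qed
  moreover have "circle_limsup \<psi> \<in> sets circle_measure"
    unfolding circle_limsup_eq by (intro sets_circle) auto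
  moreover from this have "{x \<in> space circle_measure. \<not> x \<notin> circle_limsup \<psi>} = circle_limsup \<psi>"
    using sets.sets_into_space by blast
  ultimately have "emeasure circle_measure (circle_limsup \<psi>) = 0"
    by (simp add: AE_iff_measurable)
  thus ?thesis using False by simp
next
  case True
  define \<rho> where "\<rho> n = min (\<psi> n) (1 / real (totient n))" for n
  define w where "w n = real (totient n) * \<rho> n" for n
  obtain N where N: "\<And>n. n \<in> S \<Longrightarrow> \<not> p ^ (N + 1) dvd n" using assms(6) by blast
  \<comment> \<open>Positive radii are required by \<open>limsup_nbhd_scale\<close>; the discarded
    denominators have weight 0.\<close>
  define K0 where "K0 = {n. 1 \<le> n \<and> 0 < \<psi> n}"
  \<comment> \<open>Each class has constant valuation at \<open>p\<close>, as
    \<open>limsup_nbhd_zero_one\<close> requires, and \<open>b\<close> records whether the transfer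
    or the sieve applies. The hypothesis on \<open>S\<close> bounds \<open>i\<close> by
    \<open>N\<close>.\<close>
  define K where "K i b = {n \<in> K0. multiplicity p n = i \<and> (real n * \<rho> n < 1 / (4 * real p) \<longleftrightarrow> b)}" for i b
  have p1: "1 < p" using assms(1) by (rule prime_gt_1_nat)
  have \<rho>: "0 < \<rho> n" "\<rho> n \<le> 1" "\<rho> n \<le> \<psi> n" if "n \<in> K0" for n
  proof -
    have "1 \<le> real (totient n)" using that by (simp add: K0_def Suc_le_eq)
    moreover from this have "0 < real (totient n)" by linarith
    ultimately have le1: "1 / real (totient n) \<le> 1" and "0 < 1 / real (totient n)"
      using frac_le[of 1 1 1 "real (totient n)"] by (linarith, simp only: zero_less_divide_1_iff)
    thus "0 < \<rho> n" "\<rho> n \<le> \<psi> n" using that by (auto simp: \<rho>_def K0_def)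
    show "\<rho> n \<le> 1" unfolding \<rho>_def using le1 by (rule min.coboundedI2)
  qed
  have unb: "unbounded_sum K0 w"
  proof (rule ccontr)
    assume "\<not> ?thesis"
    then obtain B where B: "\<And>F. finite F \<Longrightarrow> F \<subseteq> K0 \<Longrightarrow> sum w F < B"
      unfolding unbounded_sum_def by (meson not_less)
    have w0: "0 \<le> w n" if "1 \<le> n" for n using assms(3) that by (simp add: w_def \<rho>_def)
    have "(\<Sum>n<l. emeasure circle_measure (circle_approx \<psi> (Suc n))) \<le> ennreal (8 * B)" for l
    proof -
      have "(\<Sum>n<l. emeasure circle_measure (circle_approx \<psi> (Suc n))) \<le> (\<Sum>n<l. ennreal (8 * w (Suc n)))"
        unfolding w_def \<rho>_def using assms(3) by (intro sum_mono emeasure_circle_approx_le) auto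
      also have "\<dots> = ennreal (\<Sum>n<l. 8 * w (Suc n))" using w0 by (intro sum_ennreal) auto
      also have "(\<Sum>n<l. 8 * w (Suc n)) = 8 * (\<Sum>n=1..l. w n)"
        by (simp add: sum.atLeast1_atMost_eq sum_distrib_left)
      also have "(\<Sum>n=1..l. w n) = (\<Sum>n\<in>{1..l} \<inter> K0. w n)"
      proof (rule sum.mono_neutral_right)
        show "\<forall>n\<in>{1..l} - {1..l} \<inter> K0. w n = 0"
        proof
          fix n assume "n \<in> {1..l} - {1..l} \<inter> K0"
          hence "1 \<le> n" "\<not> 0 < \<psi> n" by (auto simp: K0_def)
          hence "\<psi> n = 0" using assms(3) by force
          thus "w n = 0" by (simp add: w_def \<rho>_def)
        qed
      qed auto
      also have "ennreal (8 * (\<Sum>n\<in>{1..l} \<inter> K0. w n)) \<le> ennreal (8 * B)"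
        using B[of "{1..l} \<inter> K0"] by (intro ennreal_leI) simp
      finally show ?thesis .
    qed
    hence "(\<Sum>n. emeasure circle_measure (circle_approx \<psi> (Suc n))) \<le> ennreal (8 * B)"
      by (intro suminf_le_const summableI)
    thus False using True by (simp add: top_unique)
  qed
  have K0_eq: "K0 = (\<Union>(i, b)\<in>{..N} \<times> UNIV. K i b)"
  proof -
    have "multiplicity p n \<le> N" if n: "n \<in> K0" for n
    proof (rule ccontr)
      assume "\<not> multiplicity p n \<le> N"
      hence "p ^ (N + 1) dvd n" by (intro multiplicity_dvd') simp
      moreover have "n \<in> S" using n assms(5) by (force simp: K0_def)
      ultimately show False using N by blast
    qed
    thus ?thesis by (auto simp: K_def)
  qed
  \<comment> \<open>Pigeonhole: one of the finitely many classes already carries divergence, and its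
    limsup set is contained in that of \<open>\<psi>\<close>.\<close>
  have "\<exists>j\<in>{..N} \<times> UNIV. unbounded_sum (case j of (i, b) \<Rightarrow> K i b) w"
  proof (rule unbounded_sum_UN)
    show "unbounded_sum (\<Union>j\<in>{..N} \<times> UNIV. case j of (i, b) \<Rightarrow> K i b) w"
      using unb unfolding K0_eq .
  next
    fix j n assume "n \<in> (case j of (i, b) \<Rightarrow> K i b)"
    hence "n \<in> K0" by (auto simp: K_def split: prod.splits)
    thus "0 \<le> w n" using \<rho>(1)[of n] by (simp add: w_def)
  qed simp
  then obtain i b where div: "unbounded_sum (K i b) w" by auto
  have K: "0 < n \<and> multiplicity p n = i" "n \<in> K0" if "n \<in> K i b" for n
    using that by (auto simp: K_def K0_def)
  have div': "unbounded_sum (K i b) (\<lambda>n. real (totient n) * \<rho> n)" using div unfolding w_def .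
  have nontrivial: "\<not> negligible (limsup_nbhd (K i b) \<rho>)"
  proof (cases b)
    case True
    show ?thesis
    proof (rule limsup_nbhd_not_negligible_small[OF assms(1,2) K(1) \<rho>(1)[OF K(2)] _ div'])
      fix n assume "n \<in> K i b"
      thus "real n * \<rho> n < 1 / (4 * real p)" using True by (simp add: K_def)
    qed
  next
    case False
    show ?thesis
    proof (rule limsup_nbhd_not_negligible_large[OF _ _ div'])
      fix n assume n: "n \<in> K i b"
      have "1 / (4 * real p) \<le> real n * \<rho> n" using n False by (simp add: K_def)
      thus "0 < n \<and> \<rho> n \<le> 1 \<and> 1 / (4 * real p) \<le> real n * \<rho> n"
        using K(1)[OF n] \<rho>(2)[OF K(2)[OF n]] by blast
    qed (use p1 in simp)
  qed
  have "negligible (- limsup_nbhd (K i b) \<rho>)"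
  proof (rule limsup_nbhd_zero_one[OF assms(1) K(1) \<rho>(1)[OF K(2)] _ nontrivial])
    fix e :: real assume e: "0 < e"
    have "{n \<in> K i b. e \<le> \<rho> n} \<subseteq> {n. 0 < n \<and> real (totient n) \<le> 1 / e}"
    proof
      fix n assume n: "n \<in> {n \<in> K i b. e \<le> \<rho> n}"
      hence n0: "0 < n" using K by blast
      hence t: "0 < real (totient n)" by simp
      have "e \<le> 1 / real (totient n)" using n by (auto simp: \<rho>_def)
      hence "real (totient n) \<le> 1 / e" using e t by (simp add: field_simps)
      thus "n \<in> {n. 0 < n \<and> real (totient n) \<le> 1 / e}" using n0 by simp
    qed
    thus "finite {n \<in> K i b. e \<le> \<rho> n}" using finite_totient_le finite_subset by blast
  qed
  moreover have "limsup_nbhd (K i b) \<rho> \<subseteq> limsup_nbhd {1..} \<psi>"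
  proof (rule limsup_nbhd_mono)
    show "K i b \<subseteq> {1..}" using K(1) by force
    show "\<rho> n \<le> \<psi> n" if "n \<in> K i b" for n by (rule \<rho>(3)[OF K(2)[OF that]])
  qed
  ultimately have neg: "negligible ({0..<1} - limsup_nbhd {1..} \<psi>)"
    using negligible_subset[of "- limsup_nbhd (K i b) \<rho>" "{0..<1} - limsup_nbhd {1..} \<psi>"] by blast
  interpret circle: prob_space circle_measure by (rule prob_space_circle)
  have "emeasure circle_measure ({0..<1} - limsup_nbhd {1..} \<psi>) = emeasure lborel ({0..<1} - limsup_nbhd {1..} \<psi>)"
    by (intro emeasure_circle) auto
  also have "\<dots> = emeasure lebesgue ({0..<1} - limsup_nbhd {1..} \<psi>)" by simp
  also have "\<dots> = 0" using neg by (simp add: negligible_iff_emeasure0)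
  finally have "measure circle_measure ({0..<1} - limsup_nbhd {1..} \<psi>) = 0" by (simp add: measure_def)
  moreover have "{0..<1} - limsup_nbhd {1..} \<psi> = space circle_measure - circle_limsup \<psi>"
    by (auto simp: circle_limsup_eq circle_measure_def space_restrict_space)
  moreover have "circle_limsup \<psi> \<in> sets circle_measure"
    unfolding circle_limsup_eq by (intro sets_circle) auto
  ultimately have "measure circle_measure (circle_limsup \<psi>) = 1"
    using circle.prob_compl[of "circle_limsup \<psi>"] by simp
  thus ?thesis using True by (simp add: circle.emeasure_eq_measure)
qed

end
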